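(* Let $d\in\{3,4\}$ and let $\sigma=\sigma_d$, where $\sigma_3=\frac76$ and $\sigma_4=\frac32-\delta$ for an arbitrary fixed $\delta\in(0,\frac12)$. There exists a constant $C$ such that for all $\lambda\in\mathbb{C}$ and all $\psi\in\ell^2(\mathbb{Z}^d)$ we have the estimate $$\|\psi\|_{\ell^{\frac{2\sigma}{\sigma-1}}(\mathbb{Z}^d)}\le C\,\|(\sqrt{1-\Delta}-\lambda)\psi\|_{\ell^{\frac{2\sigma}{\sigma+1}}(\mathbb{Z}^d)}.$$
   Context: $\Delta$ is the discrete Laplacian on $\mathbb{Z}^d$, $\Delta\psi(x)=\sum_{|x-y|=1}\psi(y)-2d\,\psi(x)$, and $\sqrt{1-\Delta}$ is the operator on $\ell^2(\mathbb{Z}^d)$ given by the Fourier multiplier $\omega(\xi)=\sqrt{1+\sum_{j=1}^d2(1-\cos\xi_j)}$, i.e. $\sqrt{1-\Delta}\,e^{ix\cdot\xi}=\omega(\xi)e^{ix\cdot\xi}$. The right-hand side is interpreted as $+\infty$ if $(\sqrt{1-\Delta}-\lambda)\psi\notin\ell^{2\sigma/(\sigma+1)}$. *)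

theory Defs
  imports "HOL-Analysis.Analysis"
begin

type_synonym 'd lattice = "int ^ 'd"

definition in_ell :: "real \<Rightarrow> ('a \<Rightarrow> complex) \<Rightarrow> bool" where
  "in_ell p f \<longleftrightarrow> (\<lambda>x. norm (f x) powr p) summable_on UNIV"

definition ell_norm :: "real \<Rightarrow> ('a \<Rightarrow> complex) \<Rightarrow> ennreal" where
  "ell_norm p f =
     (if in_ell p f then ennreal ((\<Sum>\<^sub>\<infinity>x. norm (f x) powr p) powr (1 / p)) else \<infinity>)"

definition plane_wave :: "real ^ 'd \<Rightarrow> 'd::finite lattice \<Rightarrow> complex" where
  "plane_wave \<xi> x = cis (\<Sum>i\<in>UNIV. of_int (x $ i) * \<xi> $ i)"

definition torus :: "(real ^ 'd::finite) measure" where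
  "torus = restrict_space lborel (cbox (\<chi> i. - pi) (\<chi> i. pi))"

(* g is the L^2-limit of the partial Fourier sums of \<psi>; such a g exists for every
   \<psi> with in_ell 2 \<psi> and is unique up to null sets. *)
definition is_fourier :: "('d::finite lattice \<Rightarrow> complex) \<Rightarrow> (real ^ 'd \<Rightarrow> complex) \<Rightarrow> bool" where
  "is_fourier \<psi> g \<longleftrightarrow>
     g \<in> borel_measurable torus \<and> integrable torus (\<lambda>\<xi>. (norm (g \<xi>))\<^sup>2) \<and>
     ((\<lambda>X. \<integral>\<^sup>+ \<xi>. ennreal ((norm (g \<xi> - (\<Sum>x\<in>X. \<psi> x * cnj (plane_wave \<xi> x))))\<^sup>2) \<partial>torus)
        \<longlongrightarrow> 0) (finite_subsets_at_top UNIV)"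

definition fourier :: "('d::finite lattice \<Rightarrow> complex) \<Rightarrow> real ^ 'd \<Rightarrow> complex" where
  "fourier \<psi> = (SOME g. is_fourier \<psi> g)"

definition fourier_multiplier ::
  "(real ^ 'd \<Rightarrow> complex) \<Rightarrow> ('d::finite lattice \<Rightarrow> complex) \<Rightarrow> 'd lattice \<Rightarrow> complex" where
  "fourier_multiplier m \<psi> x =
     (\<integral>\<xi>. m \<xi> * fourier \<psi> \<xi> * plane_wave \<xi> x \<partial>torus) / of_real ((2 * pi) ^ CARD('d))"

definition omega :: "real ^ 'd::finite \<Rightarrow> real" where
  "omega \<xi> = sqrt (1 + (\<Sum>j\<in>UNIV. 2 * (1 - cos (\<xi> $ j))))"

definition sqrt_one_minus_laplacian ::
  "('d::finite lattice \<Rightarrow> complex) \<Rightarrow> 'd lattice \<Rightarrow> complex" where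
  "sqrt_one_minus_laplacian = fourier_multiplier (\<lambda>\<xi>. of_real (omega \<xi>))"

(* The neighbour condition |x - y| = 1 is stated for the squared Euclidean distance. *)
definition laplacian :: "('d::finite lattice \<Rightarrow> complex) \<Rightarrow> 'd lattice \<Rightarrow> complex" where
  "laplacian \<psi> x =
     (\<Sum>y | (\<Sum>i\<in>UNIV. (x $ i - y $ i)\<^sup>2) = 1. \<psi> y) - of_nat (2 * CARD('d)) * \<psi> x"

lemma neighbours:
  fixes x :: "'d::finite lattice"
  shows "{y. (\<Sum>i\<in>UNIV. (x $ i - y $ i)\<^sup>2) = 1} =
         (\<lambda>(j, s). x + axis j s) ` (UNIV \<times> {1, -1})"
proof (intro subset_antisym subsetI)
  fix y assume "y \<in> {y. (\<Sum>i\<in>UNIV. (x $ i - y $ i)\<^sup>2) = 1}"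
  then have s: "(\<Sum>i\<in>UNIV. (x $ i - y $ i)\<^sup>2) = 1" by simp
  then obtain j where j: "x $ j \<noteq> y $ j"
    by (metis (no_types, lifting) sum.neutral diff_self power_zero_numeral zero_neq_one)
  have split: "(x $ j - y $ j)\<^sup>2 + (\<Sum>i\<in>UNIV - {j}. (x $ i - y $ i)\<^sup>2) = 1"
    using s by (simp add: sum.remove[of UNIV j])
  have ge: "(x $ j - y $ j)\<^sup>2 \<ge> 1"
    using j by (smt (verit) zero_less_power2)
  have nn: "(\<Sum>i\<in>UNIV - {j}. (x $ i - y $ i)\<^sup>2) \<ge> 0" by (simp add: sum_nonneg)
  have e1: "(x $ j - y $ j)\<^sup>2 = 1" and "(\<Sum>i\<in>UNIV - {j}. (x $ i - y $ i)\<^sup>2) = 0"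
    using split ge nn by linarith+
  then have e0: "y $ i = x $ i" if "i \<noteq> j" for i
    using that by (simp add: sum_nonneg_eq_0_iff)
  have "y $ j - x $ j \<in> {1, -1}" using e1 by (auto simp: power2_eq_1_iff)
  moreover have "y = x + axis j (y $ j - x $ j)"
    by (simp add: vec_eq_iff axis_def e0)
  ultimately show "y \<in> (\<lambda>(j, s). x + axis j s) ` (UNIV \<times> {1, -1})" by force
next
  fix y assume "y \<in> (\<lambda>(j, s). x + axis j s) ` (UNIV \<times> {1, -1})"
  then obtain j s where "y = x + axis j s" and s: "s = 1 \<or> s = -1" by auto
  then have "(\<Sum>i\<in>UNIV. (x $ i - y $ i)\<^sup>2) = (\<Sum>i\<in>UNIV. if i = j then 1 else 0)"
    by (intro sum.cong) (auto simp: axis_def)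
  then show "y \<in> {y. (\<Sum>i\<in>UNIV. (x $ i - y $ i)\<^sup>2) = 1}" by simp
qed

lemma one_minus_laplacian_plane_wave:
  fixes \<xi> :: "real ^ 'd::finite"
  shows "plane_wave \<xi> x - laplacian (plane_wave \<xi>) x = of_real ((omega \<xi>)\<^sup>2) * plane_wave \<xi> x"
proof -
  have shift: "plane_wave \<xi> (x + axis j s) = cis (of_int s * \<xi> $ j) * plane_wave \<xi> x" for j s
  proof -
    have "(\<Sum>i\<in>UNIV. real_of_int ((x + axis j s) $ i) * \<xi> $ i)
        = (\<Sum>i\<in>UNIV. (if i = j then of_int s * \<xi> $ j else 0) + of_int (x $ i) * \<xi> $ i)"
      by (intro sum.cong) (auto simp: axis_def algebra_simps)
    then show ?thesis
      by (simp add: plane_wave_def sum.distrib cis_mult)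
  qed
  have inj: "inj_on (\<lambda>(j, s). x + axis j s) (UNIV \<times> {1, -1 :: int})"
    by (auto simp: inj_on_def axis_eq_axis)
  have cs: "cis t + cis (- t) = of_real (2 * cos t)" for t
    by (simp add: complex_eq_iff)
  have "(\<Sum>y | (\<Sum>i\<in>UNIV. (x $ i - y $ i)\<^sup>2) = 1. plane_wave \<xi> y)
      = (\<Sum>(j, s)\<in>UNIV \<times> {1, -1}. cis (of_int s * \<xi> $ j) * plane_wave \<xi> x)"
    unfolding neighbours by (subst sum.reindex[OF inj]) (auto intro!: sum.cong simp: shift)
  also have "\<dots> = (\<Sum>j\<in>UNIV. of_real (2 * cos (\<xi> $ j)) * plane_wave \<xi> x)"
    by (subst sum.cartesian_product[symmetric])
       (simp add: distrib_right[symmetric] cs del: of_real_mult)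
  also have "\<dots> = of_real (\<Sum>j\<in>UNIV. 2 * cos (\<xi> $ j)) * plane_wave \<xi> x"
    by (simp add: sum_distrib_right del: of_real_mult)
  finally have lap: "laplacian (plane_wave \<xi>) x
      = (of_real (\<Sum>j\<in>UNIV. 2 * cos (\<xi> $ j)) - of_nat (2 * CARD('d))) * plane_wave \<xi> x"
    by (simp add: laplacian_def algebra_simps)
  have "(omega \<xi>)\<^sup>2 = 1 + (\<Sum>j\<in>UNIV. 2 * (1 - cos (\<xi> $ j)))"
    unfolding omega_def by (intro real_sqrt_pow2 add_nonneg_nonneg sum_nonneg) auto
  also have "\<dots> = 1 + 2 * of_nat CARD('d) - (\<Sum>j\<in>UNIV. 2 * cos (\<xi> $ j))"
    by (simp add: algebra_simps sum_subtractf)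
  finally have om: "of_real ((omega \<xi>)\<^sup>2)
      = 1 + of_nat (2 * CARD('d)) - (of_real (\<Sum>j\<in>UNIV. 2 * cos (\<xi> $ j)) :: complex)"
    by simp
  show ?thesis
    unfolding lap om by (simp only: ring_distribs) simp
qed

end

theory Submission
  imports Defs
begin

text \<open>
  Since $(\omega - z)^{-1} = (\omega + z) / (\omega^2 - z^2)$ and $\omega^2 = 1 - \Delta$, only the
  propagator $e^{-i\tau\omega^2}$ of the lattice Laplacian is needed. Its kernel is a product of Bessel
  integrals, each bounded by $C (t \, |t - |n||)^{-1/4}$ (van der Corput with the stationary points cut
  out). A product of three of these is integrable in time uniformly in the lattice point, which gives
  $\int_S^\infty |K_\tau(x)| \, d\tau \le C S^{-1/2}$ in every dimension $d \ge 3$. The multiplier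
  $\omega$ in the numerator is a norm-convergent power series in the nearest-neighbour hopping operator
  and costs only a constant.

  The integral over $[0, S]$ is bounded on $\ell^2$ by $C S$, the rest from $\ell^1$ to $\ell^\infty$ by
  $C S^{-1/2}$; balancing $S$ bounds the form by $C (|X| \, |Y|)^{5/6}$ on functions of modulus at most
  one supported in $X$ and $Y$. Summing over level sets gives the $\ell^p \to \ell^{p'}$ bound for every
  $p < 6/5$, and both $\sigma_3$ and $\sigma_4$ lie in this range. For $|z|$ large the trivial $\ell^2$
  bound suffices. No resolvent has to exist: Duhamel's formula on $[0, T]$ expresses $\psi$ through
  $(\sqrt{1-\Delta} - z)\psi$ and a remainder which tends to zero weakly as $T \to \infty$, so real $z$ in
  the spectrum needs no separate treatment.
\<close>

section \<open>Oscillatory integrals\<close>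

text \<open>The square makes the kernel computable: the root in \<open>omega\<close> couples all
  coordinates, whereas its square is a sum over coordinates, so the propagator kernel is a product.
  The obstacle is decay. The rate t^(-1/3), uniform in n, would give only t^(-1) for three factors,
  which is not integrable at infinity. The cube of (t |t - |n||)^(-1/4) is singular at t = |n|, but
  only to the integrable order 3/4, and decays like t^(-3/2) for large t. The exponent 6/5 comes
  from the balance: with n = |X| |Y| the two parts are n^(1/2) S and n S^(-1/2), equal in size for S
  = n^(1/3), and the resulting power 5/6 is 1/p at p = 6/5. As p = 2 \<sigma> / (\<sigma> + 1), the
  range p < 6/5 is exactly \<sigma> < 3/2, so one argument covers both dimensions; strictness makes
  the sum over level sets geometric. Bounds that grow with T enter only through approximation
  errors, which are sent to zero while T is fixed; the constant of the estimate depends on neither T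
  nor z.\<close>

lemma norm_integral_cis_le:
  fixes \<phi> :: "real \<Rightarrow> real"
  assumes "a \<le> b" "0 < L"
    and der: "\<And>x. x \<in> {a..b} \<Longrightarrow> (\<phi> has_real_derivative \<phi>' x) (at x)"
    and der': "\<And>x. x \<in> {a..b} \<Longrightarrow> (\<phi>' has_real_derivative \<phi>'' x) (at x)"
    and concave: "\<And>x. x \<in> {a..b} \<Longrightarrow> \<phi>'' x \<le> 0"
    and cont: "continuous_on {a..b} \<phi>''"
    and large: "\<And>x. x \<in> {a..b} \<Longrightarrow> L \<le> \<bar>\<phi>' x\<bar>"
  shows "norm (integral {a..b} (\<lambda>x. cis (\<phi> x))) \<le> 4 / L"
proof -
  \<comment> \<open>One integration by parts: F is chosen so that its derivative is
    \<open>cis (\<phi> x) - R x\<close>.\<close>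
  define F where "F x = cis (\<phi> x) / (\<i> * of_real (\<phi>' x))" for x
  define R where "R x = cis (\<phi> x) * of_real (\<phi>'' x) / (\<i> * of_real ((\<phi>' x)\<^sup>2))" for x
  have nz: "\<phi>' x \<noteq> 0" if "x \<in> {a..b}" for x
    using large[OF that] \<open>0 < L\<close> by auto
  have c1: "continuous_on {a..b} \<phi>" "continuous_on {a..b} \<phi>'"
    using der der' by (meson DERIV_isCont continuous_at_imp_continuous_on)+
  have "(F has_vector_derivative (cis (\<phi> x) - R x)) (at x within {a..b})" if "x \<in> {a..b}" for x
  proof -
    have p: "((\<lambda>x. cis (\<phi> x)) has_vector_derivative (of_real (\<phi>' x) * (\<i> * cis (\<phi> x)))) (at x within {a..b})"
    proof -
      have "((\<lambda>x. exp (\<i> * of_real (\<phi> x))) has_vector_derivative (of_real (\<phi>' x) * (\<i> * exp (\<i> * of_real (\<phi> x))))) (at x within {a..b})"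
      proof -
        have 1: "((\<lambda>x. complex_of_real (\<phi> x)) has_vector_derivative of_real (\<phi>' x)) (at x within {a..b})"
          using der[OF that] by (intro has_vector_derivative_of_real)
            (simp add: has_real_derivative_iff_has_vector_derivative has_vector_derivative_at_within)
        have 2: "((\<lambda>w. exp (\<i> * w)) has_field_derivative \<i> * exp (\<i> * of_real (\<phi> x)))
            (at (complex_of_real (\<phi> x)) within (\<lambda>x. complex_of_real (\<phi> x)) ` {a..b})"
          by (auto intro!: derivative_eq_intros)
        show ?thesis using field_vector_diff_chain_within[OF 1 2] by (simp add: o_def)
      qed
      then show ?thesis by (simp add: cis_conv_exp)
    qed
    have q: "((\<lambda>x. 1 / (\<i> * of_real (\<phi>' x))) has_vector_derivative
        (\<i> * of_real (\<phi>'' x) / (of_real (\<phi>' x))\<^sup>2)) (at x within {a..b})"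
    proof -
      have "((\<lambda>x. inverse (\<phi>' x)) has_real_derivative - (\<phi>'' x / (\<phi>' x)\<^sup>2)) (at x)"
        using der'[OF that] nz[OF that] by (auto intro!: derivative_eq_intros simp: power2_eq_square field_simps)
      then have "((\<lambda>x. - \<i> * of_real (inverse (\<phi>' x))) has_vector_derivative - \<i> * of_real (- (\<phi>'' x / (\<phi>' x)\<^sup>2))) (at x within {a..b})"
        by (intro has_vector_derivative_mult_right has_vector_derivative_of_real)
           (simp add: has_real_derivative_iff_has_vector_derivative has_vector_derivative_at_within)
      then show ?thesis by (simp add: divide_inverse mult_ac)
    qed
    have "((\<lambda>x. cis (\<phi> x) * (1 / (\<i> * of_real (\<phi>' x)))) has_vector_derivative
       cis (\<phi> x) * (\<i> * of_real (\<phi>'' x) / (of_real (\<phi>' x))\<^sup>2) + of_real (\<phi>' x) * (\<i> * cis (\<phi> x)) * (1 / (\<i> * of_real (\<phi>' x)))) (at x within {a..b})"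
      by (rule has_vector_derivative_mult[OF p q])
    moreover have "cis (\<phi> x) * (\<i> * of_real (\<phi>'' x) / (of_real (\<phi>' x))\<^sup>2) + of_real (\<phi>' x) * (\<i> * cis (\<phi> x)) * (1 / (\<i> * of_real (\<phi>' x))) = cis (\<phi> x) - R x"
      using nz[OF that] by (simp add: R_def field_simps power2_eq_square)
    ultimately show ?thesis by (simp add: F_def[abs_def])
  qed
  then have FTC: "((\<lambda>x. cis (\<phi> x) - R x) has_integral (F b - F a)) {a..b}"
    using \<open>a \<le> b\<close> by (intro fundamental_theorem_of_calculus) auto
  have ci: "(\<lambda>x. cis (\<phi> x)) integrable_on {a..b}" and Ri: "R integrable_on {a..b}"
    unfolding R_def using nz c1 cont
    by (auto intro!: integrable_continuous_interval continuous_intros simp: cis_conv_exp)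
  have nF: "norm (F x) \<le> 1 / L" if "x \<in> {a..b}" for x
    using large[OF that] \<open>0 < L\<close> by (simp add: F_def norm_divide norm_mult frac_le)
  \<comment> \<open>As \<open>\<phi>''\<close> has a constant sign, the integral of the modulus of R
    telescopes to a difference of values of \<open>1 / \<phi>'\<close>. It costs 2/L, and so do the
    two boundary values of F.\<close>
  have Q: "((\<lambda>x. - \<phi>'' x / (\<phi>' x)\<^sup>2) has_integral (1 / \<phi>' b - 1 / \<phi>' a)) {a..b}"
  proof (intro fundamental_theorem_of_calculus)
    fix x assume x: "x \<in> {a..b}"
    have "((\<lambda>x. 1 / \<phi>' x) has_real_derivative (- \<phi>'' x / (\<phi>' x)\<^sup>2)) (at x)"
      using der'[OF x] nz[OF x] by (auto intro!: derivative_eq_intros simp: power2_eq_square)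
    then show "((\<lambda>x. 1 / \<phi>' x) has_vector_derivative - \<phi>'' x / (\<phi>' x)\<^sup>2) (at x within {a..b})"
      by (simp add: has_real_derivative_iff_has_vector_derivative has_vector_derivative_at_within)
  qed fact
  have "norm (integral {a..b} R) \<le> integral {a..b} (\<lambda>x. - \<phi>'' x / (\<phi>' x)\<^sup>2)"
    using Q concave by (intro integral_norm_bound_integral Ri)
      (auto simp: R_def norm_divide norm_mult has_integral_integrable norm_power divide_right_mono)
  also have "\<dots> = 1 / \<phi>' b - 1 / \<phi>' a"
    using Q by (rule integral_unique)
  also have "\<dots> \<le> 2 / L"
  proof -
    have "\<bar>1 / \<phi>' x\<bar> \<le> 1 / L" if "x \<in> {a..b}" for x
      using large[OF that] \<open>0 < L\<close> by (simp add: frac_le)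
    then have "1 / \<phi>' b \<le> 1 / L" "- (1 / \<phi>' a) \<le> 1 / L"
      using \<open>a \<le> b\<close> by (meson abs_le_D1 abs_le_D2 atLeastAtMost_iff order_refl)+
    then show ?thesis by (simp add: field_simps)
  qed
  finally have nR: "norm (integral {a..b} R) \<le> 2 / L" .
  have "integral {a..b} (\<lambda>x. cis (\<phi> x)) = (F b - F a) + integral {a..b} R"
    using integral_unique[OF FTC] integral_diff[OF ci Ri] by (simp add: algebra_simps)
  then have "norm (integral {a..b} (\<lambda>x. cis (\<phi> x))) \<le> norm (F b) + norm (F a) + norm (integral {a..b} R)"
    by (metis norm_triangle_le norm_triangle_ineq4 add_mono order_refl)
  also have "\<dots> \<le> 1 / L + 1 / L + 2 / L"
    using nF[of a] nF[of b] nR \<open>a \<le> b\<close> by auto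
  finally show ?thesis by simp
qed

text \<open>Concavity puts the graph of sine above its chord on [0, pi/2].\<close>

lemma jordan_sin:
  assumes "0 \<le> x" "x \<le> pi / 2"
  shows "2 / pi * x \<le> sin x"
proof -
  have c: "concave_on {0..pi/2} sin"
    by (rule f''_le0_imp_concave[where f' = cos and f'' = "\<lambda>x. - sin x"])
       (auto intro!: derivative_eq_intros sin_ge_zero)
  have "(1 - 2 / pi * x) * sin 0 + (2 / pi * x) * sin (pi/2) \<le> sin ((1 - 2 / pi * x) *\<^sub>R 0 + (2 / pi * x) *\<^sub>R (pi/2))"
    using assms by (intro concave_onD[OF c]) (auto simp: field_simps)
  then show ?thesis by simp
qed

lemma jordan_cos:
  assumes "\<bar>x\<bar> \<le> pi / 2"
  shows "2 / pi * (pi/2 - \<bar>x\<bar>) \<le> cos x"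
proof -
  have "2 / pi * (pi/2 - \<bar>x\<bar>) \<le> sin (pi/2 - \<bar>x\<bar>)"
    using assms by (intro jordan_sin) auto
  then show ?thesis by (simp add: sin_diff)
qed

text \<open>The difference factors as 2 sin((x - \<alpha>)/2) cos((x + \<alpha>)/2). Jordan's
  inequality bounds the sine by the distance to \<alpha> and the cosine by the distance of \<alpha>
  from pi/2. The latter dominates \<open>sqrt (1 - sin \<alpha>)\<close>, which measures how close
  the stationary point is to becoming degenerate.\<close>

lemma sin_diff_lower_bound:
  fixes \<alpha> :: real
  assumes "0 \<le> \<alpha>" "\<alpha> \<le> pi / 2" "- (pi / 2) \<le> x" "x \<le> pi / 2"
  shows "2 / pi\<^sup>2 * (sqrt (1 - sin \<alpha>) * \<bar>x - \<alpha>\<bar>) \<le> \<bar>sin x - sin \<alpha>\<bar>"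
proof -
  define m where "m = (x + \<alpha>) / 2"
  define \<beta> where "\<beta> = pi / 2 - \<alpha>"
  have \<beta>: "0 \<le> \<beta>" using assms by (simp add: \<beta>_def)
  have "1 - sin \<alpha> = 1 - cos \<beta>" by (simp add: \<beta>_def cos_diff)
  also have "\<dots> = 2 * (sin (\<beta> / 2))\<^sup>2"
    using cos_double_sin[of "\<beta>/2"] by simp
  also have "\<dots> \<le> 2 * (\<beta> / 2)\<^sup>2"
    using abs_sin_x_le_abs_x[of "\<beta>/2"] by (intro mult_left_mono abs_le_square_iff[THEN iffD1]) auto
  also have "\<dots> \<le> \<beta>\<^sup>2" by (simp add: power2_eq_square)
  finally have k: "sqrt (1 - sin \<alpha>) \<le> \<beta>"
    using \<beta> by (intro real_le_lsqrt) auto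
  have m: "\<bar>m\<bar> \<le> pi / 2" using assms by (simp add: m_def abs_le_iff)
  \<comment> \<open>For every admissible x, the midpoint m stays away from both ends of the interval
    by at least half the distance \<beta> from \<alpha> to pi/2.\<close>
  have "\<beta> / 2 \<le> pi / 2 - \<bar>m\<bar>"
    using assms by (simp add: m_def \<beta>_def abs_if field_simps)
  then have "2 / pi * (\<beta> / 2) \<le> 2 / pi * (pi / 2 - \<bar>m\<bar>)"
    by (intro mult_left_mono) auto
  with jordan_cos[OF m] have c: "\<beta> / pi \<le> cos m" by (simp add: field_simps)
  have u: "\<bar>(x - \<alpha>) / 2\<bar> \<le> pi / 2" using assms by (simp add: abs_le_iff)
  have "2 / pi * \<bar>(x - \<alpha>) / 2\<bar> \<le> sin \<bar>(x - \<alpha>) / 2\<bar>" 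
    using u by (intro jordan_sin) auto
  also have "\<dots> \<le> \<bar>sin ((x - \<alpha>) / 2)\<bar>" by (simp add: abs_if)
  finally have s: "\<bar>x - \<alpha>\<bar> / pi \<le> \<bar>sin ((x - \<alpha>) / 2)\<bar>" by simp
  have "2 / pi\<^sup>2 * (sqrt (1 - sin \<alpha>) * \<bar>x - \<alpha>\<bar>) \<le> 2 / pi\<^sup>2 * (\<beta> * \<bar>x - \<alpha>\<bar>)"
    using k by (intro mult_left_mono mult_right_mono) auto
  also have "\<dots> = 2 * (\<bar>x - \<alpha>\<bar> / pi) * (\<beta> / pi)" by (simp add: power2_eq_square)
  also have "\<dots> \<le> 2 * \<bar>sin ((x - \<alpha>) / 2)\<bar> * cos m"
    using s c \<beta> by (intro mult_mono) auto
  also have "\<dots> \<le> \<bar>2 * sin ((x - \<alpha>) / 2) * cos m\<bar>" by (simp add: abs_mult mult_left_mono)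
  also have "\<dots> = \<bar>sin x - sin \<alpha>\<bar>" by (simp add: m_def sin_diff_sin)
  finally show ?thesis .
qed

text \<open>The point $\alpha$ is the stationary point in $[-\pi/2, \pi/2]$ if $n \le t$, and the endpoint $\pi/2$ otherwise.\<close>

lemma phase_derivative_lower_bound:
  fixes t n :: real
  assumes "0 < t" "0 \<le> n"
  obtains \<alpha> where "\<And>x. x \<in> {- (pi/2)..pi/2} \<Longrightarrow>
    2 / pi\<^sup>2 * (sqrt (t * \<bar>t - n\<bar>) * \<bar>x - \<alpha>\<bar>) \<le> \<bar>n - t * sin x\<bar>"
proof (cases "n \<le> t")
  case True
  define \<alpha> where "\<alpha> = arcsin (n / t)"
  have nt: "0 \<le> n / t" "n / t \<le> 1" using True assms by auto
  then have s: "sin \<alpha> = n / t" by (simp add: \<alpha>_def)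
  have \<alpha>: "0 \<le> \<alpha>" "\<alpha> \<le> pi / 2" using nt arcsin_bounded[of "n / t"] arcsin_le_arcsin[of 0 "n / t"] by (auto simp: \<alpha>_def)
  have "t * \<bar>t - n\<bar> = t\<^sup>2 * (1 - n / t)" using True assms by (simp add: field_simps power2_eq_square)
  then have w: "sqrt (t * \<bar>t - n\<bar>) = t * sqrt (1 - sin \<alpha>)"
    using assms by (simp add: real_sqrt_mult s)
  have "2 / pi\<^sup>2 * (sqrt (t * \<bar>t - n\<bar>) * \<bar>x - \<alpha>\<bar>) \<le> \<bar>n - t * sin x\<bar>" if "x \<in> {- (pi/2)..pi/2}" for x
  proof -
    have "t * (2 / pi\<^sup>2 * (sqrt (1 - sin \<alpha>) * \<bar>x - \<alpha>\<bar>)) \<le> t * \<bar>sin x - sin \<alpha>\<bar>"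
      using that assms \<alpha> by (intro mult_left_mono sin_diff_lower_bound) auto
    also have "\<dots> = \<bar>t * (sin x - sin \<alpha>)\<bar>" using assms by (simp add: abs_mult)
    also have "t * (sin x - sin \<alpha>) = t * sin x - n" using assms by (simp add: s algebra_simps)
    finally have "t * (2 / pi\<^sup>2 * (sqrt (1 - sin \<alpha>) * \<bar>x - \<alpha>\<bar>)) \<le> \<bar>n - t * sin x\<bar>"
      by (simp only: abs_minus_commute)
    then show ?thesis by (simp only: w mult_ac)
  qed
  then show thesis by (rule that)
next
  case False
  have "2 / pi\<^sup>2 * (sqrt (t * \<bar>t - n\<bar>) * \<bar>x - pi/2\<bar>) \<le> \<bar>n - t * sin x\<bar>" if x: "x \<in> {- (pi/2)..pi/2}" for x
  proof -
    \<comment> \<open>Here n - t sin x = (n - t) + t (1 - cos y) is a sum of two nonnegative terms;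
      the arithmetic-geometric mean inequality turns it into the required product of sqrt (t (n -
      t)) and y.\<close>
    define y where "y = pi/2 - x"
    have y: "0 \<le> y" "y \<le> pi" using x by (auto simp: y_def)
    have sx: "sin x = cos y" by (simp add: y_def cos_diff)
    have "y / pi \<le> sin (y / 2)" using jordan_sin[of "y/2"] y by simp
    then have "(y / pi)\<^sup>2 \<le> (sin (y / 2))\<^sup>2" using y by (intro power_mono) auto
    then have c: "2 * (y / pi)\<^sup>2 \<le> 1 - cos y" using cos_double_sin[of "y/2"] by simp
    have "2 / pi\<^sup>2 * (sqrt (t * \<bar>t - n\<bar>) * \<bar>x - pi/2\<bar>) = 2 / pi\<^sup>2 * (sqrt (t * (n - t)) * y)"
      using False y by (simp add: y_def)
    also have "\<dots> \<le> 2 / pi * (sqrt (t * (n - t)) * y)"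
      using y False assms pi_ge_two by (intro mult_right_mono) (auto simp: field_simps power2_eq_square)
    also have "\<dots> = 2 * (sqrt (n - t) * (sqrt t * (y / pi)))"
      by (simp add: real_sqrt_mult)
    also have "\<dots> \<le> (sqrt (n - t))\<^sup>2 + (sqrt t * (y / pi))\<^sup>2"
      using sum_squares_bound[of "sqrt (n - t)" "sqrt t * (y / pi)"] by (simp add: mult_ac)
    also have "\<dots> = (n - t) + t * (y / pi)\<^sup>2"
      using False assms by (simp add: power_mult_distrib power_divide)
    also have "\<dots> \<le> (n - t) + t * (1 - cos y)"
      using c assms zero_le_power2[of "y / pi"] by (intro add_left_mono mult_left_mono) linarith+
    also have "\<dots> = n - t * sin x" by (simp add: sx algebra_simps)
    also have "\<dots> \<le> \<bar>n - t * sin x\<bar>" by simp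
    finally show ?thesis .
  qed
  then show thesis by (rule that)
qed

text \<open>On this half circle cosine is nonnegative, so the phase is concave. A window of radius
  \<delta> about \<alpha> is estimated by its length, the two outer pieces by
  \<open>norm_integral_cis_le\<close>; they contribute 2 \<delta> and twice 2 pi^2 \<delta>.\<close>

lemma norm_integral_bessel_half_le:
  fixes t n a b :: real
  assumes "0 < t" "0 \<le> n" "t \<noteq> n" "- (pi/2) \<le> a" "a \<le> b" "b \<le> pi/2"
  shows "norm (integral {a..b} (\<lambda>\<theta>. cis (n * \<theta> + t * cos \<theta>))) \<le> (4 * pi\<^sup>2 + 2) * (t * \<bar>t - n\<bar>) powr (-1/4)"
proof -
  obtain \<alpha> where \<alpha>: "\<And>x. x \<in> {- (pi/2)..pi/2} \<Longrightarrow>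
      2 / pi\<^sup>2 * (sqrt (t * \<bar>t - n\<bar>) * \<bar>x - \<alpha>\<bar>) \<le> \<bar>n - t * sin x\<bar>"
    using phase_derivative_lower_bound[OF assms(1,2)] by blast
  define w where "w = sqrt (t * \<bar>t - n\<bar>)"
  have w: "0 < w" using assms by (simp add: w_def)
  have wp: "w powr (-1/2) = (t * \<bar>t - n\<bar>) powr (-1/4)"
    using assms by (simp add: w_def powr_half_sqrt[symmetric] powr_powr)
  \<comment> \<open>The radius that solves 1 / (w \<delta>) = \<delta>, so that window and outer
    pieces are of the same size.\<close>
  define \<delta> where "\<delta> = w powr (-1/2)"
  have \<delta>: "0 < \<delta>" using w by (simp add: \<delta>_def)
  have w\<delta>: "1 / (w * \<delta>) = \<delta>"
  proof -
    have "w * \<delta> * \<delta> = w * (w powr (-1/2) * w powr (-1/2))" by (simp add: \<delta>_def)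
    also have "w powr (-1/2) * w powr (-1/2) = w powr (-1)"
      by (subst powr_add[symmetric]) simp
    finally show ?thesis using w \<delta> by (simp add: field_simps powr_minus)
  qed
  define f where "f \<theta> = cis (n * \<theta> + t * cos \<theta>)" for \<theta>
  have fi: "f integrable_on {u..v}" for u v
    unfolding f_def by (intro integrable_continuous_interval continuous_intros)
  have piece: "norm (integral {u..v} f) \<le> 2 * pi\<^sup>2 * \<delta>"
    if "a \<le> u" "u \<le> v" "v \<le> b" and far: "u = v \<or> (\<forall>x\<in>{u..v}. \<delta> \<le> \<bar>x - \<alpha>\<bar>)" for u v
  proof (cases "u = v")
    case True
    then show ?thesis using \<delta> by simp
  next
    case False
    have "norm (integral {u..v} f) \<le> 4 / (2 / pi\<^sup>2 * (w * \<delta>))"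
      unfolding f_def
    proof (rule norm_integral_cis_le[where \<phi>' = "\<lambda>x. n - t * sin x" and \<phi>'' = "\<lambda>x. - t * cos x"])
      fix x assume x: "x \<in> {u..v}"
      then have x': "x \<in> {- (pi/2)..pi/2}" using assms that by auto
      show "((\<lambda>\<theta>. n * \<theta> + t * cos \<theta>) has_real_derivative n - t * sin x) (at x)"
        by (auto intro!: derivative_eq_intros)
      show "((\<lambda>x. n - t * sin x) has_real_derivative - t * cos x) (at x)"
        by (auto intro!: derivative_eq_intros)
      show "- t * cos x \<le> 0" using x' assms cos_ge_zero[of x] by simp
      have "2 / pi\<^sup>2 * (w * \<delta>) \<le> 2 / pi\<^sup>2 * (w * \<bar>x - \<alpha>\<bar>)"
        using far False x w by (intro mult_left_mono) auto
      also have "\<dots> \<le> \<bar>n - t * sin x\<bar>" using \<alpha>[OF x'] by (simp add: w_def)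
      finally show "2 / pi\<^sup>2 * (w * \<delta>) \<le> \<bar>n - t * sin x\<bar>" .
    qed (use that w \<delta> in \<open>auto intro!: continuous_intros\<close>)
    also have "\<dots> = 2 * pi\<^sup>2 * (1 / (w * \<delta>))" by simp
    finally show ?thesis by (simp only: w\<delta>)
  qed
  \<comment> \<open>Clipping the window to [a, b] treats all positions of \<alpha> at once. An outer
    piece may then shrink to a point at distance less than \<delta> from \<alpha>, which is why
    \<open>piece\<close> admits u = v.\<close>
  define l where "l = max a (min b (\<alpha> - \<delta>))"
  define r where "r = max a (min b (\<alpha> + \<delta>))"
  have lr: "a \<le> l" "l \<le> r" "r \<le> b" using assms \<delta> by (auto simp: l_def r_def)
  have p1: "norm (integral {a..l} f) \<le> 2 * pi\<^sup>2 * \<delta>"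
    using lr by (intro piece) (auto simp: l_def max_def min_def)
  have p3: "norm (integral {r..b} f) \<le> 2 * pi\<^sup>2 * \<delta>"
    using lr by (intro piece) (auto simp: r_def max_def min_def)
  have "norm (integral {l..r} f) \<le> 1 * measure lborel {l..r}"
    using fi by (intro has_integral_bound_real integrable_integral) (auto simp: f_def)
  also have "\<dots> \<le> 2 * \<delta>" using lr \<delta> by (auto simp: l_def r_def max_def min_def)
  finally have p2: "norm (integral {l..r} f) \<le> 2 * \<delta>" .
  have "integral {a..b} f = integral {a..l} f + integral {l..r} f + integral {r..b} f"
    using lr fi by (simp add: Henstock_Kurzweil_Integration.integral_combine)
  then have "norm (integral {a..b} f) \<le> norm (integral {a..l} f) + norm (integral {l..r} f) + norm (integral {r..b} f)"
    by (metis norm_triangle_ineq norm_triangle_le add_right_mono)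
  also have "\<dots> \<le> (4 * pi\<^sup>2 + 2) * \<delta>" using p1 p2 p3 by (simp add: algebra_simps)
  finally show ?thesis by (simp only: f_def[abs_def] \<delta>_def wp)
qed

text \<open>For integer n this is 2 pi i^n J_n(t), with J_n the Bessel function. Real n is allowed
  since the oscillatory estimates do not use integrality.\<close>

definition bessel_integral :: "real \<Rightarrow> real \<Rightarrow> complex" where
  "bessel_integral n t = integral {-pi..pi} (\<lambda>\<theta>. cis (n * \<theta> + t * cos \<theta>))"

text \<open>On the two outer quarters cosine is negative and the phase is convex. The reflection x
  -> c - x with c = pi or c = -pi changes the sign of the phase up to a constant, so these quarters
  become complex conjugates of pieces of the concave half. Three pieces give the factor 3.\<close>

lemma norm_bessel_integral_le_aux:
  assumes "0 < t" "0 \<le> n" "t \<noteq> n"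
  shows "norm (bessel_integral n t) \<le> (12 * pi\<^sup>2 + 6) * (t * \<bar>t - n\<bar>) powr (-1/4)"
proof -
  define B where "B = (4 * pi\<^sup>2 + 2) * (t * \<bar>t - n\<bar>) powr (-1/4)"
  define f where "f \<theta> = cis (n * \<theta> + t * cos \<theta>)" for \<theta>
  have fi: "f integrable_on {u..v}" for u v
    unfolding f_def by (intro integrable_continuous_interval continuous_intros)
  have half: "norm (integral {a..b} f) \<le> B" if "- (pi/2) \<le> a" "a \<le> b" "b \<le> pi/2" for a b
    unfolding f_def B_def using that assms by (intro norm_integral_bessel_half_le) auto
  have refl: "norm (integral {c - b..c - a} f) \<le> B"
    if "- (pi/2) \<le> a" "a \<le> b" "b \<le> pi/2" and c: "c = pi \<or> c = - pi" for a b c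
  proof -
    have "((\<lambda>x. f (1 *\<^sub>R x + c)) has_integral (integral {c - b..c - a} f) /\<^sub>R 1) (cbox ((c - b - c) /\<^sub>R 1) ((c - a - c) /\<^sub>R 1))"
      using has_integral_affinity'[of f "integral {c - b..c - a} f" "c - b" "c - a" 1 c] fi
      by (simp add: integrable_integral)
    then have "((\<lambda>x. f (x + c)) has_integral integral {c - b..c - a} f) {-b..-a}"
      by simp
    then have "((\<lambda>x. f (c - x)) has_integral integral {c - b..c - a} f) {a..b}"
      using has_integral_reflect_real[of "\<lambda>x. f (c - x)" "integral {c - b..c - a} f" b a] 
      by (simp add: add.commute)
    moreover have "f (c - x) = cis (n * c) * cnj (f x)" for x
      using c by (auto simp: f_def cis_cnj cis_mult cos_diff algebra_simps)
    ultimately have "integral {c - b..c - a} f = integral {a..b} (\<lambda>x. cis (n * c) * cnj (f x))"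
      by (metis (no_types, lifting) integral_unique has_integral_cong)
    also have "\<dots> = cis (n * c) * cnj (integral {a..b} f)"
      by (simp add: integral_cnj)
    finally show ?thesis using half[OF that(1-3)] by (simp add: norm_mult)
  qed
  have "integral {-pi..pi} f = integral {-pi..-(pi/2)} f + integral {-(pi/2)..pi/2} f + integral {pi/2..pi} f"
    using fi by (simp add: Henstock_Kurzweil_Integration.integral_combine)
  then have "norm (integral {-pi..pi} f) \<le> norm (integral {-pi..-(pi/2)} f) + norm (integral {-(pi/2)..pi/2} f) + norm (integral {pi/2..pi} f)"
    by (metis norm_triangle_ineq norm_triangle_le add_right_mono)
  also have "\<dots> \<le> B + B + B"
    using refl[of "-(pi/2)" 0 "-pi"] half[of "-(pi/2)" "pi/2"] refl[of 0 "pi/2" "pi"] by simp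
  finally show ?thesis by (simp add: bessel_integral_def f_def[abs_def] B_def algebra_simps)
qed

lemma bessel_integral_minus: "bessel_integral (- n) t = bessel_integral n t"
  using Henstock_Kurzweil_Integration.integral_reflect_real[of pi "-pi" "\<lambda>\<theta>. cis (n * \<theta> + t * cos \<theta>)"]
  by (simp add: bessel_integral_def)

lemma bessel_integral_minus_time: "bessel_integral n (- t) = cnj (bessel_integral n t)"
proof -
  have "bessel_integral n (- t) = bessel_integral (- n) (- t)" by (simp add: bessel_integral_minus)
  also have "\<dots> = integral {-pi..pi} (\<lambda>\<theta>. cnj (cis (n * \<theta> + t * cos \<theta>)))"
    by (simp add: bessel_integral_def cis_cnj)
  finally show ?thesis by (simp add: integral_cnj bessel_integral_def)
qed

lemma norm_bessel_integral_le:
  assumes "t \<noteq> 0" "\<bar>t\<bar> \<noteq> \<bar>n\<bar>"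
  shows "norm (bessel_integral n t) \<le> (12 * pi\<^sup>2 + 6) * (\<bar>t\<bar> * \<bar>\<bar>t\<bar> - \<bar>n\<bar>\<bar>) powr (-1/4)"
proof -
  have "norm (bessel_integral n t) = norm (bessel_integral \<bar>n\<bar> \<bar>t\<bar>)"
    by (auto simp: abs_if bessel_integral_minus bessel_integral_minus_time)
  then show ?thesis using norm_bessel_integral_le_aux[of "\<bar>t\<bar>" "\<bar>n\<bar>"] assms by simp
qed

lemma norm_bessel_integral_le_2pi: "norm (bessel_integral n t) \<le> 2 * pi"
proof -
  have "((\<lambda>\<theta>. cis (n * \<theta> + t * cos \<theta>)) has_integral bessel_integral n t) {-pi..pi}"
    unfolding bessel_integral_def
    by (intro integrable_integral integrable_continuous_interval continuous_intros)
  then have "norm (bessel_integral n t) \<le> 1 * measure lborel {-pi..pi}"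
    by (rule has_integral_bound_real[of 1 "{}", rotated 2]) auto
  then show ?thesis by simp
qed

section \<open>Time integrals of the cubed Bessel bound\<close>

lemma nn_integral_abs_diff_le:
  fixes m :: real and g :: "real \<Rightarrow> ennreal"
  assumes [measurable]: "g \<in> borel_measurable borel"
  shows "(\<integral>\<^sup>+ t. g \<bar>t - m\<bar> \<partial>lborel) \<le> 2 * (\<integral>\<^sup>+ t. g t * indicator {0..} t \<partial>lborel)"
proof -
  define h where "h t = g t * indicator {0..} t" for t
  have [measurable]: "h \<in> borel_measurable borel" unfolding h_def by measurable
  have "(\<integral>\<^sup>+ t. g \<bar>t - m\<bar> \<partial>lborel) \<le> (\<integral>\<^sup>+ t. h (- m + 1 * t) + h (m + (-1) * t) \<partial>lborel)"
    by (intro nn_integral_mono) (auto simp: h_def indicator_def abs_if)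
  also have "\<dots> = (\<integral>\<^sup>+ t. h (- m + 1 * t) \<partial>lborel) + (\<integral>\<^sup>+ t. h (m + (-1) * t) \<partial>lborel)"
    by (intro nn_integral_add) auto
  also have "(\<integral>\<^sup>+ t. h (- m + 1 * t) \<partial>lborel) = (\<integral>\<^sup>+ t. h t \<partial>lborel)"
    using nn_integral_real_affine[of h 1 "-m"] by simp
  also have "(\<integral>\<^sup>+ t. h (m + (-1) * t) \<partial>lborel) = (\<integral>\<^sup>+ t. h t \<partial>lborel)"
    using nn_integral_real_affine[of h "-1" "m"] by simp
  finally show ?thesis by (simp add: h_def mult_2)
qed

lemma nn_integral_powr_from_0:
  fixes S e :: real
  assumes "0 < S" "-1 < e"
  shows "(\<integral>\<^sup>+ t. ennreal (t powr e * indicator {0..S} t) \<partial>lborel) = ennreal (S powr (e + 1) / (e + 1))"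
  using has_integral_powr_from_0[OF assms(2), of S] assms
  by (intro nn_integral_has_integral_lborel)
     (auto simp: has_integral_restrict_UNIV[symmetric, of _ _ "{0..S}"] indicator_def of_bool_def if_distrib[of "\<lambda>y. _ * y"] cong: if_cong)

lemma nn_integral_powr_to_inf:
  fixes S e :: real
  assumes "0 < S" "e < -1"
  shows "(\<integral>\<^sup>+ t. ennreal (t powr e * indicator {S..} t) \<partial>lborel) = ennreal (- (S powr (e + 1)) / (e + 1))"
  using has_integral_powr_to_inf[OF assms(2,1)] assms
  by (intro nn_integral_has_integral_lborel)
     (auto simp: has_integral_restrict_UNIV[symmetric, of _ _ "{S..}"] indicator_def of_bool_def if_distrib[of "\<lambda>y. _ * y"] cong: if_cong)

text \<open>Within distance S of m, the factor t is at least S and the remaining singularity of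
  order 3/4 integrates to 8 S^(1/4). Further away the product is split by 2ab <= a^2 + b^2 into two
  powers of order 3/2, whose tails from S contribute 1 and 2 times S^(-1/2). Nothing depends on m,
  and 8 + 1 + 2 = 11.\<close>

lemma nn_integral_powr_kernel_le:
  fixes m S :: real
  assumes "0 < S"
  shows "(\<integral>\<^sup>+ t. ennreal ((t * \<bar>t - m\<bar>) powr (-3/4)) * indicator {S..} t \<partial>lborel) \<le> ennreal (11 * S powr (-1/2))"
proof -
  define g1 where "g1 t = ennreal (t powr (-3/4) * indicator {0..S} t)" for t :: real
  define g2 where "g2 t = ennreal (t powr (-3/2) * indicator {S..} t)" for t :: real
  have [measurable]: "g1 \<in> borel_measurable borel" "g2 \<in> borel_measurable borel"
    unfolding g1_def g2_def by measurable
  have pw: "ennreal ((t * \<bar>t - m\<bar>) powr (-3/4)) * indicator {S..} t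
      \<le> ennreal (S powr (-3/4)) * g1 \<bar>t - m\<bar> + (ennreal (1/2) * g2 t + ennreal (1/2) * g2 \<bar>t - m\<bar>)" for t
  proof (cases "S \<le> t")
    case St: True
    show ?thesis
    proof (cases "\<bar>t - m\<bar> \<le> S")
      case True
      have "(t * \<bar>t - m\<bar>) powr (-3/4) = t powr (-3/4) * \<bar>t - m\<bar> powr (-3/4)"
        by (rule powr_mult)
      also have "\<dots> \<le> S powr (-3/4) * \<bar>t - m\<bar> powr (-3/4)"
        using St assms by (intro mult_right_mono powr_mono2') auto
      finally have "ennreal ((t * \<bar>t - m\<bar>) powr (-3/4)) \<le> ennreal (S powr (-3/4)) * g1 \<bar>t - m\<bar>"
        using True by (simp add: g1_def ennreal_mult[symmetric] ennreal_leI)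
      then show ?thesis using St by (simp add: add_increasing2)
    next
      case False
      have sq: "u powr (-3/2) = (u powr (-3/4))\<^sup>2" for u :: real
        by (simp add: power2_eq_square powr_add[symmetric])
      have "(t * \<bar>t - m\<bar>) powr (-3/4) = t powr (-3/4) * \<bar>t - m\<bar> powr (-3/4)"
        by (rule powr_mult)
      also have "\<dots> \<le> 1/2 * t powr (-3/2) + 1/2 * \<bar>t - m\<bar> powr (-3/2)"
        using sum_squares_bound[of "t powr (-3/4)" "\<bar>t - m\<bar> powr (-3/4)"] unfolding sq by linarith
      finally have "ennreal ((t * \<bar>t - m\<bar>) powr (-3/4)) \<le> ennreal (1/2 * t powr (-3/2) + 1/2 * \<bar>t - m\<bar> powr (-3/2))"
        by (rule ennreal_leI)
      also have "\<dots> = ennreal (1/2) * g2 t + ennreal (1/2) * g2 \<bar>t - m\<bar>"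
        using St False by (simp add: g2_def del: ennreal_half flip: ennreal_plus ennreal_mult')
      finally show ?thesis using St by (simp add: add_increasing)
    qed
  qed simp
  have i1: "(\<integral>\<^sup>+ t. g1 \<bar>t - m\<bar> \<partial>lborel) \<le> ennreal (8 * S powr (1/4))"
  proof -
    have "(\<integral>\<^sup>+ t. g1 \<bar>t - m\<bar> \<partial>lborel) \<le> 2 * (\<integral>\<^sup>+ t. g1 t * indicator {0..} t \<partial>lborel)"
      by (rule nn_integral_abs_diff_le) auto
    also have "(\<integral>\<^sup>+ t. g1 t * indicator {0..} t \<partial>lborel) = (\<integral>\<^sup>+ t. g1 t \<partial>lborel)"
      by (intro nn_integral_cong) (auto simp: g1_def indicator_def)
    also have "\<dots> = ennreal (S powr (-3/4 + 1) / (-3/4 + 1))"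
      unfolding g1_def using assms by (intro nn_integral_powr_from_0) auto
    also have "2 * \<dots> = ennreal (8 * S powr (1/4))"
      by (simp add: ennreal_mult'[symmetric] flip: ennreal_numeral)
    finally show ?thesis .
  qed
  have i2: "(\<integral>\<^sup>+ t. g2 t \<partial>lborel) = ennreal (2 * S powr (-1/2))"
    unfolding g2_def using assms by (subst nn_integral_powr_to_inf) (auto simp: field_simps)
  have i3: "(\<integral>\<^sup>+ t. g2 \<bar>t - m\<bar> \<partial>lborel) \<le> ennreal (4 * S powr (-1/2))"
  proof -
    have "(\<integral>\<^sup>+ t. g2 \<bar>t - m\<bar> \<partial>lborel) \<le> 2 * (\<integral>\<^sup>+ t. g2 t * indicator {0..} t \<partial>lborel)"
      by (rule nn_integral_abs_diff_le) auto
    also have "(\<integral>\<^sup>+ t. g2 t * indicator {0..} t \<partial>lborel) = (\<integral>\<^sup>+ t. g2 t \<partial>lborel)"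
      using assms by (intro nn_integral_cong) (auto simp: g2_def indicator_def)
    also have "2 * \<dots> = ennreal (4 * S powr (-1/2))"
      by (simp add: i2 ennreal_mult'[symmetric] flip: ennreal_numeral)
    finally show ?thesis .
  qed
  have "(\<integral>\<^sup>+ t. ennreal ((t * \<bar>t - m\<bar>) powr (-3/4)) * indicator {S..} t \<partial>lborel)
     \<le> (\<integral>\<^sup>+ t. ennreal (S powr (-3/4)) * g1 \<bar>t - m\<bar> + (ennreal (1/2) * g2 t + ennreal (1/2) * g2 \<bar>t - m\<bar>) \<partial>lborel)"
    by (intro nn_integral_mono pw)
  also have "\<dots> = ennreal (S powr (-3/4)) * (\<integral>\<^sup>+ t. g1 \<bar>t - m\<bar> \<partial>lborel)
      + (ennreal (1/2) * (\<integral>\<^sup>+ t. g2 t \<partial>lborel) + ennreal (1/2) * (\<integral>\<^sup>+ t. g2 \<bar>t - m\<bar> \<partial>lborel))"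
    by (simp add: nn_integral_add nn_integral_cmult)
  also have "\<dots> \<le> ennreal (S powr (-3/4)) * ennreal (8 * S powr (1/4))
      + (ennreal (1/2) * ennreal (2 * S powr (-1/2)) + ennreal (1/2) * ennreal (4 * S powr (-1/2)))"
    using i1 i2 i3 by (intro add_mono mult_left_mono) auto
  also have "\<dots> = ennreal (S powr (-3/4) * (8 * S powr (1/4)) + (1/2 * (2 * S powr (-1/2)) + 1/2 * (4 * S powr (-1/2))))"
    by (simp del: ennreal_half flip: ennreal_plus ennreal_mult')
  also have "S powr (-3/4) * (8 * S powr (1/4)) = 8 * S powr (-1/2)"
    by (simp add: powr_add[symmetric])
  finally show ?thesis by simp
qed

section \<open>The propagator on the torus\<close>

lemma borel_measurable_torus:
  fixes f :: "real ^ 'd::finite \<Rightarrow> 'b::topological_space"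
  assumes "f \<in> borel_measurable borel"
  shows "f \<in> borel_measurable torus"
  using assms unfolding torus_def by (intro measurable_restrict_space1) simp

lemma emeasure_torus: "emeasure torus (space (torus :: (real ^ 'd::finite) measure)) = ennreal ((2 * pi) ^ CARD('d))"
proof -
  have "emeasure torus (space (torus :: (real ^ 'd) measure)) = emeasure lborel (cbox (\<chi> i. - pi) (\<chi> i. pi) :: (real ^ 'd) set)"
    by (simp add: torus_def emeasure_restrict_space space_restrict_space)
  also have "\<dots> = ennreal (\<Prod>b\<in>Basis. ((\<chi> i. pi) - (\<chi> i. - pi)) \<bullet> (b :: real ^ 'd))"
    by (intro emeasure_lborel_cbox) (auto simp: Basis_vec_def inner_axis)
  also have "(\<Prod>b\<in>Basis. ((\<chi> i. pi) - (\<chi> i. - pi)) \<bullet> (b :: real ^ 'd)) = (\<Prod>b\<in>(Basis :: (real ^ 'd) set). 2 * pi)"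
    by (intro prod.cong) (auto simp: Basis_vec_def inner_axis)
  finally show ?thesis by simp
qed

interpretation torus: finite_measure "torus :: (real ^ 'd::finite) measure"
  by standard (simp add: emeasure_torus)

lemma measure_torus: "measure torus (space (torus :: (real ^ 'd::finite) measure)) = (2 * pi) ^ CARD('d)"
  using emeasure_torus[where 'd = 'd] by (simp add: measure_def)

lemma integrable_torus:
  fixes f :: "real ^ 'd::finite \<Rightarrow> 'b::{banach, second_countable_topology}"
  assumes "f \<in> borel_measurable torus" "\<And>w. norm (f w) \<le> B"
  shows "integrable torus f"
  using assms by (intro torus.integrable_const_bound[of _ B]) auto

lemma norm_integral_torus_le:
  fixes f :: "real ^ 'd::finite \<Rightarrow> 'b::{banach, second_countable_topology}"
  assumes "f \<in> borel_measurable torus" "\<And>w. norm (f w) \<le> B"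
  shows "norm (integral\<^sup>L torus f) \<le> (2 * pi) ^ CARD('d) * B"
proof -
  have "norm (integral\<^sup>L torus f) \<le> (\<integral>\<xi>. norm (f \<xi>) \<partial>torus)" by (rule integral_norm_bound)
  also have "\<dots> \<le> (\<integral>\<xi>. B \<partial>(torus :: (real ^ 'd) measure))"
    using integrable_torus[OF assms] assms(2) by (intro integral_mono) auto
  finally show ?thesis by (simp add: measure_torus)
qed

lemma integral_torus_prod:
  fixes u :: "'d::finite \<Rightarrow> real \<Rightarrow> complex"
  assumes cont: "\<And>j. continuous_on UNIV (u j)"
  shows "(\<integral>\<xi>. (\<Prod>j\<in>UNIV. u j (\<xi> $ j)) \<partial>torus) = (\<Prod>j\<in>UNIV. integral {-pi..pi} (u j))"
proof -
  interpret P: product_sigma_finite "\<lambda>_ :: real ^ 'd. lborel :: real measure" by standard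
  define v where "v j x = indicator {-pi..pi} x *\<^sub>R u j x" for j and x :: real
  have [measurable]: "u j \<in> borel_measurable borel" for j
    using cont by (rule borel_measurable_continuous_onI)
  have [measurable]: "v j \<in> borel_measurable borel" for j
    unfolding v_def by measurable
  have vi: "integrable lborel (v j)" and vI: "integral\<^sup>L lborel (v j) = integral {-pi..pi} (u j)" for j
  proof -
    have "set_integrable lborel {-pi..pi} (u j)"
      using cont by (intro borel_integrable_atLeastAtMost') (auto intro: continuous_on_subset)
    then show "integrable lborel (v j)" "integral\<^sup>L lborel (v j) = integral {-pi..pi} (u j)"
      using set_borel_integral_eq_integral(2)[of "{-pi..pi}" "u j"]
      by (auto simp: set_integrable_def set_lebesgue_integral_def v_def[abs_def])
  qed
  have B: "(Basis :: (real ^ 'd) set) = range (\<lambda>j. axis j 1)"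
    by (auto simp: Basis_vec_def)
  have inj: "inj (\<lambda>j :: 'd. axis j (1::real))" by (auto simp: inj_def axis_eq_axis)
  \<comment> \<open>Lebesgue measure is the image of a product measure indexed by
    \<open>Basis\<close>; J translates basis vectors back into coordinate indices so that the
    product formula for integrals applies.\<close>
  define J where "J = the_inv (\<lambda>j :: 'd. axis j (1::real))"
  have J: "J (axis j 1) = j" for j unfolding J_def by (rule the_inv_f_f[OF inj])
  have ind: "indicator (cbox (\<chi> i. - pi) (\<chi> i. pi)) \<xi> *\<^sub>R (\<Prod>j\<in>UNIV. u j (\<xi> $ j)) = (\<Prod>j\<in>UNIV. v j (\<xi> $ j))" for \<xi> :: "real ^ 'd"
  proof (cases "\<xi> \<in> cbox (\<chi> i. - pi) (\<chi> i. pi)")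
    case True
    then show ?thesis by (simp add: v_def mem_box_cart)
  next
    case False
    then obtain j where "\<xi> $ j \<notin> {-pi..pi}" by (auto simp: mem_box_cart)
    then have "v j (\<xi> $ j) = 0" by (simp add: v_def)
    then have "(\<Prod>j\<in>UNIV. v j (\<xi> $ j)) = 0" by (intro prod_zero) auto
    then show ?thesis using False by simp
  qed
  have comp: "(\<Sum>b\<in>Basis. f b *\<^sub>R b) $ j = f (axis j 1)" for f :: "real ^ 'd \<Rightarrow> real" and j
    proof -
    have "(\<Sum>b\<in>Basis. f b *\<^sub>R b) $ j = (\<Sum>i\<in>UNIV. f (axis i 1) * (axis i 1 :: real ^ 'd) $ j)"
      by (simp add: B sum.reindex[OF inj] o_def)
    also have "\<dots> = (\<Sum>i\<in>UNIV. if i = j then f (axis j 1) else 0)"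
      by (intro sum.cong) (auto simp: axis_def)
    finally show ?thesis by simp
  qed
  have "(\<integral>\<xi>. (\<Prod>j\<in>UNIV. u j (\<xi> $ j)) \<partial>torus) = (\<integral>\<xi>. (\<Prod>j\<in>UNIV. v j (\<xi> $ j)) \<partial>(lborel :: (real ^ 'd) measure))"
    unfolding torus_def by (subst integral_restrict_space) (auto simp: ind)
  also have "\<dots> = (\<integral>f. (\<Prod>j\<in>UNIV. v j ((\<Sum>b\<in>Basis. f b *\<^sub>R b) $ j)) \<partial>(\<Pi>\<^sub>M b\<in>(Basis :: (real ^ 'd) set). lborel))"
    by (subst lborel_eq, rule integral_distr) auto
  also have "\<dots> = (\<integral>f. (\<Prod>j\<in>UNIV. v j (f (axis j 1))) \<partial>(\<Pi>\<^sub>M b\<in>(Basis :: (real ^ 'd) set). lborel))"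
    by (simp only: comp)
  also have "\<dots> = (\<integral>f. (\<Prod>b\<in>Basis. v (J b) (f b)) \<partial>(\<Pi>\<^sub>M b\<in>(Basis :: (real ^ 'd) set). lborel))"
    by (simp add: B prod.reindex[OF inj] o_def J)
  also have "\<dots> = (\<Prod>b\<in>(Basis :: (real ^ 'd) set). integral\<^sup>L lborel (v (J b)))"
    by (rule P.product_integral_prod) (auto simp: vi)
  also have "\<dots> = (\<Prod>j\<in>UNIV. integral {-pi..pi} (u j))"
    by (simp add: B prod.reindex[OF inj] o_def J vI)
  finally show ?thesis .
qed

section \<open>Characters, the symbol omega and its propagator\<close>

abbreviation L2_sq :: "(real ^ 'd::finite \<Rightarrow> complex) \<Rightarrow> real" where
  "L2_sq u \<equiv> \<integral>\<xi>. (norm (u \<xi>))\<^sup>2 \<partial>torus"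

lemma cis_sum: "cis (\<Sum>i\<in>A. f i) = (\<Prod>i\<in>A. cis (f i))"
  by (induction A rule: infinite_finite_induct) (auto simp: cis_mult[symmetric])

lemma plane_wave_add: "plane_wave \<xi> (x + y) = plane_wave \<xi> x * plane_wave \<xi> y"
  by (simp add: plane_wave_def cis_mult sum.distrib[symmetric] algebra_simps)

lemma plane_wave_minus: "plane_wave \<xi> (- x) = cnj (plane_wave \<xi> x)"
  by (simp add: plane_wave_def cis_cnj sum_negf)

lemma plane_wave_axis: "plane_wave \<xi> (axis j s) = cis (of_int s * \<xi> $ j)"
proof -
  have "(\<Sum>i\<in>UNIV. of_int (axis j s $ i) * \<xi> $ i) = (\<Sum>i\<in>UNIV. if i = j then of_int s * \<xi> $ j else 0)"
    by (intro sum.cong) (auto simp: axis_def)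
  then show ?thesis by (simp add: plane_wave_def)
qed

lemma norm_plane_wave [simp]: "norm (plane_wave \<xi> x) = 1"
  by (simp add: plane_wave_def)

lemma continuous_on_plane_wave_omega [continuous_intros]:
  "continuous_on S (\<lambda>\<xi>. plane_wave \<xi> x)" "continuous_on S omega"
  unfolding plane_wave_def omega_def[abs_def] by (intro continuous_intros)+

lemma measurable_plane_wave [measurable]: "(\<lambda>\<xi>. plane_wave \<xi> x) \<in> borel_measurable borel"
  by (intro borel_measurable_continuous_onI continuous_intros)

lemma measurable_omega [measurable]: "omega \<in> borel_measurable borel"
  by (intro borel_measurable_continuous_onI continuous_intros)

lemma measurable_cis [measurable]: "cis \<in> borel_measurable borel"
  by (intro borel_measurable_continuous_onI continuous_intros)

lemma omega_sq:
  fixes \<xi> :: "real ^ 'd::finite"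
  shows "(omega \<xi>)\<^sup>2 = 1 + 2 * real CARD('d) - (\<Sum>j\<in>UNIV. 2 * cos (\<xi> $ j))"
proof -
  have "(omega \<xi>)\<^sup>2 = 1 + (\<Sum>j\<in>UNIV. 2 * (1 - cos (\<xi> $ j)))"
    unfolding omega_def by (intro real_sqrt_pow2 add_nonneg_nonneg sum_nonneg) auto
  then show ?thesis by (simp add: algebra_simps sum_subtractf)
qed

lemma omega_ge_1: "1 \<le> omega \<xi>"
  unfolding omega_def by (simp add: sum_nonneg)

lemma omega_sq_le: "(omega (\<xi> :: real ^ 'd::finite))\<^sup>2 \<le> 1 + 4 * real CARD('d)"
proof -
  have "(\<Sum>j\<in>(UNIV :: 'd set). 2 * cos (\<xi> $ j)) \<ge> (\<Sum>j\<in>(UNIV :: 'd set). - 2)"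
    by (intro sum_mono) auto
  then show ?thesis by (simp add: omega_sq)
qed

lemma omega_le: "omega (\<xi> :: real ^ 'd::finite) \<le> 1 + 4 * real CARD('d)"
  using omega_sq_le[of \<xi>] omega_ge_1[of \<xi>] self_le_power[of "omega \<xi>" 2] by simp

text \<open>The symbol of exp(-i \<tau> (1 - \<Delta>)), with \<Delta> the lattice
  Laplacian.\<close>

definition propagator :: "real \<Rightarrow> real ^ 'd::finite \<Rightarrow> complex" where
  "propagator \<tau> \<xi> = cis (- \<tau> * (omega \<xi>)\<^sup>2)"

lemma norm_propagator [simp]: "norm (propagator \<tau> \<xi>) = 1"
  by (simp add: propagator_def)

text \<open>Left without the factor (2 pi)^(-d); the normalisation is restored once, in the constant
  of the theorem.\<close>

abbreviation propagator_kernel :: "real \<Rightarrow> 'd::finite lattice \<Rightarrow> complex" where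
  "propagator_kernel \<tau> x \<equiv> \<integral>\<xi>. propagator \<tau> \<xi> * plane_wave \<xi> x \<partial>torus"

abbreviation weighted_kernel :: "real \<Rightarrow> (real ^ 'd::finite \<Rightarrow> real) \<Rightarrow> 'd lattice \<Rightarrow> complex" where
  "weighted_kernel \<tau> u x \<equiv> \<integral>\<xi>. propagator \<tau> \<xi> * of_real (u \<xi>) * plane_wave \<xi> x \<partial>torus"

text \<open>\<open>omega_sq\<close> makes the phase a sum over coordinates. Its constant part is a
  unimodular factor, and the coefficient 2 of each cosine doubles the time.\<close>

lemma integral_propagator:
  fixes x :: "'d::finite lattice"
  shows "propagator_kernel \<tau> x
    = cis (- \<tau> * (1 + 2 * real CARD('d))) * (\<Prod>j\<in>UNIV. bessel_integral (of_int (x $ j)) (2 * \<tau>))"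
proof -
  have "propagator \<tau> \<xi> * plane_wave \<xi> x = cis (- \<tau> * (1 + 2 * real CARD('d))) *
      (\<Prod>j\<in>UNIV. cis (of_int (x $ j) * \<xi> $ j + 2 * \<tau> * cos (\<xi> $ j)))" for \<xi>
    by (simp add: propagator_def plane_wave_def omega_sq cis_mult cis_sum[symmetric] sum.distrib
        sum_distrib_left sum_negf algebra_simps)
  then have "propagator_kernel \<tau> x = cis (- \<tau> * (1 + 2 * real CARD('d))) *
     (\<integral>\<xi>. (\<Prod>j\<in>UNIV. cis (of_int (x $ j) * \<xi> $ j + 2 * \<tau> * cos (\<xi> $ j))) \<partial>torus)"
    by simp
  also have "(\<integral>\<xi>. (\<Prod>j\<in>UNIV. cis (of_int (x $ j) * \<xi> $ j + 2 * \<tau> * cos (\<xi> $ j))) \<partial>torus)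
     = (\<Prod>j\<in>UNIV. bessel_integral (of_int (x $ j)) (2 * \<tau>))"
    unfolding bessel_integral_def by (intro integral_torus_prod continuous_intros)
  finally show ?thesis .
qed

lemma bessel_integral_0: "bessel_integral (of_int n) 0 = (if n = 0 then 2 * pi else 0)"
proof (cases "n = 0")
  case True
  then show ?thesis by (simp add: bessel_integral_def scaleR_conv_of_real)
next
  case False
  have "((\<lambda>\<theta>. cis (of_int n * \<theta>)) has_integral
      (cis (of_int n * pi) / (\<i> * of_int n) - cis (of_int n * (-pi)) / (\<i> * of_int n))) {-pi..pi}"
  proof (rule fundamental_theorem_of_calculus)
    fix x assume "x \<in> {-pi..pi}"
    have "((\<lambda>w. exp (\<i> * of_int n * w) / (\<i> * of_int n)) has_field_derivative exp (\<i> * of_int n * of_real x)) (at (of_real x))"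
      using False by (auto intro!: derivative_eq_intros)
    then have "((\<lambda>t. exp (\<i> * of_int n * of_real t) / (\<i> * of_int n)) has_vector_derivative exp (\<i> * of_int n * of_real x)) (at x within {-pi..pi})"
      by (rule has_vector_derivative_real_field)
    then show "((\<lambda>t. cis (of_int n * t) / (\<i> * of_int n)) has_vector_derivative cis (of_int n * x)) (at x within {-pi..pi})"
      by (simp add: cis_conv_exp mult_ac)
  qed simp
  moreover have "cis (of_int n * pi) = cis (of_int n * (-pi))"
    by (simp add: complex_eq_iff sin_zero_iff_int2 mult.commute)
  ultimately show ?thesis using False by (simp add: bessel_integral_def integral_unique)
qed

text \<open>Orthogonality of characters is read off from the factorised propagator at time
  0.\<close>

lemma integral_plane_wave:
  fixes x :: "'d::finite lattice"
  shows "(\<integral>\<xi>. plane_wave \<xi> x \<partial>torus) = (if x = 0 then (2 * pi) ^ CARD('d) else 0)"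
proof -
  have "(\<integral>\<xi>. plane_wave \<xi> x \<partial>torus) = (\<Prod>j\<in>UNIV. bessel_integral (of_int (x $ j)) 0)"
    using integral_propagator[of 0 x] by (simp add: propagator_def)
  also have "\<dots> = (if x = 0 then (2 * pi) ^ CARD('d) else 0)"
  proof (cases "x = 0")
    case False
    then obtain j where "x $ j \<noteq> 0" by (auto simp: vec_eq_iff)
    then have "(\<Prod>j\<in>UNIV. bessel_integral (of_int (x $ j)) 0) = 0"
      by (intro prod_zero) (auto simp: bessel_integral_0)
    then show ?thesis using False by simp
  qed (use bessel_integral_0[of 0] in \<open>simp add: power_mult_distrib\<close>)
  finally show ?thesis .
qed


text \<open>All factors are replaced by the largest one. Three copies of it give the power -3/4 and
  the other d - 3 are bounded trivially by 2 pi. A pure cube avoids products that mix the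
  singularities of different coordinates.\<close>

lemma norm_integral_propagator_le:
  fixes x :: "'d::finite lattice"
  assumes "3 \<le> CARD('d)" "0 < t" "\<And>j. t \<noteq> \<bar>of_int (x $ j)\<bar> / 2" "\<bar>\<tau>\<bar> = t"
  shows "norm (propagator_kernel \<tau> x) \<le>
    (2 * pi) ^ (CARD('d) - 3) * (12 * pi\<^sup>2 + 6) ^ 3 * (\<Sum>j\<in>UNIV. (t * \<bar>t - \<bar>of_int (x $ j)\<bar> / 2\<bar>) powr (-3/4))"
proof -
  define b where "b j = norm (bessel_integral (of_int (x $ j)) (2 * \<tau>))" for j
  have bj: "b j ^ 3 \<le> (12 * pi\<^sup>2 + 6) ^ 3 * (t * \<bar>t - \<bar>of_int (x $ j)\<bar> / 2\<bar>) powr (-3/4)" for j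
  proof -
    define y where "y = t * \<bar>t - \<bar>of_int (x $ j)\<bar> / 2\<bar>"
    have y: "0 < y" using assms(2) assms(3)[of j] by (simp add: y_def)
    have eq: "\<bar>2 * \<tau>\<bar> * \<bar>\<bar>2 * \<tau>\<bar> - \<bar>of_int (x $ j)\<bar>\<bar> = 4 * y"
    proof -
      have "\<bar>2 * t - a\<bar> = 2 * \<bar>t - a / 2\<bar>" for a :: real by (simp add: abs_if)
      moreover have "\<bar>2 * \<tau>\<bar> = 2 * t" using assms(4) by (simp add: abs_mult)
      ultimately show ?thesis by (simp add: y_def)
    qed
    have "b j \<le> (12 * pi\<^sup>2 + 6) * (4 * y) powr (-1/4)"
      using norm_bessel_integral_le[of "2 * \<tau>" "of_int (x $ j)"] assms(2,4) assms(3)[of j]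
      unfolding eq b_def by (auto simp: abs_mult)
    also have "\<dots> \<le> (12 * pi\<^sup>2 + 6) * y powr (-1/4)"
      using y by (intro mult_left_mono powr_mono2') auto
    finally have "b j ^ 3 \<le> ((12 * pi\<^sup>2 + 6) * y powr (-1/4)) ^ 3"
      by (intro power_mono) (auto simp: b_def)
    also have "\<dots> = (12 * pi\<^sup>2 + 6) ^ 3 * (y powr (-1/4)) ^ 3" by (simp add: power_mult_distrib)
    also have "(y powr (-1/4)) ^ 3 = y powr (-3/4)"
      using y by (simp add: powr_realpow[symmetric] powr_powr)
    finally show ?thesis by (simp add: y_def)
  qed
  have b0: "0 \<le> b j" for j by (simp add: b_def)
  have "Max (range b) \<in> range b" by (intro Max_in) auto
  then obtain k where k: "b k = Max (range b)" by (auto simp: image_iff)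
  have "norm (propagator_kernel \<tau> x) = (\<Prod>j\<in>UNIV. b j)"
    unfolding integral_propagator by (simp add: norm_mult prod_norm b_def)
  also have "\<dots> \<le> (\<Prod>j\<in>(UNIV :: 'd set). b k)"
    unfolding k by (intro prod_mono) (auto simp: b0)
  also have "\<dots> = b k ^ (CARD('d) - 3) * b k ^ 3"
    using assms(1) by (simp add: power_add[symmetric])
  \<comment> \<open>The maximising coordinate k depends on the time; the sum over all coordinates
    removes this dependence at the cost of a factor d after integration.\<close>
  also have "\<dots> \<le> (2 * pi) ^ (CARD('d) - 3) * (\<Sum>j\<in>UNIV. b j ^ 3)"
    using norm_bessel_integral_le_2pi
    by (intro mult_mono power_mono member_le_sum) (auto simp: b_def intro: sum_nonneg)
  also have "\<dots> \<le> (2 * pi) ^ (CARD('d) - 3) * (\<Sum>j\<in>UNIV. (12 * pi\<^sup>2 + 6) ^ 3 * (t * \<bar>t - \<bar>of_int (x $ j)\<bar> / 2\<bar>) powr (-3/4))"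
    by (intro mult_left_mono sum_mono bj) auto
  finally show ?thesis by (simp add: sum_distrib_left mult_ac)
qed

text \<open>The pointwise kernel constant, times 11 for the time integral belonging to each of the d
  coordinates.\<close>

definition dispersive_const :: "'d::finite itself \<Rightarrow> real" where
  "dispersive_const _ = (2 * pi) ^ (CARD('d) - 3) * (12 * pi\<^sup>2 + 6) ^ 3 * (real CARD('d) * 11)"

lemma measurable_integral_torus [measurable]:
  fixes f :: "real \<Rightarrow> real ^ 'd::finite \<Rightarrow> complex"
  assumes "(\<lambda>(\<tau>, \<xi>). f \<tau> \<xi>) \<in> borel_measurable (borel \<Otimes>\<^sub>M borel)"
  shows "(\<lambda>\<tau>. \<integral>\<xi>. f \<tau> \<xi> \<partial>torus) \<in> borel_measurable borel"
proof (rule torus.borel_measurable_lebesgue_integral)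
  have "(\<lambda>p. (fst p, snd p)) \<in> measurable (borel \<Otimes>\<^sub>M torus) (borel \<Otimes>\<^sub>M borel :: (real \<times> (real ^ 'd)) measure)"
    by (intro measurable_Pair measurable_fst measurable_compose[OF measurable_snd borel_measurable_torus]) auto
  from measurable_compose[OF this assms]
  show "(\<lambda>(\<tau>, \<xi>). f \<tau> \<xi>) \<in> borel_measurable (borel \<Otimes>\<^sub>M torus)" by (simp add: case_prod_beta')
qed

lemma nn_integral_propagator_le:
  fixes x :: "'d::finite lattice"
  assumes d: "3 \<le> CARD('d)" and S: "0 < S" and s: "s \<in> {1, -1}"
  shows "(\<integral>\<^sup>+ t. ennreal (norm (propagator_kernel (s * t) x)) * indicator {S..} t \<partial>lborel)
    \<le> ennreal (dispersive_const TYPE('d) * S powr (-1/2))"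
proof -
  define C where "C = (2 * pi) ^ (CARD('d) - 3) * (12 * pi\<^sup>2 + 6) ^ 3"
  have C: "0 \<le> C" by (simp add: C_def)
  define K where "K j t = ennreal ((t * \<bar>t - \<bar>of_int (x $ j)\<bar> / 2\<bar>) powr (-3/4)) * indicator {S..} t" for j t
  have [measurable]: "K j \<in> borel_measurable borel" for j unfolding K_def by measurable
  \<comment> \<open>The pointwise bound excludes the finitely many times at which some Bessel factor
    sits exactly on its singularity.\<close>
  have "AE t in lborel. \<forall>j\<in>(UNIV :: 'd set). (t::real) \<noteq> \<bar>of_int (x $ j)\<bar> / 2"
    by (subst AE_finite_all[OF finite], intro ballI AE_lborel_singleton)
  then have ae: "AE t in lborel. \<forall>j. (t::real) \<noteq> \<bar>of_int (x $ j)\<bar> / 2"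
    by simp
  have "(\<integral>\<^sup>+ t. ennreal (norm (propagator_kernel (s * t) x)) * indicator {S..} t \<partial>lborel)
    \<le> (\<integral>\<^sup>+ t. ennreal C * (\<Sum>j\<in>UNIV. K j t) \<partial>lborel)"
  proof (intro nn_integral_mono_AE, use ae in eventually_elim)
    case (elim t)
    show ?case
    proof (cases "S \<le> t")
      case True
      have "norm (propagator_kernel (s * t) x) \<le> C * (\<Sum>j\<in>UNIV. (t * \<bar>t - \<bar>of_int (x $ j)\<bar> / 2\<bar>) powr (-3/4))"
        unfolding C_def using d S True elim s by (intro norm_integral_propagator_le) auto
      then have "ennreal (norm (propagator_kernel (s * t) x)) \<le> ennreal C * (\<Sum>j\<in>UNIV. ennreal ((t * \<bar>t - \<bar>of_int (x $ j)\<bar> / 2\<bar>) powr (-3/4)))"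
        using C by (subst sum_ennreal) (auto simp: ennreal_mult[symmetric] sum_nonneg intro!: ennreal_leI)
      then show ?thesis using True by (simp add: K_def)
    qed simp
  qed
  also have "\<dots> = ennreal C * (\<Sum>j\<in>UNIV. \<integral>\<^sup>+ t. K j t \<partial>lborel)"
    by (simp add: nn_integral_cmult nn_integral_sum)
  also have "\<dots> \<le> ennreal C * (\<Sum>j\<in>(UNIV :: 'd set). ennreal (11 * S powr (-1/2)))"
    unfolding K_def using S by (intro mult_left_mono sum_mono nn_integral_powr_kernel_le) auto
  also have "\<dots> = ennreal (dispersive_const TYPE('d) * S powr (-1/2))"
    using C by (simp add: ennreal_of_nat_eq_real_of_nat ennreal_mult'[symmetric] ennreal_mult''[symmetric] dispersive_const_def C_def mult_ac)
  finally show ?thesis .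
qed

section \<open>Expansion of omega in powers of the hopping symbol\<close>

definition hopping :: "real ^ 'd::finite \<Rightarrow> real" where
  "hopping \<xi> = (\<Sum>j\<in>UNIV. 2 * cos (\<xi> $ j)) / (1 + 2 * real CARD('d))"

text \<open>The maximum of |\<open>hopping\<close>|. The mass term 1 in \<open>omega\<close> keeps
  it strictly below 1, hence inside the disc of convergence of the square root series.\<close>

definition hopping_bound :: "'d::finite itself \<Rightarrow> real" where
  "hopping_bound _ = 2 * real CARD('d) / (1 + 2 * real CARD('d))"

text \<open>Binomial coefficients of the root of (1 + 2d)(1 - h) in powers of h; this root is
  \<open>omega\<close> at h = \<open>hopping\<close>.\<close>

definition sqrt_coeff :: "'d::finite itself \<Rightarrow> nat \<Rightarrow> real" where
  "sqrt_coeff _ k = sqrt (1 + 2 * real CARD('d)) * (((1/2) gchoose k) * (-1) ^ k)"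

lemma measurable_hopping [measurable]: "hopping \<in> borel_measurable borel"
  unfolding hopping_def[abs_def] by (intro borel_measurable_continuous_onI continuous_intros) auto

lemma hopping_bound: "0 \<le> hopping_bound TYPE('d::finite)" "hopping_bound TYPE('d) < 1"
  by (auto simp: hopping_bound_def divide_less_eq add_pos_nonneg)

lemma abs_hopping_le: "\<bar>hopping (\<xi> :: real ^ 'd::finite)\<bar> \<le> hopping_bound TYPE('d)"
proof -
  have "\<bar>\<Sum>j\<in>(UNIV :: 'd set). 2 * cos (\<xi> $ j)\<bar> \<le> (\<Sum>j\<in>(UNIV :: 'd set). 2)"
    by (intro sum_abs[THEN order_trans] sum_mono) (auto simp: abs_mult)
  then show ?thesis by (simp add: hopping_def hopping_bound_def divide_right_mono)
qed

lemma summable_sqrt_coeff: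
  "summable (\<lambda>k. \<bar>sqrt_coeff TYPE('d::finite) k\<bar> * hopping_bound TYPE('d) ^ k)"
proof -
  define q where "q = hopping_bound TYPE('d)"
  \<comment> \<open>Plain convergence of the binomial series at a point r strictly between q and 1
    yields absolute convergence at q.\<close>
  define r where "r = (1 + q) / 2"
  have qr: "0 \<le> q" "q < r" "r < 1" using hopping_bound[where 'd = 'd] by (auto simp: q_def r_def)
  have "summable (\<lambda>n. ((1/2) gchoose n) * r ^ n)"
    using gen_binomial_real[of r "1/2"] qr by (intro sums_summable) auto
  then have "summable (\<lambda>n. norm (((1/2) gchoose n) * q ^ n))"
    using qr by (intro powser_insidea[of _ r]) auto
  then have "summable (\<lambda>n. sqrt (1 + 2 * real CARD('d)) * norm (((1/2) gchoose n) * q ^ n))"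
    by (rule summable_mult)
  then show ?thesis
    using qr by (simp add: sqrt_coeff_def abs_mult power_abs q_def mult_ac)
qed

lemma omega_sums: "(\<lambda>k. sqrt_coeff TYPE('d) k * hopping \<xi> ^ k) sums omega (\<xi> :: real ^ 'd::finite)"
proof -
  define M where "M = 1 + 2 * real CARD('d)"
  have M: "0 < M" by (simp add: M_def)
  have h: "\<bar>hopping \<xi>\<bar> < 1" using abs_hopping_le[of \<xi>] hopping_bound[where 'd = 'd] by simp
  have "(\<lambda>n. ((1/2) gchoose n) * (- hopping \<xi>) ^ n) sums (1 + - hopping \<xi>) powr (1/2)"
    using h by (intro gen_binomial_real) auto
  then have "(\<lambda>n. sqrt M * (((1/2) gchoose n) * (- hopping \<xi>) ^ n)) sums (sqrt M * (1 + - hopping \<xi>) powr (1/2))"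
    by (rule sums_mult)
  moreover have "sqrt M * (1 + - hopping \<xi>) powr (1/2) = sqrt (M * (1 - hopping \<xi>))"
    using h by (simp add: powr_half_sqrt real_sqrt_mult)
  moreover have "M * (1 - hopping \<xi>) = (omega \<xi>)\<^sup>2"
    using M by (simp add: omega_sq hopping_def M_def field_simps)
  ultimately have "(\<lambda>n. sqrt M * (((1/2) gchoose n) * (- hopping \<xi>) ^ n)) sums omega \<xi>"
    using omega_ge_1[of \<xi>] by simp
  moreover have "sqrt M * (((1/2) gchoose n) * (- hopping \<xi>) ^ n) = sqrt_coeff TYPE('d) n * hopping \<xi> ^ n" for n
    by (simp add: sqrt_coeff_def M_def power_minus[of "hopping \<xi>"] mult_ac)
  ultimately show ?thesis by simp
qed

text \<open>Multiplication by \<open>hopping\<close> acts on kernels as a normalised sum over the 2d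
  neighbours of x, with no other effect.\<close>

lemma hopping_plane_wave:
  fixes x :: "'d::finite lattice"
  shows "of_real (hopping \<xi>) * plane_wave \<xi> x =
    (\<Sum>(j, s)\<in>UNIV \<times> {1, -1}. plane_wave \<xi> (x + axis j s)) / of_real (1 + 2 * real CARD('d))"
proof -
  have cs: "cis t + cis (- t) = of_real (2 * cos t)" for t
    by (simp add: complex_eq_iff)
  have "(\<Sum>(j, s)\<in>UNIV \<times> {1, -1}. plane_wave \<xi> (x + axis j s))
     = (\<Sum>j\<in>UNIV. (cis (\<xi> $ j) + cis (- (\<xi> $ j))) * plane_wave \<xi> x)"
    by (simp add: sum.cartesian_product[symmetric] plane_wave_add plane_wave_axis algebra_simps)
  also have "\<dots> = of_real (\<Sum>j\<in>UNIV. 2 * cos (\<xi> $ j)) * plane_wave \<xi> x"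
    by (simp only: cs of_real_sum sum_distrib_right)
  finally show ?thesis by (simp add: hopping_def)
qed

text \<open>Since the bound is uniform in x, each further power of \<open>hopping\<close> replaces
  the kernel by 2d translates divided by 1 + 2d and costs exactly the factor
  \<open>hopping_bound\<close>.\<close>

lemma nn_integral_propagator_hopping_le:
  fixes x :: "'d::finite lattice"
  assumes d: "3 \<le> CARD('d)" and S: "0 < S" and s: "s \<in> {1, -1}"
  shows "(\<integral>\<^sup>+ t. ennreal (norm (weighted_kernel (s * t) (\<lambda>\<xi>. hopping \<xi> ^ k) x)) * indicator {S..} t \<partial>lborel)
    \<le> ennreal (hopping_bound TYPE('d) ^ k * (dispersive_const TYPE('d) * S powr (-1/2)))"
proof (induction k arbitrary: x)
  case 0
  show ?case using nn_integral_propagator_le[OF assms, of x] by simp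
next
  case (Suc k)
  define I where "I x t = weighted_kernel (s * t) (\<lambda>\<xi>. hopping \<xi> ^ k) x" for x :: "'d lattice" and t
  define M where "M = 1 + 2 * real CARD('d)"
  define E where "E = dispersive_const TYPE('d) * S powr (-1/2)"
  have M: "0 < M" by (simp add: M_def)
  have E: "0 \<le> E" by (simp add: E_def dispersive_const_def)
  have [measurable]: "I x \<in> borel_measurable borel" for x
    unfolding I_def propagator_def by measurable
  define J where "J p t = ennreal (norm (I (x + axis (fst p) (snd p)) t)) * indicator {S..} t" for p t
  have [measurable]: "J p \<in> borel_measurable borel" for p
    unfolding J_def by measurable
  have int: "integrable torus (\<lambda>\<xi>. propagator (s * t) \<xi> * of_real (hopping \<xi> ^ k) * plane_wave \<xi> x)" for t and x :: "'d lattice"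
  proof (rule integrable_torus[where B = 1])
    show "norm (propagator (s * t) w * of_real (hopping w ^ k) * plane_wave w x) \<le> 1" for w
      using abs_hopping_le[of w] hopping_bound[where 'd = 'd]
      by (simp add: norm_mult norm_power power_le_one)
  qed (auto intro!: borel_measurable_torus simp: propagator_def)
  have step: "weighted_kernel (s * t) (\<lambda>\<xi>. hopping \<xi> ^ Suc k) x
     = (\<Sum>(j, u)\<in>UNIV \<times> {1, -1}. I (x + axis j u) t) / of_real M" for t
  proof -
    have "propagator (s * t) \<xi> * of_real (hopping \<xi> ^ Suc k) * plane_wave \<xi> x
        = propagator (s * t) \<xi> * of_real (hopping \<xi> ^ k) * (of_real (hopping \<xi>) * plane_wave \<xi> x)" for \<xi>
      by simp
    also have "\<dots> \<xi> = (\<Sum>(j, u)\<in>UNIV \<times> {1, -1}. propagator (s * t) \<xi> * of_real (hopping \<xi> ^ k) * plane_wave \<xi> (x + axis j u)) / of_real M" for \<xi>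
      unfolding hopping_plane_wave by (simp add: M_def sum_distrib_left case_prod_beta)
    finally have "weighted_kernel (s * t) (\<lambda>\<xi>. hopping \<xi> ^ Suc k) x = 
        (\<integral>\<xi>. (\<Sum>(j, u)\<in>UNIV \<times> {1, -1}. propagator (s * t) \<xi> * of_real (hopping \<xi> ^ k) * plane_wave \<xi> (x + axis j u)) / of_real M \<partial>torus)"
      by simp
    also have "\<dots> = (\<Sum>(j, u)\<in>UNIV \<times> {1, -1}. I (x + axis j u) t) / of_real M"
      using int by (simp add: I_def case_prod_beta)
    finally show ?thesis .
  qed
  have "(\<integral>\<^sup>+ t. ennreal (norm (weighted_kernel (s * t) (\<lambda>\<xi>. hopping \<xi> ^ Suc k) x)) * indicator {S..} t \<partial>lborel)
     \<le> (\<integral>\<^sup>+ t. ennreal (1 / M) * (\<Sum>p\<in>UNIV \<times> {1, -1}. J p t) \<partial>lborel)"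
  proof (intro nn_integral_mono)
    fix t
    have "norm (\<Sum>(j, u)\<in>UNIV \<times> {1, -1}. I (x + axis j u) t) / M \<le> (1 / M) * (\<Sum>(j, u)\<in>UNIV \<times> {1, -1}. norm (I (x + axis j u) t))"
      using M norm_sum[of "\<lambda>(j, u). I (x + axis j u) t" "UNIV \<times> {1, -1}"]
      by (simp add: divide_right_mono case_prod_beta)
    then have "ennreal (norm (\<Sum>(j, u)\<in>UNIV \<times> {1, -1}. I (x + axis j u) t) / M) \<le> ennreal (1 / M) * (\<Sum>(j, u)\<in>UNIV \<times> {1, -1}. ennreal (norm (I (x + axis j u) t)))"
      using M by (simp add: case_prod_beta ennreal_mult'[symmetric] sum_nonneg ennreal_leI)
    then show "ennreal (norm (weighted_kernel (s * t) (\<lambda>\<xi>. hopping \<xi> ^ Suc k) x)) * indicator {S..} t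
       \<le> ennreal (1 / M) * (\<Sum>p\<in>UNIV \<times> {1, -1}. J p t)"
      unfolding step using M by (cases "S \<le> t") (auto simp: norm_divide J_def case_prod_beta)
  qed
  also have "\<dots> = ennreal (1 / M) * (\<Sum>p\<in>UNIV \<times> {1, -1}. \<integral>\<^sup>+ t. J p t \<partial>lborel)"
    by (simp add: nn_integral_cmult nn_integral_sum)
  also have "\<dots> \<le> ennreal (1 / M) * (\<Sum>p\<in>(UNIV :: 'd set) \<times> {1, -1 :: int}. ennreal (hopping_bound TYPE('d) ^ k * E))"
    using Suc.IH unfolding J_def I_def E_def by (intro mult_left_mono sum_mono) auto
  also have "\<dots> = ennreal (hopping_bound TYPE('d) ^ Suc k * E)"
    using M E hopping_bound[where 'd = 'd]
    by (simp add: case_prod_beta ennreal_of_nat_eq_real_of_nat ennreal_mult'[symmetric] hopping_bound_def M_def card_cartesian_product mult_ac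
        flip: ennreal_numeral)
  finally show ?case by (simp add: E_def)
qed

definition resolvent_const :: "'d::finite itself \<Rightarrow> real" where
  "resolvent_const _ = (\<Sum>k. \<bar>sqrt_coeff TYPE('d) k\<bar> * hopping_bound TYPE('d) ^ k) * dispersive_const TYPE('d)"

text \<open>The power series of \<open>omega\<close> is integrated term by term, first over the
  torus and then in time; \<open>summable_sqrt_coeff\<close> justifies the former and makes the
  final sum finite.\<close>

lemma nn_integral_propagator_omega_le:
  fixes x :: "'d::finite lattice"
  assumes d: "3 \<le> CARD('d)" and S: "0 < S" and s: "s \<in> {1, -1}"
  shows "(\<integral>\<^sup>+ t. ennreal (norm (weighted_kernel (s * t) omega x)) * indicator {S..} t \<partial>lborel)
    \<le> ennreal (resolvent_const TYPE('d) * S powr (-1/2))"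
proof -
  define q where "q = hopping_bound TYPE('d)"
  define c where "c = sqrt_coeff TYPE('d)"
  define I where "I k t = weighted_kernel (s * t) (\<lambda>\<xi>. hopping \<xi> ^ k) x" for k t
  define E where "E = dispersive_const TYPE('d) * S powr (-1/2)"
  have E: "0 \<le> E" by (simp add: E_def dispersive_const_def)
  have q: "0 \<le> q" "q < 1" using hopping_bound[where 'd = 'd] by (auto simp: q_def)
  have sc: "summable (\<lambda>k. \<bar>c k\<bar> * q ^ k)" using summable_sqrt_coeff[where 'd = 'd] by (simp add: c_def q_def)
  have [measurable]: "I k \<in> borel_measurable borel" for k
    unfolding I_def propagator_def by measurable
  have bd: "norm (propagator (s * t) w * of_real (hopping w ^ k) * plane_wave w x) \<le> q ^ k" for t k and w :: "real ^ 'd"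
    using abs_hopping_le[of w] by (simp add: norm_mult norm_power power_mono q_def)
  have ms: "(\<lambda>\<xi>. propagator (s * t) \<xi> * of_real (hopping \<xi> ^ k) * plane_wave \<xi> x) \<in> borel_measurable torus" for t k
    by (auto intro!: borel_measurable_torus simp: propagator_def)
  have Is: "(\<lambda>k. of_real (c k) * I k t) sums (weighted_kernel (s * t) omega x)" for t
  proof -
    define F where "F k \<xi> = of_real (c k) * (propagator (s * t) \<xi> * of_real (hopping \<xi> ^ k) * plane_wave \<xi> x)" for k \<xi>
    have Fb: "norm (F k w) \<le> \<bar>c k\<bar> * q ^ k" for k w
      using bd[of t w k] by (simp add: F_def norm_mult mult_left_mono)
    have Fm: "F k \<in> borel_measurable torus" for k unfolding F_def[abs_def] using ms by measurable
    have "(\<lambda>k. integral\<^sup>L torus (F k)) sums (\<integral>\<xi>. (\<Sum>k. F k \<xi>) \<partial>torus)"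
    proof (rule sums_integral)
      show "integrable torus (F k)" for k by (rule integrable_torus[OF Fm Fb])
      show "AE \<xi> in torus. summable (\<lambda>k. norm (F k \<xi>))"
        using Fb by (intro AE_I2 summable_comparison_test'[OF sc]) auto
      have "norm (norm (\<integral>\<xi>. norm (F k \<xi>) \<partial>torus)) \<le> (2 * pi) ^ CARD('d) * (\<bar>c k\<bar> * q ^ k)" for k
        using norm_integral_torus_le[of "\<lambda>\<xi>. norm (F k \<xi>)" "\<bar>c k\<bar> * q ^ k"] Fb Fm by simp
      then show "summable (\<lambda>k. \<integral>\<xi>. norm (F k \<xi>) \<partial>torus)"
        by (intro summable_comparison_test'[OF summable_mult[OF sc]]) auto
    qed
    moreover have "(\<Sum>k. F k \<xi>) = propagator (s * t) \<xi> * of_real (omega \<xi>) * plane_wave \<xi> x" for \<xi>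
    proof -
      have "(\<lambda>k. propagator (s * t) \<xi> * complex_of_real (c k * hopping \<xi> ^ k) * plane_wave \<xi> x) sums
          (propagator (s * t) \<xi> * of_real (omega \<xi>) * plane_wave \<xi> x)"
        unfolding c_def by (intro sums_mult sums_mult2 sums_of_real omega_sums)
      then show ?thesis by (simp add: F_def mult_ac sums_iff)
    qed
    ultimately show ?thesis by (simp add: F_def[abs_def] I_def)
  qed
  have "(\<integral>\<^sup>+ t. ennreal (norm (weighted_kernel (s * t) omega x)) * indicator {S..} t \<partial>lborel)
    \<le> (\<integral>\<^sup>+ t. (\<Sum>k. ennreal \<bar>c k\<bar> * (ennreal (norm (I k t)) * indicator {S..} t)) \<partial>lborel)"
  proof (intro nn_integral_mono)
    fix t
    have nI: "norm (of_real (c k) * I k t) \<le> (2 * pi) ^ CARD('d) * (\<bar>c k\<bar> * q ^ k)" for k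
      using norm_integral_torus_le[OF ms bd, of t k] unfolding I_def[symmetric]
      by (simp add: norm_mult mult_left_mono mult_ac)
    have sI: "summable (\<lambda>k. norm (of_real (c k) * I k t))"
      using nI by (intro summable_comparison_test'[OF summable_mult[OF sc]]) auto
    have "norm (weighted_kernel (s * t) omega x) \<le> (\<Sum>k. norm (of_real (c k) * I k t))"
      using sums_unique[OF Is] summable_norm[OF sI] by simp
    then have "ennreal (norm (weighted_kernel (s * t) omega x)) \<le> (\<Sum>k. ennreal (norm (of_real (c k) * I k t)))"
      using sI by (subst suminf_ennreal2) (auto intro: ennreal_leI)
    then show "ennreal (norm (weighted_kernel (s * t) omega x)) * indicator {S..} t
       \<le> (\<Sum>k. ennreal \<bar>c k\<bar> * (ennreal (norm (I k t)) * indicator {S..} t))"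
      by (cases "S \<le> t") (auto simp: norm_mult ennreal_mult)
  qed
  also have "\<dots> = (\<Sum>k. ennreal \<bar>c k\<bar> * (\<integral>\<^sup>+ t. ennreal (norm (I k t)) * indicator {S..} t \<partial>lborel))"
    by (subst nn_integral_suminf) (auto simp: nn_integral_cmult)
  also have "\<dots> \<le> (\<Sum>k. ennreal \<bar>c k\<bar> * ennreal (q ^ k * E))"
    unfolding I_def q_def E_def by (intro suminf_le mult_left_mono nn_integral_propagator_hopping_le assms) auto
  also have "\<dots> = ennreal (\<Sum>k. \<bar>c k\<bar> * q ^ k * E)"
    using E q sc by (subst suminf_ennreal2[symmetric]) (auto simp: ennreal_mult'[symmetric] mult_ac intro: summable_mult2)
  also have "(\<Sum>k. \<bar>c k\<bar> * q ^ k * E) = resolvent_const TYPE('d) * S powr (-1/2)"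
    using suminf_mult2[OF sc, of E] by (simp add: resolvent_const_def E_def c_def q_def mult_ac)
  finally show ?thesis .
qed

section \<open>Restricted bounds\<close>

text \<open>On the dyadic level j the modulus of f is about 2^(-j), so the level has at most
  2^((j+1)p) points by Chebyshev. The assumed bound then gives K 2^(5p/6) r^j with r = 2^(5p/6 - 1),
  which is less than 1 precisely for p < 6/5. The weight b is arbitrary, so the lemma can be applied
  in each variable separately.\<close>

lemma sum_level_sets_le:
  fixes b f :: "'a \<Rightarrow> complex" and p K :: real
  assumes p: "0 < p" "p < 6 / 5" and K: "0 \<le> K" and X: "finite X"
    and bound: "\<And>X' M. \<lbrakk>X' \<subseteq> X; 0 \<le> M; \<And>x. x \<in> X' \<Longrightarrow> norm (f x) \<le> M\<rbrakk> \<Longrightarrow>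
      norm (\<Sum>x\<in>X'. f x * b x) \<le> K * M * real (card X') powr (5/6)"
    and le1: "(\<Sum>x\<in>X. norm (f x) powr p) \<le> 1"
  shows "norm (\<Sum>x\<in>X. f x * b x) \<le> K * (2 powr (5 * p / 6) / (1 - 2 powr (5 * p / 6 - 1)))"
proof -
  define X0 where "X0 = {x \<in> X. f x \<noteq> 0}"
  have X0: "finite X0" using X by (simp add: X0_def)
  \<comment> \<open>Zeros of f are excluded by X0, and f has modulus at most 1 on X by
    \<open>le1\<close>; hence the floor is nonnegative wherever it is used and \<open>nat\<close>
    does not truncate.\<close>
  define level where "level x = nat \<lfloor>- log 2 (norm (f x))\<rfloor>" for x
  have le: "norm (f x) \<le> 1" if "x \<in> X" for x
  proof -
    have "norm (f x) powr p \<le> 1"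
      using member_le_sum[of x X "\<lambda>x. norm (f x) powr p"] that X le1 by auto
    moreover have "1 powr p < norm (f x) powr p" if "1 < norm (f x)"
      using p that by (intro powr_less_mono2) auto
    ultimately show ?thesis by force
  qed
  have level: "2 powr (- real (level x) - 1) < norm (f x)" "norm (f x) \<le> 2 powr (- real (level x))" if "x \<in> X0" for x
  proof -
    have fx: "0 < norm (f x)" "norm (f x) \<le> 1" using that le by (auto simp: X0_def)
    then have "0 \<le> - log 2 (norm (f x))" by simp
    then have "real (level x) = of_int \<lfloor>- log 2 (norm (f x))\<rfloor>" by (simp add: level_def)
    then have "real (level x) \<le> - log 2 (norm (f x))" "- log 2 (norm (f x)) < real (level x) + 1"
      by linarith+
    then have "log 2 (norm (f x)) \<le> - real (level x)" "- real (level x) - 1 < log 2 (norm (f x))"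
      by linarith+
    then show "2 powr (- real (level x) - 1) < norm (f x)" "norm (f x) \<le> 2 powr (- real (level x))"
      using fx by (simp_all add: log_le_iff less_log_iff)
  qed
  define r where "r = 2 powr (5 * p / 6 - 1)"
  have r: "0 < r" "r < 1" using p powr_less_mono[of "5 * p / 6 - 1" 0 2] by (auto simp: r_def)
  define L where "L j = {x \<in> X0. level x = j}" for j
  have card: "real (card (L j)) \<le> 2 powr ((real j + 1) * p)" for j
  proof -
    have "real (card (L j)) * 2 powr (- (real j + 1) * p) = (\<Sum>x\<in>L j. (2 powr (- real j - 1)) powr p)"
    proof -
      have "(- real j - 1) * p = - (real j + 1) * p" by (simp add: algebra_simps)
      then show ?thesis by (simp only: powr_powr sum_constant)
    qed
    also have "\<dots> \<le> (\<Sum>x\<in>L j. norm (f x) powr p)"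
      using level(1) p by (intro sum_mono powr_mono2) (auto simp: L_def intro: less_imp_le)
    also have "\<dots> \<le> (\<Sum>x\<in>X. norm (f x) powr p)"
      using X by (intro sum_mono2) (auto simp: L_def X0_def)
    also have "\<dots> \<le> 1" by (rule le1)
    finally have "real (card (L j)) * 2 powr (- (real j + 1) * p) * 2 powr ((real j + 1) * p) \<le> 1 * 2 powr ((real j + 1) * p)"
      by (intro mult_right_mono) auto
    moreover have "- (real j + 1) * p + (real j + 1) * p = 0" by (simp add: algebra_simps)
    ultimately show ?thesis by (simp only: mult.assoc powr_add[symmetric]) simp
  qed
  have piece: "norm (\<Sum>x\<in>L j. f x * b x) \<le> K * 2 powr (5 * p / 6) * r ^ j" for j
  proof -
    have "norm (\<Sum>x\<in>L j. f x * b x) \<le> K * 2 powr (- real j) * real (card (L j)) powr (5/6)"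
      using level(2) by (intro bound) (auto simp: L_def X0_def)
    also have "\<dots> \<le> K * 2 powr (- real j) * (2 powr ((real j + 1) * p)) powr (5/6)"
      using K card by (intro mult_left_mono powr_mono2) auto
    also have "2 powr (- real j) * (2 powr ((real j + 1) * p)) powr (5/6) = 2 powr (5 * p / 6) * r ^ j"
      using r by (simp add: powr_powr r_def powr_add[symmetric] powr_realpow[symmetric] field_simps)
    then have "K * 2 powr (- real j) * (2 powr ((real j + 1) * p)) powr (5/6) = K * 2 powr (5 * p / 6) * r ^ j"
      by (simp only: mult.assoc)
    finally show ?thesis .
  qed
  have "(\<Sum>x\<in>X. f x * b x) = (\<Sum>x\<in>X0. f x * b x)"
    using X by (intro sum.mono_neutral_right) (auto simp: X0_def)
  also have "\<dots> = (\<Sum>j\<in>level ` X0. \<Sum>x\<in>L j. f x * b x)"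
    unfolding L_def using X0 by (intro sum.group[symmetric]) auto
  finally have "norm (\<Sum>x\<in>X. f x * b x) \<le> (\<Sum>j\<in>level ` X0. norm (\<Sum>x\<in>L j. f x * b x))"
    using norm_sum by simp
  also have "\<dots> \<le> (\<Sum>j\<in>level ` X0. K * 2 powr (5 * p / 6) * r ^ j)"
    by (intro sum_mono piece)
  also have "\<dots> \<le> (\<Sum>j. K * 2 powr (5 * p / 6) * r ^ j)"
    using X0 r K by (intro sum_le_suminf summable_mult summable_geometric) auto
  also have "\<dots> = K * (2 powr (5 * p / 6) / (1 - r))"
    using r by (simp add: suminf_mult suminf_geometric summable_geometric)
  finally show ?thesis by (simp add: r_def)
qed

text \<open>Restricted type at p = 6/5, for functions merely bounded on X and Y instead of
  indicators, so that it applies to level sets directly. The form is bilinear: neither argument is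
  conjugated.\<close>

definition restricted_bound :: "real \<Rightarrow> ('a \<Rightarrow> 'a \<Rightarrow> complex) \<Rightarrow> bool" where
  "restricted_bound K B \<longleftrightarrow> (\<forall>X Y f h M N. finite X \<longrightarrow> finite Y \<longrightarrow> 0 \<le> M \<longrightarrow> 0 \<le> N \<longrightarrow>
     (\<forall>x\<in>X. norm (f x) \<le> M) \<longrightarrow> (\<forall>y\<in>Y. norm (h y) \<le> N) \<longrightarrow>
     norm (\<Sum>x\<in>X. \<Sum>y\<in>Y. f x * h y * B x y) \<le> K * M * N * (real (card X) * real (card Y)) powr (5/6))"

text \<open>The sum of the geometric series over the dyadic levels of one variable.\<close>

definition interpolation_const :: "real \<Rightarrow> real" where
  "interpolation_const p = 2 powr (5 * p / 6) / (1 - 2 powr (5 * p / 6 - 1))"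

lemma interpolation_const_pos: "p < 6 / 5 \<Longrightarrow> 0 < interpolation_const p"
  using powr_less_mono[of "5 * p / 6 - 1" 0 2] by (simp add: interpolation_const_def)

text \<open>The level set summation is used twice: for fixed X' in the variable y, with the sum over
  X' as weight, and then in x. This squares the constant.\<close>

lemma restricted_bound_imp_strong_bound:
  assumes R: "restricted_bound K B" and p: "0 < p" "p < 6 / 5" and K: "0 \<le> K"
    and fin: "finite X" "finite Y" and s: "0 < s"
    and f: "(\<Sum>x\<in>X. norm (f x) powr p) \<le> s powr p" and h: "(\<Sum>y\<in>Y. norm (h y) powr p) \<le> 1"
  shows "norm (\<Sum>x\<in>X. \<Sum>y\<in>Y. f x * h y * B x y) \<le> K * (interpolation_const p)\<^sup>2 * s"
proof -
  define A where "A = interpolation_const p"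
  have A: "0 < A" using p interpolation_const_pos by (simp add: A_def)
  define g where "g x = f x / of_real s" for x
  have g: "(\<Sum>x\<in>X. norm (g x) powr p) \<le> 1"
  proof -
    have "(\<Sum>x\<in>X. norm (g x) powr p) = (\<Sum>x\<in>X. norm (f x) powr p) / s powr p"
      using s by (simp add: g_def norm_divide powr_divide sum_divide_distrib)
    then show ?thesis using f s by simp
  qed
  have "norm (\<Sum>x\<in>X. g x * (\<Sum>y\<in>Y. h y * B x y)) \<le> (K * A) * A"
    unfolding A_def interpolation_const_def
  proof (rule sum_level_sets_le[OF p _ fin(1) _ g], fold interpolation_const_def A_def)
    fix X' M assume X': "X' \<subseteq> X" "0 \<le> M" "\<And>x. x \<in> X' \<Longrightarrow> norm (g x) \<le> M"
    then have finX': "finite X'" using fin(1) finite_subset by blast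
    have "norm (\<Sum>y\<in>Y. h y * (\<Sum>x\<in>X'. g x * B x y)) \<le> (K * M * real (card X') powr (5/6)) * A"
      unfolding A_def interpolation_const_def
    proof (rule sum_level_sets_le[OF p _ fin(2) _ h])
      fix Y' N assume Y': "Y' \<subseteq> Y" "0 \<le> N" "\<And>y. y \<in> Y' \<Longrightarrow> norm (h y) \<le> N"
      then have finY': "finite Y'" using fin(2) finite_subset by blast
      have "(\<Sum>y\<in>Y'. h y * (\<Sum>x\<in>X'. g x * B x y)) = (\<Sum>x\<in>X'. \<Sum>y\<in>Y'. g x * h y * B x y)"
        unfolding sum_distrib_left by (subst sum.swap) (simp add: mult_ac)
      also have "norm \<dots> \<le> K * M * N * (real (card X') * real (card Y')) powr (5/6)"
        using R[unfolded restricted_bound_def, rule_format, OF finX' finY' X'(2) Y'(2), of g h] X'(3) Y'(3) by simp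
      finally show "norm (\<Sum>y\<in>Y'. h y * (\<Sum>x\<in>X'. g x * B x y)) \<le>
          K * M * real (card X') powr (5/6) * N * real (card Y') powr (5/6)"
        by (simp add: powr_mult mult_ac)
    qed (use K X' in auto)
    also have "(\<Sum>y\<in>Y. h y * (\<Sum>x\<in>X'. g x * B x y)) = (\<Sum>x\<in>X'. g x * (\<Sum>y\<in>Y. h y * B x y))"
      unfolding sum_distrib_left by (subst sum.swap) (simp add: mult_ac)
    finally show "norm (\<Sum>x\<in>X'. g x * (\<Sum>y\<in>Y. h y * B x y)) \<le> K * A * M * real (card X') powr (5/6)"
      by (simp add: mult_ac)
  qed (use K A in auto)
  also have "(\<Sum>x\<in>X. g x * (\<Sum>y\<in>Y. h y * B x y)) = (\<Sum>x\<in>X. \<Sum>y\<in>Y. f x * h y * B x y) / of_real s"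
    by (simp add: g_def sum_distrib_left sum_divide_distrib mult_ac)
  finally have "norm (\<Sum>x\<in>X. \<Sum>y\<in>Y. f x * h y * B x y) / s \<le> K * A * A"
    using s by (simp add: norm_divide)
  then have "norm (\<Sum>x\<in>X. \<Sum>y\<in>Y. f x * h y * B x y) \<le> K * A * A * s"
    using s by (subst (asm) pos_divide_le_eq) auto
  then show ?thesis by (simp only: A_def power2_eq_square mult.assoc)
qed

lemma Cauchy_Schwarz_integral:
  fixes u v :: "'a \<Rightarrow> complex"
  assumes [measurable]: "u \<in> borel_measurable M" "v \<in> borel_measurable M"
    and u: "integrable M (\<lambda>x. (norm (u x))\<^sup>2)" and v: "integrable M (\<lambda>x. (norm (v x))\<^sup>2)"
  shows integrable_mult_L2: "integrable M (\<lambda>x. u x * v x)"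
    and integral_norm_mult_le: "(\<integral>x. norm (u x * v x) \<partial>M) \<le> sqrt (\<integral>x. (norm (u x))\<^sup>2 \<partial>M) * sqrt (\<integral>x. (norm (v x))\<^sup>2 \<partial>M)"
proof -
  have "integrable M (\<lambda>x. (norm (u x))\<^sup>2 + (norm (v x))\<^sup>2)" using u v by simp
  then show i: "integrable M (\<lambda>x. u x * v x)"
  proof (rule Bochner_Integration.integrable_bound)
    have "norm (u x * v x) \<le> norm ((norm (u x))\<^sup>2 + (norm (v x))\<^sup>2)" for x
      using sum_squares_bound[of "norm (u x)" "norm (v x)"] mult_nonneg_nonneg[of "norm (u x)" "norm (v x)"]
      by (simp add: norm_mult del: mult_nonneg_nonneg)
    then show "AE x in M. norm (u x * v x) \<le> norm ((norm (u x))\<^sup>2 + (norm (v x))\<^sup>2)" by simp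
  qed measurable
  have sq: "(\<integral>\<^sup>+ x. ennreal (norm (w x)) ^ 2 \<partial>M) = ennreal (\<integral>x. (norm (w x))\<^sup>2 \<partial>M)"
    if "integrable M (\<lambda>x. (norm (w x))\<^sup>2)" for w :: "'a \<Rightarrow> complex"
    using that by (simp add: ennreal_power nn_integral_eq_integral)
  have "(\<integral>\<^sup>+ x. ennreal (norm (u x)) * ennreal (norm (v x)) \<partial>M) = ennreal (\<integral>x. norm (u x * v x) \<partial>M)"
    using nn_integral_eq_integral[OF integrable_norm[OF i]] by (simp add: ennreal_mult norm_mult)
  with Cauchy_Schwarz_nn_integral[of "\<lambda>x. ennreal (norm (u x))" M "\<lambda>x. ennreal (norm (v x))"]
  have "ennreal ((\<integral>x. norm (u x * v x) \<partial>M)\<^sup>2) \<le> ennreal ((\<integral>x. (norm (u x))\<^sup>2 \<partial>M) * (\<integral>x. (norm (v x))\<^sup>2 \<partial>M))"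
    unfolding sq[OF u] sq[OF v] by (simp add: ennreal_power flip: ennreal_mult')
  then have "(\<integral>x. norm (u x * v x) \<partial>M)\<^sup>2 \<le> (\<integral>x. (norm (u x))\<^sup>2 \<partial>M) * (\<integral>x. (norm (v x))\<^sup>2 \<partial>M)"
    by (subst (asm) ennreal_le_iff) auto
  then have "sqrt ((\<integral>x. norm (u x * v x) \<partial>M)\<^sup>2) \<le> sqrt ((\<integral>x. (norm (u x))\<^sup>2 \<partial>M) * (\<integral>x. (norm (v x))\<^sup>2 \<partial>M))"
    by (rule real_sqrt_le_mono)
  then show "(\<integral>x. norm (u x * v x) \<partial>M) \<le> sqrt (\<integral>x. (norm (u x))\<^sup>2 \<partial>M) * sqrt (\<integral>x. (norm (v x))\<^sup>2 \<partial>M)"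
    by (simp add: real_sqrt_mult)
qed

section \<open>Trigonometric polynomials and the forms of Fourier multipliers\<close>

lemma measurable_cnj [measurable]: "cnj \<in> borel_measurable borel"
  by (intro borel_measurable_continuous_onI continuous_intros)

text \<open>With the conjugated character this is the partial Fourier sum that occurs in
  \<open>is_fourier\<close>.\<close>

definition trig_poly :: "'d::finite lattice set \<Rightarrow> ('d lattice \<Rightarrow> complex) \<Rightarrow> real ^ 'd \<Rightarrow> complex" where
  "trig_poly X f \<xi> = (\<Sum>x\<in>X. f x * cnj (plane_wave \<xi> x))"

lemma measurable_trig_poly [measurable]: "trig_poly X f \<in> borel_measurable borel"
  unfolding trig_poly_def[abs_def] by measurable

lemma norm_trig_poly_le: "norm (trig_poly X f \<xi>) \<le> (\<Sum>x\<in>X. norm (f x))"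
  unfolding trig_poly_def by (rule order_trans[OF norm_sum]) (simp add: norm_mult)

lemma integral_plane_wave_cnj:
  fixes x y :: "'d::finite lattice"
  shows "(\<integral>\<xi>. cnj (plane_wave \<xi> x) * plane_wave \<xi> y \<partial>torus) = (if x = y then (2 * pi) ^ CARD('d) else 0)"
  using integral_plane_wave[of "y - x"]
  by (simp add: plane_wave_minus[symmetric] plane_wave_add[symmetric])

lemma integrable_torus_borel:
  fixes f :: "real ^ 'd::finite \<Rightarrow> 'b::{banach, second_countable_topology}"
  assumes "f \<in> borel_measurable borel" "\<And>w. norm (f w) \<le> B"
  shows "integrable torus f"
  using integrable_torus[OF borel_measurable_torus[OF assms(1)] assms(2)] .

lemma integral_trig_poly_sq:
  fixes f :: "'d::finite lattice \<Rightarrow> complex"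
  shows "L2_sq (trig_poly X f) = (2 * pi) ^ CARD('d) * (\<Sum>x\<in>X. (norm (f x))\<^sup>2)"
proof (cases "finite X")
  case True
  have int: "integrable torus (\<lambda>\<xi>. f x * cnj (f y) * (cnj (plane_wave \<xi> x) * plane_wave \<xi> y))" for x y
    by (rule integrable_torus_borel[where B = "norm (f x) * norm (f y)"]) (auto simp: norm_mult)
  have "complex_of_real (L2_sq (trig_poly X f)) = (\<integral>\<xi>. trig_poly X f \<xi> * cnj (trig_poly X f \<xi>) \<partial>torus)"
    by (simp only: complex_norm_square[symmetric] integral_complex_of_real)
  also have "\<dots> = (\<integral>\<xi>. (\<Sum>x\<in>X. \<Sum>y\<in>X. f x * cnj (f y) * (cnj (plane_wave \<xi> x) * plane_wave \<xi> y)) \<partial>torus)"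
    by (simp add: trig_poly_def sum_product mult_ac)
  also have "\<dots> = (\<Sum>x\<in>X. \<Sum>y\<in>X. f x * cnj (f y) * (\<integral>\<xi>. cnj (plane_wave \<xi> x) * plane_wave \<xi> y \<partial>torus))"
    using int by (simp add: Bochner_Integration.integral_sum Bochner_Integration.integrable_sum)
  also have "\<dots> = (\<Sum>x\<in>X. f x * cnj (f x) * of_real ((2 * pi) ^ CARD('d)))"
  proof (intro sum.cong refl)
    fix x assume "x \<in> X"
    have "(\<Sum>y\<in>X. f x * cnj (f y) * (\<integral>\<xi>. cnj (plane_wave \<xi> x) * plane_wave \<xi> y \<partial>torus))
        = (\<Sum>y\<in>X. if x = y then f x * cnj (f x) * of_real ((2 * pi) ^ CARD('d)) else 0)"
      unfolding integral_plane_wave_cnj by (intro sum.cong) auto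
    then show "(\<Sum>y\<in>X. f x * cnj (f y) * (\<integral>\<xi>. cnj (plane_wave \<xi> x) * plane_wave \<xi> y \<partial>torus))
        = f x * cnj (f x) * of_real ((2 * pi) ^ CARD('d))"
      using True \<open>x \<in> X\<close> by simp
  qed
  also have "\<dots> = of_real ((2 * pi) ^ CARD('d) * (\<Sum>x\<in>X. (norm (f x))\<^sup>2))"
    by (simp only: complex_norm_square[symmetric] of_real_mult[symmetric] of_real_sum[symmetric])
       (simp add: sum_distrib_left sum_distrib_right mult.commute)
  finally show ?thesis by (simp only: of_real_eq_iff)
\<comment> \<open>For infinite X both sums are 0 by convention.\<close>
qed (simp add: trig_poly_def)

text \<open>Matrix entries of the Fourier multiplier with symbol m, up to the factor (2
  pi)^d.\<close>

definition torus_form :: "(real ^ 'd::finite \<Rightarrow> complex) \<Rightarrow> 'd lattice \<Rightarrow> 'd lattice \<Rightarrow> complex" where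
  "torus_form m x y = (\<integral>\<xi>. m \<xi> * (cnj (plane_wave \<xi> x) * plane_wave \<xi> y) \<partial>torus)"

lemma sum_torus_form:
  fixes m :: "real ^ 'd::finite \<Rightarrow> complex"
  assumes m: "integrable torus m"
  shows "(\<Sum>x\<in>X. \<Sum>y\<in>Y. f x * h y * torus_form m x y)
    = (\<integral>\<xi>. m \<xi> * (trig_poly X f \<xi> * cnj (trig_poly Y (\<lambda>y. cnj (h y)) \<xi>)) \<partial>torus)"
proof -
  have int: "integrable torus (\<lambda>\<xi>. f x * h y * (m \<xi> * (cnj (plane_wave \<xi> x) * plane_wave \<xi> y)))" for x y
  proof -
    have [measurable]: "m \<in> borel_measurable torus" using m by simp
    have [measurable]: "(\<lambda>\<xi>. plane_wave \<xi> z) \<in> borel_measurable torus" for z :: "'d lattice"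
      by (rule borel_measurable_torus) measurable
    have "integrable torus (\<lambda>\<xi>. m \<xi> * (cnj (plane_wave \<xi> x) * plane_wave \<xi> y))"
      by (rule Bochner_Integration.integrable_bound[OF m]) (auto simp: norm_mult)
    then show ?thesis by simp
  qed
  have "m \<xi> * (trig_poly X f \<xi> * cnj (trig_poly Y (\<lambda>y. cnj (h y)) \<xi>))
     = (\<Sum>x\<in>X. \<Sum>y\<in>Y. f x * h y * (m \<xi> * (cnj (plane_wave \<xi> x) * plane_wave \<xi> y)))" for \<xi>
    by (simp add: trig_poly_def sum_product sum_distrib_left mult_ac)
  then have "(\<integral>\<xi>. m \<xi> * (trig_poly X f \<xi> * cnj (trig_poly Y (\<lambda>y. cnj (h y)) \<xi>)) \<partial>torus)
    = (\<integral>\<xi>. (\<Sum>x\<in>X. \<Sum>y\<in>Y. f x * h y * (m \<xi> * (cnj (plane_wave \<xi> x) * plane_wave \<xi> y))) \<partial>torus)"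
    by simp
  also have "\<dots> = (\<Sum>x\<in>X. \<Sum>y\<in>Y. (\<integral>\<xi>. f x * h y * (m \<xi> * (cnj (plane_wave \<xi> x) * plane_wave \<xi> y)) \<partial>torus))"
    using int by (simp only: Bochner_Integration.integral_sum Bochner_Integration.integrable_sum)
  finally show ?thesis by (simp add: torus_form_def)
qed

text \<open>Cauchy-Schwarz and Parseval; a function bounded by M on X has l^2 norm at most M times
  the root of the cardinality. This is the source of the power 1/2.\<close>

lemma norm_integral_trig_poly_le:
  fixes m :: "real ^ 'd::finite \<Rightarrow> complex"
  assumes [measurable]: "m \<in> borel_measurable torus" and D: "\<And>\<xi>. norm (m \<xi>) \<le> D"
    and f: "finite X" "\<And>x. x \<in> X \<Longrightarrow> norm (f x) \<le> M" and h: "finite Y" "\<And>y. y \<in> Y \<Longrightarrow> norm (h y) \<le> N"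
    and MN: "0 \<le> M" "0 \<le> N"
  shows "norm (\<integral>\<xi>. m \<xi> * (trig_poly X f \<xi> * cnj (trig_poly Y h \<xi>)) \<partial>torus)
    \<le> D * (2 * pi) ^ CARD('d) * M * N * (real (card X) * real (card Y)) powr (1/2)"
proof -
  have D0: "0 \<le> D" using D[of 0] norm_ge_zero order_trans by blast
  have [measurable]: "trig_poly X f \<in> borel_measurable torus" for X and f :: "'d lattice \<Rightarrow> complex"
    by (rule borel_measurable_torus) measurable
  have sq: "integrable torus (\<lambda>\<xi>. (norm (trig_poly X f \<xi>))\<^sup>2)" for X and f :: "'d lattice \<Rightarrow> complex"
    by (rule integrable_torus_borel[where B = "(\<Sum>x\<in>X. norm (f x))\<^sup>2"])
       (auto intro!: power_mono norm_trig_poly_le)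
  have sqb: "sqrt (L2_sq (trig_poly X f)) \<le> sqrt ((2 * pi) ^ CARD('d)) * (M * sqrt (real (card X)))"
    if "\<And>x. x \<in> X \<Longrightarrow> norm (f x) \<le> M" "0 \<le> M" for X M and f :: "'d lattice \<Rightarrow> complex"
  proof -
    have "(\<Sum>x\<in>X. (norm (f x))\<^sup>2) \<le> (\<Sum>x\<in>X. M\<^sup>2)"
      using that by (intro sum_mono power_mono) auto
    then have "sqrt (\<Sum>x\<in>X. (norm (f x))\<^sup>2) \<le> sqrt (M\<^sup>2 * real (card X))"
      by (simp add: mult.commute)
    also have "\<dots> = M * sqrt (real (card X))" using that by (simp add: real_sqrt_mult)
    finally show ?thesis
      by (simp add: integral_trig_poly_sq real_sqrt_mult mult_left_mono)
  qed
  have i: "integrable torus (\<lambda>\<xi>. trig_poly X f \<xi> * cnj (trig_poly Y h \<xi>))"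
    by (rule integrable_mult_L2) (auto simp: sq)
  have "norm (\<integral>\<xi>. m \<xi> * (trig_poly X f \<xi> * cnj (trig_poly Y h \<xi>)) \<partial>torus)
      \<le> (\<integral>\<xi>. norm (m \<xi> * (trig_poly X f \<xi> * cnj (trig_poly Y h \<xi>))) \<partial>torus)"
    by (rule integral_norm_bound)
  also have "\<dots> \<le> (\<integral>\<xi>. D * norm (trig_poly X f \<xi> * cnj (trig_poly Y h \<xi>)) \<partial>torus)"
  proof (rule integral_mono)
    have le: "norm (m \<xi> * (trig_poly X f \<xi> * cnj (trig_poly Y h \<xi>))) \<le> D * norm (trig_poly X f \<xi> * cnj (trig_poly Y h \<xi>))" for \<xi>
      unfolding norm_mult[of "m \<xi>"] by (rule mult_right_mono[OF D norm_ge_zero])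
    show "integrable torus (\<lambda>\<xi>. norm (m \<xi> * (trig_poly X f \<xi> * cnj (trig_poly Y h \<xi>))))"
    proof (rule Bochner_Integration.integrable_bound)
      show "integrable torus (\<lambda>\<xi>. D * norm (trig_poly X f \<xi> * cnj (trig_poly Y h \<xi>)))"
        using i by (intro integrable_mult_right integrable_norm)
      show "AE \<xi> in torus. norm (norm (m \<xi> * (trig_poly X f \<xi> * cnj (trig_poly Y h \<xi>)))) \<le> norm (D * norm (trig_poly X f \<xi> * cnj (trig_poly Y h \<xi>)))"
        using order_trans[OF le abs_ge_self] by (intro AE_I2) (simp only: abs_norm_cancel real_norm_def)
    qed measurable
    show "norm (m \<xi> * (trig_poly X f \<xi> * cnj (trig_poly Y h \<xi>))) \<le> D * norm (trig_poly X f \<xi> * cnj (trig_poly Y h \<xi>))" for \<xi>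
      by (rule le)
  qed (use i in simp)
  also have "\<dots> = D * (\<integral>\<xi>. norm (trig_poly X f \<xi> * cnj (trig_poly Y h \<xi>)) \<partial>torus)" by simp
  also have "\<dots> \<le> D * (sqrt (L2_sq (trig_poly X f)) * sqrt (L2_sq (\<lambda>\<xi>. cnj (trig_poly Y h \<xi>))))"
    using D0 by (intro mult_left_mono integral_norm_mult_le) (auto simp: sq)
  also have "\<dots> \<le> D * ((sqrt ((2 * pi) ^ CARD('d)) * (M * sqrt (real (card X)))) * (sqrt ((2 * pi) ^ CARD('d)) * (N * sqrt (real (card Y)))))"
    using D0 sqb[of X f M] sqb[of Y h N] f h MN by (intro mult_left_mono mult_mono) auto
  also have "\<dots> = D * (sqrt ((2 * pi) ^ CARD('d)) * sqrt ((2 * pi) ^ CARD('d))) * M * N * sqrt (real (card X) * real (card Y))"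
    by (simp only: real_sqrt_mult mult_ac)
  also have "sqrt ((2 * pi) ^ CARD('d)) * sqrt ((2 * pi) ^ CARD('d)) = (2 * pi) ^ CARD('d)"
    by (simp add: real_sqrt_mult_self)
  also have "sqrt (real (card X) * real (card Y)) = (real (card X) * real (card Y)) powr (1/2)"
    by (simp add: powr_half_sqrt)
  finally show ?thesis .
qed


section \<open>The approximate resolvent as a truncated time integral\<close>

definition time_measure :: "real \<Rightarrow> real measure" where
  "time_measure T = restrict_space lborel {0..T}"

interpretation time: finite_measure "time_measure T"
  unfolding time_measure_def by standard (cases "0 \<le> T", simp_all add: emeasure_restrict_space space_restrict_space)

text \<open>Up to the factor i s, a substitute for 1/w by a truncated Laplace integral; it stays
  finite at w = 0.\<close>

definition time_evolution :: "real \<Rightarrow> complex \<Rightarrow> real \<Rightarrow> complex" where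
  "time_evolution s w T = (\<integral>t. exp (- \<i> * of_real s * of_real t * w) \<partial>time_measure T)"

text \<open>Written without division by w, so that the zeros of \<open>omega\<close> squared minus z
  squared cause no exception for real z in the spectrum.\<close>

lemma time_evolution_eq:
  assumes "0 \<le> T"
  shows "\<i> * of_real s * w * time_evolution s w T = 1 - exp (- \<i> * of_real s * of_real T * w)"
proof -
  define g where "g t = exp (- \<i> * of_real s * of_real t * w)" for t :: real
  have c: "continuous_on A g" for A unfolding g_def by (intro continuous_intros)
  have "time_evolution s w T = (LBINT t:{0..T}. g t)"
    by (simp add: time_evolution_def time_measure_def integral_restrict_space set_lebesgue_integral_def g_def)
  also have "\<dots> = integral {0..T} g"
    by (intro set_borel_integral_eq_integral(2) borel_integrable_atLeastAtMost' c)
  finally have te: "time_evolution s w T = integral {0..T} g" .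
  have "((\<lambda>t. - \<i> * of_real s * w * g t) has_integral (g T - g 0)) {0..T}"
  proof (rule fundamental_theorem_of_calculus[OF assms])
    fix t assume "t \<in> {0..T}"
    have "((\<lambda>u. exp (- \<i> * of_real s * u * w)) has_field_derivative - \<i> * of_real s * w * exp (- \<i> * of_real s * of_real t * w)) (at (of_real t))"
      by (auto intro!: derivative_eq_intros)
    then show "(g has_vector_derivative - \<i> * of_real s * w * g t) (at t within {0..T})"
      unfolding g_def by (rule has_vector_derivative_real_field)
  qed
  moreover have "((\<lambda>t. - \<i> * of_real s * w * g t) has_integral (- \<i> * of_real s * w * integral {0..T} g)) {0..T}"
    by (intro has_integral_mult_right integrable_integral integrable_continuous_interval c)
  ultimately have "- \<i> * of_real s * w * integral {0..T} g = g T - g 0"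
    by (rule has_integral_unique[symmetric])
  then show ?thesis by (simp add: te g_def algebra_simps)
qed

lemma borel_measurable_time_torus:
  fixes f :: "real \<times> (real ^ 'd::finite) \<Rightarrow> 'b::topological_space"
  assumes "f \<in> borel_measurable (borel \<Otimes>\<^sub>M borel)"
  shows "f \<in> borel_measurable (time_measure T \<Otimes>\<^sub>M torus)"
proof -
  have "(\<lambda>p. (fst p, snd p)) \<in> measurable (time_measure T \<Otimes>\<^sub>M torus) (borel \<Otimes>\<^sub>M borel :: (real \<times> (real ^ 'd)) measure)"
    by (intro measurable_Pair measurable_compose[OF measurable_snd borel_measurable_torus]
        measurable_compose[OF measurable_fst]) (auto simp: time_measure_def intro!: measurable_restrict_space1)
  from measurable_compose[OF this assms] show ?thesis by simp
qed

text \<open>The sign $s = \pm 1$ is chosen with $s \, \mathrm{Im}\, z^2 \ge 0$, so that $e^{i s t z^2}$ stays bounded for $t \ge 0$.\<close>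

definition resolvent_symbol :: "real \<Rightarrow> complex \<Rightarrow> real \<Rightarrow> real ^ 'd::finite \<Rightarrow> complex" where
  "resolvent_symbol s z T \<xi> = (of_real (omega \<xi>) + z) * time_evolution s (of_real ((omega \<xi>)\<^sup>2) - z\<^sup>2) T"

text \<open>The numerator \<open>omega\<close> + z completes \<open>omega\<close> - z to the
  difference of squares. What is left is the boundary term at time T, a bounded factor times the
  propagator.\<close>

lemma resolvent_symbol_eq:
  assumes "0 \<le> T"
  shows "\<i> * of_real s * (of_real (omega \<xi>) - z) * resolvent_symbol s z T \<xi>
    = 1 - exp (\<i> * of_real s * of_real T * z\<^sup>2) * propagator (s * T) \<xi>"
proof -
  have "\<i> * of_real s * (of_real (omega \<xi>) - z) * resolvent_symbol s z T \<xi>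
    = \<i> * of_real s * (of_real ((omega \<xi>)\<^sup>2) - z\<^sup>2) * time_evolution s (of_real ((omega \<xi>)\<^sup>2) - z\<^sup>2) T"
    by (simp add: resolvent_symbol_def algebra_simps power2_eq_square)
  also have "\<dots> = 1 - exp (- \<i> * of_real s * of_real T * (of_real ((omega \<xi>)\<^sup>2) - z\<^sup>2))"
    by (rule time_evolution_eq[OF assms])
  also have "exp (- \<i> * of_real s * of_real T * (of_real ((omega \<xi>)\<^sup>2) - z\<^sup>2))
     = exp (\<i> * of_real s * of_real T * z\<^sup>2) * propagator (s * T) \<xi>"
    by (simp add: propagator_def cis_conv_exp exp_add[symmetric] algebra_simps)
  finally show ?thesis .
qed

lemma norm_exp_time_le:
  assumes "0 \<le> t" "0 \<le> s * Im (z\<^sup>2)"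
  shows "norm (exp (\<i> * of_real s * of_real t * z\<^sup>2)) \<le> 1"
proof -
  have "Re (\<i> * of_real s * of_real t * z\<^sup>2) = - (t * (s * Im (z\<^sup>2)))"
    by (simp add: mult_ac)
  also have "\<dots> \<le> 0" using assms by simp
  finally show ?thesis by simp
qed

lemma resolvent_symbol_as_integral:
  "resolvent_symbol s z T \<xi> =
    (\<integral>t. exp (\<i> * of_real s * of_real t * z\<^sup>2) * (propagator (s * t) \<xi> * (of_real (omega \<xi>) + z)) \<partial>time_measure T)"
proof -
  have "exp (\<i> * of_real s * of_real t * z\<^sup>2) * (propagator (s * t) \<xi> * (of_real (omega \<xi>) + z))
     = (of_real (omega \<xi>) + z) * exp (- \<i> * of_real s * of_real t * (of_real ((omega \<xi>)\<^sup>2) - z\<^sup>2))" for t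
    by (simp add: propagator_def cis_conv_exp exp_add[symmetric] algebra_simps)
  then show ?thesis by (simp only: resolvent_symbol_def time_evolution_def integral_mult_right_zero)
qed

lemma norm_omega_plus_le: "norm (of_real (omega (\<xi> :: real ^ 'd::finite)) + (z::complex)) \<le> 1 + 4 * real CARD('d) + norm z"
proof -
  have "norm (of_real (omega \<xi>) + z) \<le> norm (complex_of_real (omega \<xi>)) + norm z" by (rule norm_triangle_ineq)
  then show ?thesis using omega_le[of \<xi>] omega_ge_1[of \<xi>] by simp
qed

lemma resolvent_symbol_joint_measurable:
  "(\<lambda>(t, \<xi>). exp (\<i> * of_real s * of_real t * z\<^sup>2) * (propagator (s * t) \<xi> * (of_real (omega \<xi>) + z)))
     \<in> borel_measurable (borel \<Otimes>\<^sub>M borel)"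
  unfolding propagator_def by measurable

text \<open>The linear growth in T is harmless: the bound serves integrability and approximation
  errors only, and never reaches the constant of the estimate.\<close>

lemma resolvent_symbol_bounded:
  assumes "0 \<le> T" "0 \<le> s * Im (z\<^sup>2)"
  shows "norm (resolvent_symbol s z T (\<xi> :: real ^ 'd::finite)) \<le> T * (1 + 4 * real CARD('d) + norm z)"
proof -
  define D where "D = 1 + 4 * real CARD('d) + norm z"
  define g where "g t = exp (\<i> * of_real s * of_real t * z\<^sup>2) * (propagator (s * t) \<xi> * (of_real (omega \<xi>) + z))" for t
  have [measurable]: "g \<in> borel_measurable borel"
    unfolding g_def propagator_def by measurable
  then have gm: "g \<in> borel_measurable (time_measure T)"
    unfolding time_measure_def by (intro measurable_restrict_space1) simp
  have sp: "space (time_measure T) = {0..T}" by (simp add: time_measure_def space_restrict_space)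
  have gb: "norm (g t) \<le> D" if "t \<in> {0..T}" for t
  proof -
    have "norm (g t) \<le> 1 * (1 * D)"
      unfolding g_def norm_mult D_def using that assms
      by (intro mult_mono norm_exp_time_le norm_omega_plus_le) auto
    then show ?thesis by simp
  qed
  have "norm (resolvent_symbol s z T \<xi>) \<le> (\<integral>t. norm (g t) \<partial>time_measure T)"
    unfolding resolvent_symbol_as_integral g_def by (rule integral_norm_bound)
  also have "\<dots> \<le> (\<integral>t. D \<partial>time_measure T)"
  proof (rule integral_mono)
    have "integrable (time_measure T) g"
      using gb gm by (intro time.integrable_const_bound[where B = D] AE_I2) (auto simp: sp)
    then show "integrable (time_measure T) (\<lambda>t. norm (g t))" by (rule integrable_norm)
  qed (use gb in \<open>auto simp: sp\<close>)
  also have "\<dots> = T * D"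
    using assms by (simp add: sp measure_restrict_space time_measure_def)
  finally show ?thesis by (simp add: D_def)
qed

lemma resolvent_symbol_measurable: "resolvent_symbol s z T \<in> borel_measurable torus"
proof -
  have "(\<lambda>(\<xi>, t). exp (\<i> * of_real s * of_real t * z\<^sup>2) * (propagator (s * t) \<xi> * (of_real (omega \<xi>) + z))) 
     \<in> borel_measurable (torus \<Otimes>\<^sub>M time_measure T)"
    using measurable_compose[OF measurable_pair_swap' borel_measurable_time_torus[OF resolvent_symbol_joint_measurable]]
    by (simp add: case_prod_beta')
  from time.borel_measurable_lebesgue_integral[OF this] show ?thesis
    by (simp add: resolvent_symbol_as_integral[abs_def])
qed

text \<open>Fubini on [0, T] times the torus exposes the propagator at each fixed time, where the
  energy and kernel bounds are available.\<close>

lemma integral_resolvent_symbol: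
  fixes F :: "real ^ 'd::finite \<Rightarrow> complex"
  assumes [measurable]: "F \<in> borel_measurable borel" and F: "\<And>\<xi>. norm (F \<xi>) \<le> B"
    and T: "0 \<le> T" and z: "0 \<le> s * Im (z\<^sup>2)"
  shows "(\<integral>\<xi>. resolvent_symbol s z T \<xi> * F \<xi> \<partial>torus) =
    (\<integral>t. exp (\<i> * of_real s * of_real t * z\<^sup>2) * (\<integral>\<xi>. propagator (s * t) \<xi> * (of_real (omega \<xi>) + z) * F \<xi> \<partial>torus) \<partial>time_measure T)"
proof -
  define G where "G t \<xi> = exp (\<i> * of_real s * of_real t * z\<^sup>2) * (propagator (s * t) \<xi> * (of_real (omega \<xi>) + z)) * F \<xi>" for t \<xi>
  define D where "D = 1 + 4 * real CARD('d) + norm z"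
  interpret P: finite_measure "time_measure T \<Otimes>\<^sub>M (torus :: (real ^ 'd) measure)"
    by (intro finite_measure_pair_measure) (unfold_locales)
  interpret pair_sigma_finite "time_measure T" "torus :: (real ^ 'd) measure"
    by unfold_locales
  have sp: "space (time_measure T) = {0..T}" by (simp add: time_measure_def space_restrict_space)
  have "(\<lambda>(t, \<xi>). G t \<xi>) \<in> borel_measurable (borel \<Otimes>\<^sub>M borel)"
    unfolding G_def propagator_def by measurable
  then have "integrable (time_measure T \<Otimes>\<^sub>M torus) (\<lambda>(t, \<xi>). G t \<xi>)"
  proof (intro P.integrable_const_bound[of _ "D * B"] borel_measurable_time_torus AE_I2)
    fix p :: "real \<times> (real ^ 'd)" assume "p \<in> space (time_measure T \<Otimes>\<^sub>M torus)"
    then have "0 \<le> fst p" by (auto simp: space_pair_measure sp)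
    then have "norm (G (fst p) (snd p)) \<le> 1 * (1 * D) * B"
      unfolding G_def norm_mult D_def using z
      by (intro mult_mono norm_exp_time_le norm_omega_plus_le F) auto
    then show "norm (case p of (t, \<xi>) \<Rightarrow> G t \<xi>) \<le> D * B" by (simp add: case_prod_beta)
  qed
  from Fubini_integral[OF this]
  have "(\<integral>\<xi>. (\<integral>t. G t \<xi> \<partial>time_measure T) \<partial>torus) = (\<integral>t. (\<integral>\<xi>. G t \<xi> \<partial>torus) \<partial>time_measure T)" .
  moreover have "(\<integral>t. G t \<xi> \<partial>time_measure T) = resolvent_symbol s z T \<xi> * F \<xi>" for \<xi>
    by (simp add: G_def resolvent_symbol_as_integral)
  moreover have "(\<integral>\<xi>. G t \<xi> \<partial>torus) = exp (\<i> * of_real s * of_real t * z\<^sup>2) * (\<integral>\<xi>. propagator (s * t) \<xi> * (of_real (omega \<xi>) + z) * F \<xi> \<partial>torus)" for t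
    by (simp add: G_def mult.assoc)
  ultimately show ?thesis by simp
qed


text \<open>It also covers functions that are not integrable, whose integral is 0 by convention, so
  no integrability has to be checked at the point of use.\<close>

lemma norm_integral_le_nn_integral:
  fixes f :: "'a \<Rightarrow> 'b::{banach, second_countable_topology}"
  shows "ennreal (norm (integral\<^sup>L M f)) \<le> (\<integral>\<^sup>+ x. ennreal (norm (f x)) \<partial>M)"
  by (cases "integrable M f") (auto simp: integral_norm_bound_ennreal not_integrable_integral_eq)

text \<open>Time is split at S: unitarity controls the early part, the time-integrated kernel the
  late part. The constant is free of T and sees z only through Z.\<close>

lemma restricted_bound_resolvent_symbol:
  fixes z :: complex
  assumes d: "3 \<le> CARD('d::finite)" and T: "0 \<le> T" and s: "s \<in> {1, -1}" and z: "0 \<le> s * Im (z\<^sup>2)" and Z: "norm z \<le> Z"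
  shows "restricted_bound ((1 + 4 * real CARD('d) + Z) * (2 * pi) ^ CARD('d) + (resolvent_const TYPE('d) + Z * dispersive_const TYPE('d)))
    (torus_form (resolvent_symbol s z T :: real ^ 'd \<Rightarrow> complex))"
  unfolding restricted_bound_def
proof (intro allI impI)
  fix X Y :: "'d lattice set" and f h :: "'d lattice \<Rightarrow> complex" and M N :: real
  assume fin: "finite X" "finite Y" and MN: "0 \<le> M" "0 \<le> N"
    and f: "\<forall>x\<in>X. norm (f x) \<le> M" and h: "\<forall>y\<in>Y. norm (h y) \<le> N"
  define D where "D = 1 + 4 * real CARD('d) + Z"
  define E where "E = resolvent_const TYPE('d) + Z * dispersive_const TYPE('d)"
  define n where "n = real (card X) * real (card Y)"
  have Z0: "0 \<le> Z" using Z norm_ge_zero order_trans by blast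
  have dc: "0 \<le> dispersive_const TYPE('d)" by (simp add: dispersive_const_def)
  have rc: "0 \<le> resolvent_const TYPE('d)"
    unfolding resolvent_const_def using hopping_bound[where 'd = 'd]
    by (intro mult_nonneg_nonneg suminf_nonneg summable_sqrt_coeff dc) auto
  show "norm (\<Sum>x\<in>X. \<Sum>y\<in>Y. f x * h y * torus_form (resolvent_symbol s z T) x y)
    \<le> (D * (2 * pi) ^ CARD('d) + E) * M * N * n powr (5/6)"
  proof (cases "n = 0")
    case True
    then show ?thesis using fin by (auto simp: n_def)
  next
    case False
    then have n: "0 < n" by (simp add: n_def)
    \<comment> \<open>balances $S n^{1/2}$ against $n S^{-1/2}$\<close>
    define S where "S = n powr (1/3)"
    have S: "0 < S" using n by (simp add: S_def)
    define F where "F \<xi> = trig_poly X f \<xi> * cnj (trig_poly Y (\<lambda>y. cnj (h y)) \<xi>)" for \<xi>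
    have [measurable]: "F \<in> borel_measurable borel" unfolding F_def by measurable
    have Fb: "norm (F \<xi>) \<le> (\<Sum>x\<in>X. norm (f x)) * (\<Sum>y\<in>Y. norm (h y))" for \<xi>
      unfolding F_def norm_mult
      using norm_trig_poly_le[of X f \<xi>] norm_trig_poly_le[of Y "\<lambda>y. cnj (h y)" \<xi>]
      by (intro mult_mono) (auto intro: sum_nonneg)
    define b where "b t = norm (\<integral>\<xi>. propagator (s * t) \<xi> * (of_real (omega \<xi>) + z) * F \<xi> \<partial>torus)" for t
    have [measurable]: "b \<in> borel_measurable borel" unfolding b_def propagator_def by measurable
    have om: "(\<lambda>\<xi>. propagator (s * t) \<xi> * (of_real (omega \<xi>) + z)) \<in> borel_measurable torus" for t
      unfolding propagator_def by (rule borel_measurable_torus) measurable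
    have nom: "norm (propagator (s * t) \<xi> * (of_real (omega \<xi>) + z)) \<le> D" for t and \<xi> :: "real ^ 'd"
      unfolding norm_mult using norm_omega_plus_le[of \<xi> z] Z by (simp add: D_def)
    \<comment> \<open>The propagator is unimodular, so each instant before S costs only the l^2
      bound.\<close>
    have b_early: "b t \<le> D * (2 * pi) ^ CARD('d) * M * N * n powr (1/2)" for t
      unfolding b_def F_def n_def using f h fin MN
      by (intro norm_integral_trig_poly_le om nom) auto
    define k where "k x t = norm (weighted_kernel (s * t) omega x)
       + Z * norm (propagator_kernel (s * t) x)" for x :: "'d lattice" and t
    have [measurable]: "k x \<in> borel_measurable borel" for x unfolding k_def propagator_def by measurable
    \<comment> \<open>From l^1 to l^infinity: the form is bounded by the sum of its kernel entries.
      Integrated over times beyond S, each of the n entries costs E S^(-1/2).\<close>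
    have b_late: "b t \<le> M * N * (\<Sum>x\<in>X. \<Sum>y\<in>Y. k (y - x) t)" for t
    proof -
      define m where "m \<xi> = propagator (s * t) \<xi> * (of_real (omega \<xi>) + z)" for \<xi> :: "real ^ 'd"
      have mi: "integrable torus m"
        unfolding m_def by (rule integrable_torus[OF om nom])
      have tk: "norm (torus_form m x y) \<le> k (y - x) t" for x y
      proof -
        have i1: "integrable torus (\<lambda>\<xi>. propagator (s * t) \<xi> * of_real (omega \<xi>) * plane_wave \<xi> (y - x))"
          by (rule integrable_torus_borel[where B = "1 + 4 * real CARD('d)"])
             (use omega_le in \<open>auto simp: norm_mult propagator_def abs_of_nonneg[OF order_trans[OF zero_le_one omega_ge_1]]\<close>)
        have i2: "integrable torus (\<lambda>\<xi>. propagator (s * t) \<xi> * plane_wave \<xi> (y - x))"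
          by (rule integrable_torus_borel[where B = 1]) (auto simp: norm_mult propagator_def)
        have "torus_form m x y = (\<integral>\<xi>. propagator (s * t) \<xi> * of_real (omega \<xi>) * plane_wave \<xi> (y - x)
            + z * (propagator (s * t) \<xi> * plane_wave \<xi> (y - x)) \<partial>torus)"
          unfolding torus_form_def m_def plane_wave_minus[symmetric] plane_wave_add[symmetric]
          by (simp add: algebra_simps)
        also have "\<dots> = weighted_kernel (s * t) omega (y - x)
            + z * propagator_kernel (s * t) (y - x)"
          using i1 i2 by simp
        also have "norm \<dots> \<le> k (y - x) t"
          unfolding k_def using Z by (intro norm_triangle_mono) (auto simp: norm_mult mult_right_mono)
        finally show ?thesis .
      qed
      have "b t = norm (\<Sum>x\<in>X. \<Sum>y\<in>Y. f x * h y * torus_form m x y)"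
        unfolding sum_torus_form[OF mi] b_def F_def m_def by simp
      also have "\<dots> \<le> (\<Sum>x\<in>X. \<Sum>y\<in>Y. norm (f x * h y * torus_form m x y))"
        by (intro sum_norm_le norm_sum)
      also have "\<dots> \<le> (\<Sum>x\<in>X. \<Sum>y\<in>Y. M * N * k (y - x) t)"
        unfolding norm_mult using f h MN by (intro sum_mono mult_mono tk) auto
      finally show ?thesis by (simp add: sum_distrib_left)
    qed
    have k_int: "(\<integral>\<^sup>+ t. ennreal (k x t) * indicator {S..} t \<partial>lborel) \<le> ennreal (E * S powr (-1/2))" for x
    proof -
      define u where "u t = ennreal (norm (weighted_kernel (s * t) omega x)) * indicator {S..} t" for t
      define v where "v t = ennreal (norm (propagator_kernel (s * t) x)) * indicator {S..} t" for t
      have [measurable]: "u \<in> borel_measurable borel" "v \<in> borel_measurable borel"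
        unfolding u_def v_def propagator_def by measurable
      have "ennreal (k x t) * indicator {S..} t = u t + ennreal Z * v t" for t
        using Z0 by (cases "S \<le> t") (auto simp: k_def u_def v_def ennreal_plus ennreal_mult)
      then have "(\<integral>\<^sup>+ t. ennreal (k x t) * indicator {S..} t \<partial>lborel) = (\<integral>\<^sup>+ t. u t \<partial>lborel) + ennreal Z * (\<integral>\<^sup>+ t. v t \<partial>lborel)"
        by (simp add: nn_integral_add nn_integral_cmult)
      also have "\<dots> \<le> ennreal (resolvent_const TYPE('d) * S powr (-1/2)) + ennreal Z * ennreal (dispersive_const TYPE('d) * S powr (-1/2))"
        unfolding u_def v_def using d S s
        by (intro add_mono mult_left_mono nn_integral_propagator_omega_le nn_integral_propagator_le) auto
      also have "\<dots> = ennreal (E * S powr (-1/2))"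
        using Z0 dc rc by (simp add: E_def algebra_simps ennreal_mult'[symmetric] flip: ennreal_plus)
      finally show ?thesis .
    qed
    have late: "(\<integral>\<^sup>+ t. ennreal (b t) * indicator {S..} t \<partial>lborel) \<le> ennreal (M * N * (n * (E * S powr (-1/2))))"
    proof -
      have E0: "0 \<le> E" using rc dc Z0 by (simp add: E_def)
      have k0: "0 \<le> k x t" for x t using Z0 by (simp add: k_def)
      define q where "q x t = ennreal (k x t) * indicator {S..} t" for x t
      have [measurable]: "q x \<in> borel_measurable borel" for x unfolding q_def by measurable
      have "ennreal (b t) * indicator {S..} t \<le> ennreal (M * N) * (\<Sum>x\<in>X. \<Sum>y\<in>Y. q (y - x) t)" for t
      proof (cases "S \<le> t")
        case True
        have "ennreal (b t) \<le> ennreal (M * N * (\<Sum>x\<in>X. \<Sum>y\<in>Y. k (y - x) t))" by (intro ennreal_leI b_late)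
        also have "\<dots> = ennreal (M * N) * (\<Sum>x\<in>X. \<Sum>y\<in>Y. ennreal (k (y - x) t))"
          using MN k0 by (simp add: ennreal_mult sum_nonneg flip: sum_ennreal)
        finally show ?thesis using True by (simp add: q_def)
      qed simp
      then have "(\<integral>\<^sup>+ t. ennreal (b t) * indicator {S..} t \<partial>lborel) \<le> (\<integral>\<^sup>+ t. ennreal (M * N) * (\<Sum>x\<in>X. \<Sum>y\<in>Y. q (y - x) t) \<partial>lborel)"
        by (rule nn_integral_mono)
      also have "\<dots> = ennreal (M * N) * (\<Sum>x\<in>X. \<Sum>y\<in>Y. \<integral>\<^sup>+ t. q (y - x) t \<partial>lborel)"
        by (simp add: nn_integral_cmult nn_integral_sum)
      also have "\<dots> \<le> ennreal (M * N) * (\<Sum>x\<in>X. \<Sum>y\<in>Y. ennreal (E * S powr (-1/2)))"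
        unfolding q_def by (intro mult_left_mono sum_mono k_int) auto
      also have "(\<Sum>x\<in>X. \<Sum>y\<in>Y. ennreal (E * S powr (-1/2))) = ennreal (n * (E * S powr (-1/2)))"
        using E0 by (subst sum_ennreal, simp)+ (simp add: n_def mult_ac)
      also have "ennreal (M * N) * \<dots> = ennreal (M * N * (n * (E * S powr (-1/2))))"
        using MN by (simp add: ennreal_mult')
      finally show ?thesis .
    qed
    have early: "(\<integral>\<^sup>+ t. ennreal (b t) * indicator {0..S} t \<partial>lborel) \<le> ennreal (S * (D * (2 * pi) ^ CARD('d) * M * N * n powr (1/2)))"
    proof -
      have "(\<integral>\<^sup>+ t. ennreal (b t) * indicator {0..S} t \<partial>lborel) \<le> (\<integral>\<^sup>+ t. ennreal (D * (2 * pi) ^ CARD('d) * M * N * n powr (1/2)) * indicator {0..S} t \<partial>lborel)"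
        by (intro nn_integral_mono mult_right_mono ennreal_leI b_early) auto
      also have "\<dots> = ennreal (S * (D * (2 * pi) ^ CARD('d) * M * N * n powr (1/2)))"
        using S by (subst nn_integral_cmult_indicator) (auto simp: ennreal_mult' mult.commute)
      finally show ?thesis .
    qed
    have D0: "0 \<le> D" using Z0 by (simp add: D_def)
    have E0: "0 \<le> E" using rc dc Z0 by (simp add: E_def)
    have sym: "integrable torus (resolvent_symbol s z T :: real ^ 'd \<Rightarrow> complex)"
      using resolvent_symbol_measurable resolvent_symbol_bounded[OF T z] by (rule integrable_torus)
    have "norm (\<Sum>x\<in>X. \<Sum>y\<in>Y. f x * h y * torus_form (resolvent_symbol s z T) x y)
       = norm (\<integral>t. exp (\<i> * of_real s * of_real t * z\<^sup>2) * (\<integral>\<xi>. propagator (s * t) \<xi> * (of_real (omega \<xi>) + z) * F \<xi> \<partial>torus) \<partial>time_measure T)"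
      unfolding sum_torus_form[OF sym] F_def[symmetric]
      by (subst integral_resolvent_symbol[OF _ Fb T z]) auto
    also have "ennreal \<dots> \<le> (\<integral>\<^sup>+ t. ennreal (norm (exp (\<i> * of_real s * of_real t * z\<^sup>2) * (\<integral>\<xi>. propagator (s * t) \<xi> * (of_real (omega \<xi>) + z) * F \<xi> \<partial>torus))) \<partial>time_measure T)"
      by (rule norm_integral_le_nn_integral)
    also have "\<dots> \<le> (\<integral>\<^sup>+ t. ennreal (b t) \<partial>time_measure T)"
    proof (rule nn_integral_mono)
      fix t assume "t \<in> space (time_measure T)"
      then have "0 \<le> t" by (simp add: time_measure_def space_restrict_space)
      then show "ennreal (norm (exp (\<i> * of_real s * of_real t * z\<^sup>2) * (\<integral>\<xi>. propagator (s * t) \<xi> * (of_real (omega \<xi>) + z) * F \<xi> \<partial>torus))) \<le> ennreal (b t)"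
        unfolding norm_mult b_def using norm_exp_time_le[OF _ z, of t] by (intro ennreal_leI mult_left_le_one_le) auto
    qed
    also have "\<dots> = (\<integral>\<^sup>+ t. ennreal (b t) * indicator {0..T} t \<partial>lborel)"
      unfolding time_measure_def by (subst nn_integral_restrict_space) auto
    \<comment> \<open>The cut-off at T is dropped here, whether T lies before or after S; this makes
      the bound uniform in T.\<close>
    also have "\<dots> \<le> (\<integral>\<^sup>+ t. ennreal (b t) * indicator {0..S} t + ennreal (b t) * indicator {S..} t \<partial>lborel)"
      by (intro nn_integral_mono) (auto simp: indicator_def)
    also have "\<dots> = (\<integral>\<^sup>+ t. ennreal (b t) * indicator {0..S} t \<partial>lborel) + (\<integral>\<^sup>+ t. ennreal (b t) * indicator {S..} t \<partial>lborel)"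
      by (intro nn_integral_add) auto
    also have "\<dots> \<le> ennreal (S * (D * (2 * pi) ^ CARD('d) * M * N * n powr (1/2))) + ennreal (M * N * (n * (E * S powr (-1/2))))"
      by (intro add_mono early late)
    also have "\<dots> = ennreal (S * (D * (2 * pi) ^ CARD('d) * M * N * n powr (1/2)) + M * N * (n * (E * S powr (-1/2))))"
      using D0 E0 MN S n by (intro ennreal_plus[symmetric]) auto
    also have "S * (D * (2 * pi) ^ CARD('d) * M * N * n powr (1/2)) = D * (2 * pi) ^ CARD('d) * M * N * n powr (5/6)"
      by (simp add: S_def powr_add[symmetric])
    also have "M * N * (n * (E * S powr (-1/2))) = E * M * N * n powr (5/6)"
    proof -
      have "n * S powr (-1/2) = n powr 1 * n powr (-1/6)" using n by (simp add: S_def powr_powr)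
      also have "\<dots> = n powr (1 + -1/6)" by (rule powr_add[symmetric])
      also have "\<dots> = n powr (5/6)" by simp
      finally show ?thesis by (simp add: mult_ac)
    qed
    finally show ?thesis
      using D0 E0 MN by (subst (asm) ennreal_le_iff) (auto simp: algebra_simps)
  qed
qed

section \<open>Fourier series of square summable functions\<close>

definition square_integrable :: "(real ^ 'd::finite \<Rightarrow> complex) \<Rightarrow> bool" where
  "square_integrable G \<longleftrightarrow> G \<in> borel_measurable torus \<and> integrable torus (\<lambda>\<xi>. (norm (G \<xi>))\<^sup>2)"

definition fourier_coeff :: "(real ^ 'd::finite \<Rightarrow> complex) \<Rightarrow> 'd lattice \<Rightarrow> complex" where
  "fourier_coeff G x = (\<integral>\<xi>. G \<xi> * plane_wave \<xi> x \<partial>torus) / of_real ((2 * pi) ^ CARD('d))"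

lemma square_integrable_bounded:
  fixes f :: "real ^ 'd::finite \<Rightarrow> complex"
  assumes "f \<in> borel_measurable torus" "\<And>\<xi>. norm (f \<xi>) \<le> B"
  shows "square_integrable f"
  unfolding square_integrable_def
proof (intro conjI assms(1) integrable_torus[where B = "B\<^sup>2"])
  show "(\<lambda>\<xi>. (norm (f \<xi>))\<^sup>2) \<in> borel_measurable torus" using assms(1) by measurable
  show "norm ((norm (f \<xi>))\<^sup>2) \<le> B\<^sup>2" for \<xi> using assms(2)[of \<xi>] by (simp add: power_mono)
qed

lemma trig_poly_measurable_torus [measurable]: "trig_poly Y c \<in> borel_measurable torus"
  by (rule borel_measurable_torus) measurable

lemma plane_wave_measurable_torus [measurable]: "(\<lambda>\<xi>. plane_wave \<xi> x) \<in> borel_measurable torus"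
  by (rule borel_measurable_torus) measurable

lemma square_integrable_trig_poly: "square_integrable (trig_poly Y c)"
  by (rule square_integrable_bounded[OF trig_poly_measurable_torus norm_trig_poly_le])

lemma square_integrable_add:
  assumes "square_integrable u" "square_integrable v"
  shows "square_integrable (\<lambda>\<xi>. u \<xi> + v \<xi>)"
    and "L2_sq (\<lambda>\<xi>. u \<xi> + v \<xi>) \<le> 2 * L2_sq u + 2 * L2_sq v"
proof -
  have [measurable]: "u \<in> borel_measurable torus" "v \<in> borel_measurable torus"
    and int: "integrable torus (\<lambda>\<xi>. (norm (u \<xi>))\<^sup>2)" "integrable torus (\<lambda>\<xi>. (norm (v \<xi>))\<^sup>2)"
    using assms by (auto simp: square_integrable_def)
  have le: "(norm (u \<xi> + v \<xi>))\<^sup>2 \<le> 2 * (norm (u \<xi>))\<^sup>2 + 2 * (norm (v \<xi>))\<^sup>2" for \<xi>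
  proof -
    have "(norm (u \<xi> + v \<xi>))\<^sup>2 \<le> (norm (u \<xi>) + norm (v \<xi>))\<^sup>2"
      by (intro power_mono norm_triangle_ineq) auto
    also have "\<dots> \<le> 2 * (norm (u \<xi>))\<^sup>2 + 2 * (norm (v \<xi>))\<^sup>2"
      using sum_squares_bound[of "norm (u \<xi>)" "norm (v \<xi>)"] by (simp add: power2_sum)
    finally show ?thesis .
  qed
  have i: "integrable torus (\<lambda>\<xi>. (norm (u \<xi> + v \<xi>))\<^sup>2)"
  proof (rule Bochner_Integration.integrable_bound)
    show "integrable torus (\<lambda>\<xi>. 2 * (norm (u \<xi>))\<^sup>2 + 2 * (norm (v \<xi>))\<^sup>2)" using int by simp
    show "AE \<xi> in torus. norm ((norm (u \<xi> + v \<xi>))\<^sup>2) \<le> norm (2 * (norm (u \<xi>))\<^sup>2 + 2 * (norm (v \<xi>))\<^sup>2)"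
      using le by (intro AE_I2) (simp add: order_trans[OF le abs_ge_self])
  qed measurable
  then show "square_integrable (\<lambda>\<xi>. u \<xi> + v \<xi>)" unfolding square_integrable_def by simp
  have "L2_sq (\<lambda>\<xi>. u \<xi> + v \<xi>) \<le> (\<integral>\<xi>. 2 * (norm (u \<xi>))\<^sup>2 + 2 * (norm (v \<xi>))\<^sup>2 \<partial>torus)"
    using i int le by (intro integral_mono) auto
  then show "L2_sq (\<lambda>\<xi>. u \<xi> + v \<xi>) \<le> 2 * L2_sq u + 2 * L2_sq v"
    using int by simp
qed

lemma square_integrable_mult:
  assumes m: "m \<in> borel_measurable torus" "\<And>\<xi>. norm (m \<xi>) \<le> B" and u: "square_integrable u"
  shows "square_integrable (\<lambda>\<xi>. m \<xi> * u \<xi>)"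
    and "L2_sq (\<lambda>\<xi>. m \<xi> * u \<xi>) \<le> B\<^sup>2 * L2_sq u"
proof -
  have [measurable]: "u \<in> borel_measurable torus" "m \<in> borel_measurable torus"
    and int: "integrable torus (\<lambda>\<xi>. (norm (u \<xi>))\<^sup>2)"
    using u m by (auto simp: square_integrable_def)
  have le: "(norm (m \<xi> * u \<xi>))\<^sup>2 \<le> B\<^sup>2 * (norm (u \<xi>))\<^sup>2" for \<xi>
    unfolding norm_mult power_mult_distrib using m(2) by (intro mult_right_mono power_mono) auto
  have i: "integrable torus (\<lambda>\<xi>. (norm (m \<xi> * u \<xi>))\<^sup>2)"
  proof (rule Bochner_Integration.integrable_bound)
    show "integrable torus (\<lambda>\<xi>. B\<^sup>2 * (norm (u \<xi>))\<^sup>2)" using int by simp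
    show "AE \<xi> in torus. norm ((norm (m \<xi> * u \<xi>))\<^sup>2) \<le> norm (B\<^sup>2 * (norm (u \<xi>))\<^sup>2)"
      using order_trans[OF le abs_ge_self] by (intro AE_I2) (simp only: real_norm_def abs_power2)
  qed measurable
  then show "square_integrable (\<lambda>\<xi>. m \<xi> * u \<xi>)" unfolding square_integrable_def by simp
  have "L2_sq (\<lambda>\<xi>. m \<xi> * u \<xi>) \<le> (\<integral>\<xi>. B\<^sup>2 * (norm (u \<xi>))\<^sup>2 \<partial>torus)"
    using i int by (intro integral_mono le) auto
  then show "L2_sq (\<lambda>\<xi>. m \<xi> * u \<xi>) \<le> B\<^sup>2 * L2_sq u"
    by simp
qed

lemma square_integrable_diff:
  assumes "square_integrable u" "square_integrable v"
  shows "square_integrable (\<lambda>\<xi>. u \<xi> - v \<xi>)"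
  using square_integrable_add(1)[OF assms(1) square_integrable_mult(1)[OF _ _ assms(2), of "\<lambda>_. -1" 1]] by simp

lemma square_integrable_imp_integrable:
  assumes u: "square_integrable (u :: real ^ 'd::finite \<Rightarrow> complex)"
  shows "integrable torus u"
    and "(\<integral>\<xi>. norm (u \<xi>) \<partial>torus) \<le> sqrt ((2 * pi) ^ CARD('d)) * sqrt (L2_sq u)"
proof -
  have u': "u \<in> borel_measurable torus" "integrable torus (\<lambda>\<xi>. (norm (u \<xi>))\<^sup>2)"
    using u by (auto simp: square_integrable_def)
  have one: "(\<lambda>\<xi>. 1 :: complex) \<in> borel_measurable (torus :: (real ^ 'd) measure)"
    "integrable (torus :: (real ^ 'd) measure) (\<lambda>\<xi>. (norm (1 :: complex))\<^sup>2)" by auto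
  show "integrable torus u" using integrable_mult_L2[OF u'(1) one(1) u'(2) one(2)] by simp
  show "(\<integral>\<xi>. norm (u \<xi>) \<partial>torus) \<le> sqrt ((2 * pi) ^ CARD('d)) * sqrt (L2_sq u)"
    using integral_norm_mult_le[OF u'(1) one(1) u'(2) one(2)] measure_torus[where 'd = 'd]
    by (simp add: mult.commute)
qed

text \<open>Completing the square in the coefficients. The identity yields both Bessel's inequality
  and the optimality of the Fourier coefficients among all coefficients supported in Y.\<close>

lemma integral_norm_minus_trig_poly_sq:
  fixes G :: "real ^ 'd::finite \<Rightarrow> complex"
  assumes G: "square_integrable G"
  shows "L2_sq (\<lambda>\<xi>. G \<xi> - trig_poly Y c \<xi>) = L2_sq G
    + (2 * pi) ^ CARD('d) * (\<Sum>x\<in>Y. (norm (c x - fourier_coeff G x))\<^sup>2 - (norm (fourier_coeff G x))\<^sup>2)"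
proof -
  define V where "V = (2 * pi) ^ CARD('d)"
  have V: "0 < V" by (simp add: V_def)
  have G': "G \<in> borel_measurable torus" "integrable torus (\<lambda>\<xi>. (norm (G \<xi>))\<^sup>2)"
    using G by (auto simp: square_integrable_def)
  have sq: "(norm (a - b))\<^sup>2 = (norm a)\<^sup>2 + (norm b)\<^sup>2 - 2 * Re (a * cnj b)" for a b :: complex
    unfolding cmod_power2 by (simp add: power2_eq_square algebra_simps)
  have iG: "integrable torus (\<lambda>\<xi>. G \<xi> * plane_wave \<xi> x)" for x
    by (rule square_integrable_imp_integrable)
       (use square_integrable_mult(1)[of "\<lambda>\<xi>. plane_wave \<xi> x" 1 G] G in \<open>simp add: mult.commute\<close>)
  have GP: "G \<xi> * cnj (trig_poly Y c \<xi>) = (\<Sum>x\<in>Y. cnj (c x) * (G \<xi> * plane_wave \<xi> x))" for \<xi>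
    by (simp add: trig_poly_def sum_distrib_left mult_ac)
  have iGP: "integrable torus (\<lambda>\<xi>. G \<xi> * cnj (trig_poly Y c \<xi>))"
    unfolding GP using iG by auto
  have "(\<integral>\<xi>. G \<xi> * cnj (trig_poly Y c \<xi>) \<partial>torus) = (\<Sum>x\<in>Y. cnj (c x) * (of_real V * fourier_coeff G x))"
    unfolding GP using iG V by (simp add: fourier_coeff_def V_def)
  then have Re: "(\<integral>\<xi>. Re (G \<xi> * cnj (trig_poly Y c \<xi>)) \<partial>torus) = V * (\<Sum>x\<in>Y. Re (cnj (c x) * fourier_coeff G x))"
    unfolding integral_Re[OF iGP] by (simp add: sum_distrib_left algebra_simps)
  have "L2_sq (\<lambda>\<xi>. G \<xi> - trig_poly Y c \<xi>)
     = L2_sq G + L2_sq (trig_poly Y c) - 2 * (\<integral>\<xi>. Re (G \<xi> * cnj (trig_poly Y c \<xi>)) \<partial>torus)"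
    unfolding sq using G' square_integrable_trig_poly[of Y c] integrable_Re[OF iGP]
    by (simp add: square_integrable_def del: times_complex.sel)
  also have "\<dots> = L2_sq G + V * (\<Sum>x\<in>Y. (norm (c x))\<^sup>2 - 2 * Re (cnj (c x) * fourier_coeff G x))"
    unfolding Re integral_trig_poly_sq V_def[symmetric]
    by (simp add: sum_subtractf sum_distrib_left algebra_simps)
  also have "(\<Sum>x\<in>Y. (norm (c x))\<^sup>2 - 2 * Re (cnj (c x) * fourier_coeff G x))
     = (\<Sum>x\<in>Y. (norm (c x - fourier_coeff G x))\<^sup>2 - (norm (fourier_coeff G x))\<^sup>2)"
    unfolding sq by (intro sum.cong) (auto simp: algebra_simps)
  finally show ?thesis by (simp add: V_def)
qed

lemma bessel_inequality:
  fixes G :: "real ^ 'd::finite \<Rightarrow> complex"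
  assumes G: "square_integrable G"
  shows "(2 * pi) ^ CARD('d) * (\<Sum>x\<in>Y. (norm (c x - fourier_coeff G x))\<^sup>2) \<le> L2_sq (\<lambda>\<xi>. G \<xi> - trig_poly Y c \<xi>)"
proof -
  have "0 \<le> L2_sq (\<lambda>\<xi>. G \<xi> - trig_poly Y (fourier_coeff G) \<xi>)" by simp
  then show ?thesis
    unfolding integral_norm_minus_trig_poly_sq[OF G] by (simp add: sum_subtractf sum_negf algebra_simps)
qed

text \<open>The L^2 closure of the trigonometric polynomials. Fourier transforms enter it by their
  construction, and multiplication by \<open>omega\<close> - z is shown to preserve it.\<close>

definition trig_approximable :: "(real ^ 'd::finite \<Rightarrow> complex) \<Rightarrow> bool" where
  "trig_approximable G \<longleftrightarrow> square_integrable G \<and>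
    (\<forall>\<epsilon>>0. \<exists>Y c. finite Y \<and> (L2_sq (\<lambda>\<xi>. G \<xi> - trig_poly Y c \<xi>)) < \<epsilon>)"

text \<open>By optimality the approximating coefficients may be taken to be the Fourier
  coefficients. This matters because for (\<open>omega\<close> - z) times the transform of \<psi>
  these are the values whose l^p norm appears on the right of the theorem.\<close>

lemma trig_approximable_fourier_series:
  assumes G: "trig_approximable G" and "0 < \<epsilon>"
  obtains Y where "finite Y" "L2_sq (\<lambda>\<xi>. G \<xi> - trig_poly Y (fourier_coeff G) \<xi>) < \<epsilon>"
proof -
  from assms obtain Y c where Y: "finite Y" "L2_sq (\<lambda>\<xi>. G \<xi> - trig_poly Y c \<xi>) < \<epsilon>"
    and sq: "square_integrable G"
    by (auto simp: trig_approximable_def)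
  have "L2_sq (\<lambda>\<xi>. G \<xi> - trig_poly Y (fourier_coeff G) \<xi>) \<le> L2_sq (\<lambda>\<xi>. G \<xi> - trig_poly Y c \<xi>)"
    unfolding integral_norm_minus_trig_poly_sq[OF sq] by (intro add_left_mono mult_left_mono sum_mono) auto
  with Y show thesis by (intro that) auto
qed

text \<open>An algebra of symbols containing the characters, hence all polynomials in
  \<open>hopping\<close>; it supplies the uniform approximants of \<open>omega\<close>.\<close>

definition preserves_trig_polys :: "(real ^ 'd::finite \<Rightarrow> complex) \<Rightarrow> bool" where
  "preserves_trig_polys m \<longleftrightarrow> (\<forall>Y c. finite Y \<longrightarrow> (\<exists>Y' c'. finite Y' \<and> (\<lambda>\<xi>. m \<xi> * trig_poly Y c \<xi>) = trig_poly Y' c'))"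

lemma preserves_trig_polys_const: "preserves_trig_polys (\<lambda>_. a)"
  unfolding preserves_trig_polys_def
proof (intro allI impI)
  fix Y :: "'d::finite lattice set" and c assume "finite Y"
  moreover have "(\<lambda>\<xi>. a * trig_poly Y c \<xi>) = trig_poly Y (\<lambda>x. a * c x)"
    by (simp add: trig_poly_def fun_eq_iff sum_distrib_left mult_ac)
  ultimately show "\<exists>Y' c'. finite Y' \<and> (\<lambda>\<xi>. a * trig_poly Y c \<xi>) = trig_poly Y' c'" by blast
qed

lemma preserves_trig_polys_plane_wave:
  fixes u :: "'d::finite lattice"
  shows "preserves_trig_polys (\<lambda>\<xi>. plane_wave \<xi> u)"
  unfolding preserves_trig_polys_def
proof (intro allI impI)
  fix Y :: "'d lattice set" and c assume "finite Y"
  moreover have "(\<lambda>\<xi>. plane_wave \<xi> u * trig_poly Y c \<xi>) = trig_poly ((\<lambda>x. x - u) ` Y) (\<lambda>x. c (x + u))"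
  proof
    fix \<xi>
    have "trig_poly ((\<lambda>x. x - u) ` Y) (\<lambda>x. c (x + u)) \<xi> = (\<Sum>x\<in>Y. c x * cnj (plane_wave \<xi> (x - u)))"
      unfolding trig_poly_def by (subst sum.reindex) (auto simp: inj_on_def)
    also have "\<dots> = plane_wave \<xi> u * trig_poly Y c \<xi>"
      by (simp add: plane_wave_add[of \<xi> _ "- u", simplified] plane_wave_minus trig_poly_def sum_distrib_left mult_ac)
    finally show "plane_wave \<xi> u * trig_poly Y c \<xi> = trig_poly ((\<lambda>x. x - u) ` Y) (\<lambda>x. c (x + u)) \<xi>" ..
  qed
  ultimately show "\<exists>Y' c'. finite Y' \<and> (\<lambda>\<xi>. plane_wave \<xi> u * trig_poly Y c \<xi>) = trig_poly Y' c'"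
    by blast
qed

lemma preserves_trig_polys_mult:
  assumes "preserves_trig_polys u" "preserves_trig_polys v"
  shows "preserves_trig_polys (\<lambda>\<xi>. u \<xi> * v \<xi>)"
  unfolding preserves_trig_polys_def
proof (intro allI impI)
  fix Y :: "'a::finite lattice set" and c assume "finite Y"
  then obtain Y1 c1 where 1: "finite Y1" "(\<lambda>\<xi>. v \<xi> * trig_poly Y c \<xi>) = trig_poly Y1 c1"
    using assms(2) unfolding preserves_trig_polys_def by blast
  then obtain Y2 c2 where 2: "finite Y2" "(\<lambda>\<xi>. u \<xi> * trig_poly Y1 c1 \<xi>) = trig_poly Y2 c2"
    using assms(1) unfolding preserves_trig_polys_def by blast
  have "(\<lambda>\<xi>. u \<xi> * v \<xi> * trig_poly Y c \<xi>) = trig_poly Y2 c2"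
    unfolding 2(2)[symmetric] 1(2)[symmetric] by (simp add: mult.assoc)
  then show "\<exists>Y' c'. finite Y' \<and> (\<lambda>\<xi>. u \<xi> * v \<xi> * trig_poly Y c \<xi>) = trig_poly Y' c'"
    using 2(1) by blast
qed

lemma preserves_trig_polys_add:
  assumes "preserves_trig_polys u" "preserves_trig_polys v"
  shows "preserves_trig_polys (\<lambda>\<xi>. u \<xi> + v \<xi>)"
  unfolding preserves_trig_polys_def
proof (intro allI impI)
  fix Y :: "'a::finite lattice set" and c assume Y: "finite Y"
  then obtain Y1 c1 where 1: "finite Y1" "(\<lambda>\<xi>. u \<xi> * trig_poly Y c \<xi>) = trig_poly Y1 c1"
    using assms(1) unfolding preserves_trig_polys_def by blast
  from Y obtain Y2 c2 where 2: "finite Y2" "(\<lambda>\<xi>. v \<xi> * trig_poly Y c \<xi>) = trig_poly Y2 c2"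
    using assms(2) unfolding preserves_trig_polys_def by blast
  have ext: "trig_poly Y0 c0 = trig_poly (Y1 \<union> Y2) (\<lambda>x. if x \<in> Y0 then c0 x else 0)" if "Y0 \<subseteq> Y1 \<union> Y2" for Y0 c0
    unfolding trig_poly_def using that 1(1) 2(1) by (intro ext sum.mono_neutral_cong_left) auto
  have "(\<lambda>\<xi>. (u \<xi> + v \<xi>) * trig_poly Y c \<xi>) = (\<lambda>\<xi>. trig_poly Y1 c1 \<xi> + trig_poly Y2 c2 \<xi>)"
    unfolding 2(2)[symmetric] 1(2)[symmetric] by (simp add: algebra_simps)
  also have "\<dots> = trig_poly (Y1 \<union> Y2) (\<lambda>x. (if x \<in> Y1 then c1 x else 0) + (if x \<in> Y2 then c2 x else 0))"
    by (subst (1 2) ext) (auto simp: trig_poly_def fun_eq_iff sum.distrib[symmetric] algebra_simps)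
  finally show "\<exists>Y' c'. finite Y' \<and> (\<lambda>\<xi>. (u \<xi> + v \<xi>) * trig_poly Y c \<xi>) = trig_poly Y' c'"
    using 1(1) 2(1) by blast
qed

lemma preserves_trig_polys_sum:
  "(\<And>i. i \<in> I \<Longrightarrow> preserves_trig_polys (u i)) \<Longrightarrow> preserves_trig_polys (\<lambda>\<xi>. \<Sum>i\<in>I. u i \<xi>)"
  by (induction I rule: infinite_finite_induct)
     (auto intro: preserves_trig_polys_const preserves_trig_polys_add)

lemma preserves_trig_polys_hopping: "preserves_trig_polys (\<lambda>\<xi> :: real ^ 'd::finite. of_real (hopping \<xi>))"
proof -
  have "of_real (hopping \<xi>) = (\<Sum>p\<in>(UNIV :: 'd set) \<times> {1, -1}. of_real (1 / (1 + 2 * real CARD('d))) * plane_wave \<xi> (axis (fst p) (snd p)))" for \<xi> :: "real ^ 'd"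
    using hopping_plane_wave[of \<xi> 0] by (simp add: plane_wave_def[of \<xi> 0] case_prod_beta sum_divide_distrib)
  then show ?thesis
    by (simp only:) (intro preserves_trig_polys_sum preserves_trig_polys_mult preserves_trig_polys_const preserves_trig_polys_plane_wave)
qed

lemma preserves_trig_polys_hopping_power: "preserves_trig_polys (\<lambda>\<xi>. of_real (hopping \<xi> ^ k))"
  by (induction k) (auto intro: preserves_trig_polys_const preserves_trig_polys_mult preserves_trig_polys_hopping)

text \<open>With u uniformly close to m and P close to G, the product u P is again a trigonometric
  polynomial, and m G - u P = (m - u) G + u (G - P).\<close>

lemma trig_approximable_mult:
  fixes m :: "real ^ 'd::finite \<Rightarrow> complex"
  assumes G: "trig_approximable G" and m: "m \<in> borel_measurable torus"
    and B: "\<And>\<xi>. norm (m \<xi>) \<le> B"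
    and appr: "\<And>\<epsilon>. 0 < \<epsilon> \<Longrightarrow> \<exists>u. u \<in> borel_measurable torus \<and> preserves_trig_polys u \<and> (\<forall>\<xi>. norm (m \<xi> - u \<xi>) \<le> \<epsilon>)"
  shows "trig_approximable (\<lambda>\<xi>. m \<xi> * G \<xi>)"
  unfolding trig_approximable_def
proof (intro conjI allI impI)
  have sG: "square_integrable G" using G by (simp add: trig_approximable_def)
  show "square_integrable (\<lambda>\<xi>. m \<xi> * G \<xi>)" by (rule square_integrable_mult(1)[OF m B sG])
  fix \<epsilon> :: real assume \<epsilon>: "0 < \<epsilon>"
  define I where "I = L2_sq G"
  have I0: "0 \<le> I" by (simp add: I_def)
  have B0: "0 \<le> B" using B[of 0] norm_ge_zero order_trans by blast
  \<comment> \<open>The bound 1 gives |u| <= B + 1 and makes \<delta> squared at most \<delta>; I +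
    1 avoids division by zero.\<close>
  define \<delta> where "\<delta> = min 1 (\<epsilon> / (4 * (I + 1)))"
  have \<delta>: "0 < \<delta>" "\<delta> \<le> 1" "\<delta> \<le> \<epsilon> / (4 * (I + 1))" using \<epsilon> I0 by (auto simp: \<delta>_def)
  obtain u where u: "u \<in> borel_measurable torus" "preserves_trig_polys u" "\<And>\<xi>. norm (m \<xi> - u \<xi>) \<le> \<delta>"
    using appr[OF \<delta>(1)] by blast
  have uB: "norm (u \<xi>) \<le> B + 1" for \<xi>
    using norm_triangle_ineq2[of "u \<xi>" "m \<xi>"] u(3)[of \<xi>] B[of \<xi>] \<delta>(2) by (simp add: norm_minus_commute)
  have "0 < \<epsilon> / (4 * (B + 1)\<^sup>2)" using \<epsilon> B0 by simp
  then obtain Y c where Y: "finite Y" "L2_sq (\<lambda>\<xi>. G \<xi> - trig_poly Y c \<xi>) < \<epsilon> / (4 * (B + 1)\<^sup>2)"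
    using G unfolding trig_approximable_def by blast
  obtain Y' c' where Y': "finite Y'" "(\<lambda>\<xi>. u \<xi> * trig_poly Y c \<xi>) = trig_poly Y' c'"
    using u(2) Y(1) unfolding preserves_trig_polys_def by blast
  have eq: "m \<xi> * G \<xi> - trig_poly Y' c' \<xi> = (m \<xi> - u \<xi>) * G \<xi> + u \<xi> * (G \<xi> - trig_poly Y c \<xi>)" for \<xi>
    unfolding Y'(2)[symmetric] by (simp add: algebra_simps)
  have s1: "square_integrable (\<lambda>\<xi>. (m \<xi> - u \<xi>) * G \<xi>)" "L2_sq (\<lambda>\<xi>. (m \<xi> - u \<xi>) * G \<xi>) \<le> \<delta>\<^sup>2 * I"
    unfolding I_def using m u(1,3) by (auto intro!: square_integrable_mult sG)
  have s2: "square_integrable (\<lambda>\<xi>. u \<xi> * (G \<xi> - trig_poly Y c \<xi>))"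
    "L2_sq (\<lambda>\<xi>. u \<xi> * (G \<xi> - trig_poly Y c \<xi>)) \<le> (B + 1)\<^sup>2 * L2_sq (\<lambda>\<xi>. G \<xi> - trig_poly Y c \<xi>)"
    using square_integrable_mult[OF u(1) uB square_integrable_diff[OF sG square_integrable_trig_poly]] by auto
  have "L2_sq (\<lambda>\<xi>. m \<xi> * G \<xi> - trig_poly Y' c' \<xi>) \<le> 2 * L2_sq (\<lambda>\<xi>. (m \<xi> - u \<xi>) * G \<xi>)
     + 2 * L2_sq (\<lambda>\<xi>. u \<xi> * (G \<xi> - trig_poly Y c \<xi>))"
    unfolding eq by (rule square_integrable_add(2)[OF s1(1) s2(1)])
  also have "\<dots> \<le> 2 * (\<delta>\<^sup>2 * I) + 2 * ((B + 1)\<^sup>2 * L2_sq (\<lambda>\<xi>. G \<xi> - trig_poly Y c \<xi>))"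
    using s1(2) s2(2) by (intro add_mono mult_left_mono) auto
  also have "\<dots> < \<epsilon> / 2 + \<epsilon> / 2"
  proof (rule add_le_less_mono)
    have "\<delta>\<^sup>2 * I \<le> \<delta> * (I + 1)"
      using \<delta> I0 by (intro mult_mono) (auto simp: power2_eq_square mult_left_le_one_le)
    also have "\<dots> \<le> \<epsilon> / (4 * (I + 1)) * (I + 1)" using \<delta> I0 by (intro mult_right_mono) auto
    also have "\<dots> = \<epsilon> / 4" using I0 by (simp add: field_simps)
    finally show "2 * (\<delta>\<^sup>2 * I) \<le> \<epsilon> / 2" by simp
    have "(B + 1)\<^sup>2 * L2_sq (\<lambda>\<xi>. G \<xi> - trig_poly Y c \<xi>) < (B + 1)\<^sup>2 * (\<epsilon> / (4 * (B + 1)\<^sup>2))"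
      using Y(2) B0 by (intro mult_strict_left_mono) auto
    also have "\<dots> = \<epsilon> / 4" using B0 by simp
    finally show "2 * ((B + 1)\<^sup>2 * L2_sq (\<lambda>\<xi>. G \<xi> - trig_poly Y c \<xi>)) < \<epsilon> / 2" by simp
  qed
  finally show "\<exists>Y c. finite Y \<and> (L2_sq (\<lambda>\<xi>. m \<xi> * G \<xi> - trig_poly Y c \<xi>)) < \<epsilon>"
    using Y'(1) by auto
qed

text \<open>Truncations of the square root series converge uniformly because the tail is dominated
  by the numerical tail at \<open>hopping_bound\<close>.\<close>

lemma omega_minus_uniform_approx:
  assumes "0 < \<epsilon>"
  shows "\<exists>u. u \<in> borel_measurable torus \<and> preserves_trig_polys u \<and>
    (\<forall>\<xi> :: real ^ 'd::finite. norm (of_real (omega \<xi>) - z - u \<xi>) \<le> \<epsilon>)"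
proof -
  define c where "c = sqrt_coeff TYPE('d)"
  define q where "q = hopping_bound TYPE('d)"
  have sc: "summable (\<lambda>k. \<bar>c k\<bar> * q ^ k)" using summable_sqrt_coeff[where 'd = 'd] by (simp add: c_def q_def)
  obtain N where N: "norm (\<Sum>k. \<bar>c (k + N)\<bar> * q ^ (k + N)) < \<epsilon>"
    using suminf_exist_split[OF assms sc] by blast
  define u where "u \<xi> = (\<Sum>k<N. of_real (c k) * of_real (hopping \<xi> ^ k)) + (- z)" for \<xi> :: "real ^ 'd"
  have "preserves_trig_polys u"
    unfolding u_def by (intro preserves_trig_polys_add preserves_trig_polys_sum preserves_trig_polys_mult
        preserves_trig_polys_const preserves_trig_polys_hopping_power)
  moreover have "u \<in> borel_measurable torus"
    unfolding u_def by (rule borel_measurable_torus) measurable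
  moreover have "norm (of_real (omega \<xi>) - z - u \<xi>) \<le> \<epsilon>" for \<xi> :: "real ^ 'd"
  proof -
    have s: "(\<lambda>k. c k * hopping \<xi> ^ k) sums omega \<xi>" unfolding c_def by (rule omega_sums)
    have le: "norm (c (k + N) * hopping \<xi> ^ (k + N)) \<le> \<bar>c (k + N)\<bar> * q ^ (k + N)" for k
      using abs_hopping_le[of \<xi>] unfolding q_def real_norm_def abs_mult power_abs
      by (intro mult_left_mono power_mono) auto
    have sc': "summable (\<lambda>k. \<bar>c (k + N)\<bar> * q ^ (k + N))" using summable_ignore_initial_segment[OF sc] .
    have sn: "summable (\<lambda>k. norm (c (k + N) * hopping \<xi> ^ (k + N)))"
      by (rule summable_comparison_test'[OF sc']) (use le in auto)
    have "omega \<xi> - (\<Sum>k<N. c k * hopping \<xi> ^ k) = (\<Sum>k. c (k + N) * hopping \<xi> ^ (k + N))"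
      using suminf_minus_initial_segment[OF sums_summable[OF s], of N] sums_unique[OF s] by simp
    also have "norm \<dots> \<le> (\<Sum>k. norm (c (k + N) * hopping \<xi> ^ (k + N)))" by (rule summable_norm[OF sn])
    also have "\<dots> \<le> (\<Sum>k. \<bar>c (k + N)\<bar> * q ^ (k + N))" by (intro suminf_le le sn sc')
    also have "\<dots> \<le> \<epsilon>" using N by simp
    finally have "\<bar>omega \<xi> - (\<Sum>k<N. c k * hopping \<xi> ^ k)\<bar> \<le> \<epsilon>" by simp
    moreover have "of_real (omega \<xi>) - z - u \<xi> = of_real (omega \<xi> - (\<Sum>k<N. c k * hopping \<xi> ^ k))"
      by (simp add: u_def)
    ultimately show ?thesis by (simp only: norm_of_real)
  qed
  ultimately show ?thesis by blast
qed


section \<open>Existence of the Fourier transform and recovery of its coefficients\<close>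

lemma trig_poly_diff:
  assumes "finite A" "finite B"
  shows "trig_poly A \<psi> \<xi> - trig_poly B \<psi> \<xi> = trig_poly ((A - B) \<union> (B - A)) (\<lambda>x. if x \<in> A then \<psi> x else - \<psi> x) \<xi>"
proof -
  have e: "trig_poly C \<psi> \<xi> = (\<Sum>x\<in>A \<union> B. if x \<in> C then \<psi> x * cnj (plane_wave \<xi> x) else 0)" if "C \<subseteq> A \<union> B" for C
    unfolding trig_poly_def using that assms by (intro sum.mono_neutral_cong_left) auto
  have "trig_poly A \<psi> \<xi> - trig_poly B \<psi> \<xi> = (\<Sum>x\<in>A \<union> B. if x \<in> A \<and> x \<notin> B then \<psi> x * cnj (plane_wave \<xi> x)
      else if x \<in> B \<and> x \<notin> A then - \<psi> x * cnj (plane_wave \<xi> x) else 0)"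
    unfolding e[of A, OF Un_upper1] e[of B, OF Un_upper2] sum_subtractf[symmetric] by (intro sum.cong) auto
  also have "\<dots> = trig_poly ((A - B) \<union> (B - A)) (\<lambda>x. if x \<in> A then \<psi> x else - \<psi> x) \<xi>"
    unfolding trig_poly_def using assms by (intro sum.mono_neutral_cong_right) auto
  finally show ?thesis .
qed

lemma nn_integral_trig_poly_diff:
  fixes \<psi> :: "'d::finite lattice \<Rightarrow> complex"
  assumes "finite A" "finite B"
  shows "(\<integral>\<^sup>+ \<xi>. ennreal ((norm (trig_poly A \<psi> \<xi> - trig_poly B \<psi> \<xi>))\<^sup>2) \<partial>torus)
     = ennreal ((2 * pi) ^ CARD('d) * (\<Sum>x\<in>(A - B) \<union> (B - A). (norm (\<psi> x))\<^sup>2))"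
proof -
  define c where "c x = (if x \<in> A then \<psi> x else - \<psi> x)" for x
  have "(\<Sum>x\<in>(A - B) \<union> (B - A). (norm (c x))\<^sup>2) = (\<Sum>x\<in>(A - B) \<union> (B - A). (norm (\<psi> x))\<^sup>2)"
    by (intro sum.cong) (auto simp: c_def)
  then show ?thesis
    unfolding trig_poly_diff[OF assms] c_def[symmetric]
    using nn_integral_eq_integral[of torus "\<lambda>\<xi>. (norm (trig_poly ((A - B) \<union> (B - A)) c \<xi>))\<^sup>2"]
      square_integrable_trig_poly[of "(A - B) \<union> (B - A)" c]
    by (simp add: square_integrable_def integral_trig_poly_sq)
qed

text \<open>\<open>fourier\<close> is a choice by \<open>SOME\<close>, so it has its meaning only
  after a limit is constructed. The limit is pointwise almost everywhere along a fast sequence of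
  partial sums, and Fatou's lemma upgrades it to L^2.\<close>

lemma riesz_fischer:
  fixes \<psi> :: "'d::finite lattice \<Rightarrow> complex"
  assumes "in_ell 2 \<psi>"
  shows "\<exists>g. is_fourier \<psi> g"
proof -
  define V where "V = (2 * pi) ^ CARD('d)"
  have V: "0 < V" by (simp add: V_def)
  define a where "a x = (norm (\<psi> x))\<^sup>2" for x
  have "(\<lambda>x. norm (\<psi> x) powr 2) = a" by (auto simp: a_def fun_eq_iff)
  then have a: "a summable_on UNIV" using assms by (simp add: in_ell_def)
  have a0: "0 \<le> a x" for x by (simp add: a_def)
  define s where "s = infsum a UNIV"
  have a_le: "sum a X \<le> s" if "finite X" for X
    unfolding s_def using that a a0 by (intro finite_sum_le_infsum) auto
  \<comment> \<open>Powers of 1/4 for the squared norms give powers of 1/2 for the norms, which is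
    the summability needed for pointwise convergence.\<close>
  have "\<exists>X. finite X \<and> s - sum a X < (1/4) ^ n" for n :: nat
  proof -
    have "eventually (\<lambda>X. s - (1/4) ^ n < sum a X) (finite_subsets_at_top UNIV)"
      using infsum_tendsto[OF a] unfolding s_def[symmetric] by (rule order_tendstoD) simp
    then show ?thesis unfolding eventually_finite_subsets_at_top by (metis add.commute diff_less_eq finite.emptyI order_refl subset_UNIV)
  qed
  then obtain X where X: "\<And>n. finite (X n)" "\<And>n. s - sum a (X n) < (1/4) ^ n" by metis
  define Z where "Z n = (\<Union>k\<le>n. X k)" for n :: nat
  have Zfin: "finite (Z n)" for n using X(1) by (simp add: Z_def)
  have Zmono: "Z m \<subseteq> Z n" if "m \<le> n" for m n
    unfolding Z_def using that by (intro UN_mono) auto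
  have tail: "sum a Y \<le> (1/4) ^ n" if Y: "finite Y" "Y \<inter> Z n = {}" for Y n
  proof -
    have "sum a (X n) \<le> sum a (Z n)"
      by (intro sum_mono2 Zfin a0) (auto simp: Z_def)
    moreover have "sum a (Z n) + sum a Y \<le> s"
      using Y Zfin[of n] a_le[of "Z n \<union> Y"] sum.union_disjoint[of "Z n" Y a] by (simp add: Int_commute)
    ultimately show ?thesis using X(2)[of n] by linarith
  qed
  define f where "f n = trig_poly (Z n) \<psi>" for n
  have [measurable]: "f n \<in> borel_measurable torus" for n by (simp add: f_def)
  have diff_le: "(\<integral>\<^sup>+ \<xi>. ennreal ((norm (f n \<xi> - trig_poly Y \<psi> \<xi>))\<^sup>2) \<partial>torus) \<le> ennreal (V * (1/4) ^ m)"
    if "finite Y" "Z m \<subseteq> Y" "m \<le> n" for Y m n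
    unfolding f_def nn_integral_trig_poly_diff[OF Zfin that(1)] a_def[symmetric] V_def[symmetric]
    using that Zfin V Zmono[OF that(3)] by (intro ennreal_leI mult_left_mono tail) auto
  have "AE \<xi> in torus. convergent (\<lambda>n. f n \<xi>)"
  proof -
    define D where "D n \<xi> = f (Suc n) \<xi> - f n \<xi>" for n \<xi>
    have [measurable]: "D n \<in> borel_measurable torus" for n unfolding D_def by measurable
    have Dsq: "square_integrable (D n)" for n
      unfolding D_def f_def by (intro square_integrable_diff square_integrable_trig_poly)
    have D_le: "L2_sq (D n) \<le> V * (1/4) ^ n" for n
    proof -
      have "ennreal (L2_sq (D n)) = (\<integral>\<^sup>+ \<xi>. ennreal ((norm (D n \<xi>))\<^sup>2) \<partial>torus)"
        using Dsq[of n] by (intro nn_integral_eq_integral[symmetric]) (auto simp: square_integrable_def)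
      also have "\<dots> \<le> ennreal (V * (1/4) ^ n)"
        using diff_le[of "Z n" n "Suc n"] Zfin by (simp add: D_def f_def)
      finally show ?thesis using V by (subst (asm) ennreal_le_iff) auto
    qed
    \<comment> \<open>On a finite measure space the L^1 norm is controlled by the L^2 norm; the
      increments are then summable in L^1, hence almost everywhere.\<close>
    have D1: "(\<integral>\<^sup>+ \<xi>. ennreal (norm (D n \<xi>)) \<partial>torus) \<le> ennreal (V * (1/2) ^ n)" for n
    proof -
      have "(\<integral>\<xi>. norm (D n \<xi>) \<partial>torus) \<le> sqrt V * sqrt (L2_sq (D n))"
        unfolding V_def by (rule square_integrable_imp_integrable(2)[OF Dsq])
      also have "\<dots> \<le> sqrt V * sqrt (V * (1/4) ^ n)"
        using V by (intro mult_left_mono real_sqrt_le_mono D_le) auto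
      also have "\<dots> = V * sqrt ((1/4) ^ n)" using V by (simp add: real_sqrt_mult)
      also have "sqrt ((1/4) ^ n :: real) = (1/2) ^ n"
        by (simp add: real_sqrt_power real_sqrt_divide)
      finally show ?thesis
        using nn_integral_eq_integral[OF integrable_norm[OF square_integrable_imp_integrable(1)[OF Dsq[of n]]]]
        by (simp add: ennreal_leI)
    qed
    have "(\<integral>\<^sup>+ \<xi>. (\<Sum>n. ennreal (norm (D n \<xi>))) \<partial>torus) = (\<Sum>n. \<integral>\<^sup>+ \<xi>. ennreal (norm (D n \<xi>)) \<partial>torus)"
      by (intro nn_integral_suminf) measurable
    also have "\<dots> \<le> (\<Sum>n. ennreal (V * (1/2) ^ n))" by (intro suminf_le D1) auto
    also have "\<dots> = ennreal (\<Sum>n. V * (1/2) ^ n)"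
      using V by (intro suminf_ennreal2 summable_mult summable_geometric) auto
    also have "\<dots> < \<infinity>" by simp
    finally have "AE \<xi> in torus. (\<Sum>n. ennreal (norm (D n \<xi>))) \<noteq> \<infinity>"
      by (intro nn_integral_noteq_infinite) auto
    then show ?thesis
    proof eventually_elim
      case (elim \<xi>)
      then have "summable (\<lambda>n. norm (D n \<xi>))" by (intro summable_suminf_not_top) auto
      then have "(\<lambda>n. \<Sum>k<n. D k \<xi>) \<longlonglongrightarrow> (\<Sum>k. D k \<xi>)"
        by (rule summable_LIMSEQ[OF summable_norm_cancel])
      then have "(\<lambda>n. (\<Sum>k<n. D k \<xi>) + f 0 \<xi>) \<longlonglongrightarrow> (\<Sum>k. D k \<xi>) + f 0 \<xi>"
        by (intro tendsto_intros)
      moreover have "(\<Sum>k<n. D k \<xi>) + f 0 \<xi> = f n \<xi>" for n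
        using sum_lessThan_telescope[of "\<lambda>n. f n \<xi>" n] by (simp add: D_def)
      ultimately show ?case by (auto simp: convergent_def)
    qed
  qed
  define g where "g \<xi> = lim (\<lambda>n. f n \<xi>)" for \<xi>
  have g_meas [measurable]: "g \<in> borel_measurable torus" unfolding g_def by measurable
  have lim: "AE \<xi> in torus. (\<lambda>n. f n \<xi>) \<longlonglongrightarrow> g \<xi>"
    using \<open>AE \<xi> in torus. convergent (\<lambda>n. f n \<xi>)\<close> by eventually_elim (simp add: g_def convergent_LIMSEQ_iff)
  \<comment> \<open>The bound holds for every finite Y containing Z m, not just along the sequence:
    the limit in \<open>is_fourier\<close> runs over all finite sets.\<close>
  have fatou: "(\<integral>\<^sup>+ \<xi>. ennreal ((norm (g \<xi> - trig_poly Y \<psi> \<xi>))\<^sup>2) \<partial>torus) \<le> ennreal (V * (1/4) ^ m)"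
    if Y: "finite Y" "Z m \<subseteq> Y" for Y m
  proof -
    have "(\<integral>\<^sup>+ \<xi>. ennreal ((norm (g \<xi> - trig_poly Y \<psi> \<xi>))\<^sup>2) \<partial>torus)
      \<le> (\<integral>\<^sup>+ \<xi>. liminf (\<lambda>n. ennreal ((norm (f n \<xi> - trig_poly Y \<psi> \<xi>))\<^sup>2)) \<partial>torus)"
    proof (rule nn_integral_mono_AE, use lim in eventually_elim)
      case (elim \<xi>)
      then have "(\<lambda>n. ennreal ((norm (f n \<xi> - trig_poly Y \<psi> \<xi>))\<^sup>2)) \<longlonglongrightarrow> ennreal ((norm (g \<xi> - trig_poly Y \<psi> \<xi>))\<^sup>2)"
        by (intro tendsto_intros)
      from lim_imp_Liminf[OF trivial_limit_sequentially this] show ?case by (simp only: order_refl)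
    qed
    also have "\<dots> \<le> liminf (\<lambda>n. \<integral>\<^sup>+ \<xi>. ennreal ((norm (f n \<xi> - trig_poly Y \<psi> \<xi>))\<^sup>2) \<partial>torus)"
      by (intro nn_integral_liminf) measurable
    also have "\<dots> \<le> liminf (\<lambda>n. ennreal (V * (1/4) ^ m))"
      using diff_le[OF Y] by (intro Liminf_mono eventually_sequentiallyI[of m]) auto
    finally show ?thesis by (simp add: Liminf_const)
  qed
  have gT: "square_integrable (\<lambda>\<xi>. g \<xi> - trig_poly (Z 0) \<psi> \<xi>)"
    unfolding square_integrable_def
  proof
    show "integrable torus (\<lambda>\<xi>. (norm (g \<xi> - trig_poly (Z 0) \<psi> \<xi>))\<^sup>2)"
      using le_less_trans[OF fatou[OF Zfin order_refl] ennreal_less_top] by (intro integrableI_bounded) auto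
  qed measurable
  have gsq: "square_integrable g"
    using square_integrable_add(1)[OF gT square_integrable_trig_poly[of "Z 0" \<psi>]] by simp
  have "((\<lambda>Y. \<integral>\<^sup>+ \<xi>. ennreal ((norm (g \<xi> - trig_poly Y \<psi> \<xi>))\<^sup>2) \<partial>torus) \<longlongrightarrow> 0) (finite_subsets_at_top UNIV)"
  proof (rule order_tendstoI)
    fix e :: ennreal assume "0 < e"
    then obtain e' where e': "0 < e'" "ennreal e' < e"
      by (metis dense ennreal_cases ennreal_less_zero_iff less_top_ennreal order.strict_trans top.not_eq_extremum)
    have "(\<lambda>m. V * (1/4) ^ m) \<longlonglongrightarrow> V * 0" by (intro tendsto_intros LIMSEQ_power_zero) auto
    then have "eventually (\<lambda>m. V * (1/4) ^ m < e') sequentially" using e' by (intro order_tendstoD) auto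
    then obtain m where m: "V * (1/4) ^ m < e'" by (auto simp: eventually_sequentially)
    show "eventually (\<lambda>Y. (\<integral>\<^sup>+ \<xi>. ennreal ((norm (g \<xi> - trig_poly Y \<psi> \<xi>))\<^sup>2) \<partial>torus) < e) (finite_subsets_at_top UNIV)"
      unfolding eventually_finite_subsets_at_top
    proof (intro exI[of _ "Z m"] conjI allI impI)
      fix Y assume "finite Y \<and> Z m \<subseteq> Y \<and> Y \<subseteq> UNIV"
      then have "(\<integral>\<^sup>+ \<xi>. ennreal ((norm (g \<xi> - trig_poly Y \<psi> \<xi>))\<^sup>2) \<partial>torus) \<le> ennreal (V * (1/4) ^ m)"
        by (intro fatou) auto
      also have "\<dots> \<le> ennreal e'" using m by (intro ennreal_leI) auto
      finally show "(\<integral>\<^sup>+ \<xi>. ennreal ((norm (g \<xi> - trig_poly Y \<psi> \<xi>))\<^sup>2) \<partial>torus) < e" using e' by simp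
    qed (use Zfin in auto)
  qed simp
  then show ?thesis
    using gsq by (auto simp: is_fourier_def square_integrable_def trig_poly_def intro!: exI[of _ g])
qed

text \<open>Bessel's inequality applied to the errors of the partial sums identifies the
  coefficients: the gap at x is bounded by the error of any large partial sum containing x.\<close>

lemma fourier_properties:
  fixes \<psi> :: "'d::finite lattice \<Rightarrow> complex"
  assumes "in_ell 2 \<psi>"
  shows trig_approximable_fourier: "trig_approximable (fourier \<psi>)"
    and fourier_coeff_fourier: "fourier_coeff (fourier \<psi>) = \<psi>"
proof -
  have F: "is_fourier \<psi> (fourier \<psi>)"
    unfolding fourier_def using riesz_fischer[OF assms] by (rule someI_ex)
  then have sq: "square_integrable (fourier \<psi>)" by (simp add: is_fourier_def square_integrable_def)
  have lim: "((\<lambda>Y. \<integral>\<^sup>+ \<xi>. ennreal ((norm (fourier \<psi> \<xi> - trig_poly Y \<psi> \<xi>))\<^sup>2) \<partial>torus) \<longlongrightarrow> 0) (finite_subsets_at_top UNIV)"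
    using F by (simp add: is_fourier_def trig_poly_def)
  have close: "\<exists>X. finite X \<and> (\<forall>Y. finite Y \<and> X \<subseteq> Y \<longrightarrow> (L2_sq (\<lambda>\<xi>. fourier \<psi> \<xi> - trig_poly Y \<psi> \<xi>)) < e)"
    if "0 < e" for e
  proof -
    have "eventually (\<lambda>Y. (\<integral>\<^sup>+ \<xi>. ennreal ((norm (fourier \<psi> \<xi> - trig_poly Y \<psi> \<xi>))\<^sup>2) \<partial>torus) < ennreal e) (finite_subsets_at_top UNIV)"
      using lim that by (intro order_tendstoD) auto
    moreover have "(\<integral>\<^sup>+ \<xi>. ennreal ((norm (fourier \<psi> \<xi> - trig_poly Y \<psi> \<xi>))\<^sup>2) \<partial>torus)
       = ennreal (L2_sq (\<lambda>\<xi>. fourier \<psi> \<xi> - trig_poly Y \<psi> \<xi>))" for Y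
      using square_integrable_diff[OF sq square_integrable_trig_poly[of Y \<psi>]]
      by (intro nn_integral_eq_integral) (auto simp: square_integrable_def)
    ultimately show ?thesis
      unfolding eventually_finite_subsets_at_top by (auto simp: ennreal_less_iff)
  qed
  show "trig_approximable (fourier \<psi>)"
    unfolding trig_approximable_def using sq close by blast
  show "fourier_coeff (fourier \<psi>) = \<psi>"
  proof
    fix x
    define V where "V = (2 * pi) ^ CARD('d)"
    have V: "0 < V" by (simp add: V_def)
    have "(norm (\<psi> x - fourier_coeff (fourier \<psi>) x))\<^sup>2 \<le> 0 + e" if "0 < e" for e
    proof -
      have "0 < V * e" using V that by simp
      from close[OF this] obtain X where X: "finite X"
        "\<And>Y. finite Y \<Longrightarrow> X \<subseteq> Y \<Longrightarrow> (L2_sq (\<lambda>\<xi>. fourier \<psi> \<xi> - trig_poly Y \<psi> \<xi>)) < V * e"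
        by blast
      have "V * (norm (\<psi> x - fourier_coeff (fourier \<psi>) x))\<^sup>2 \<le> V * (\<Sum>y\<in>insert x X. (norm (\<psi> y - fourier_coeff (fourier \<psi>) y))\<^sup>2)"
        using X(1) V by (intro mult_left_mono member_le_sum) auto
      also have "\<dots> \<le> L2_sq (\<lambda>\<xi>. fourier \<psi> \<xi> - trig_poly (insert x X) \<psi> \<xi>)"
        unfolding V_def by (rule bessel_inequality[OF sq])
      also have "\<dots> < V * e" using X(1) by (intro X(2)) auto
      finally show ?thesis using V by simp
    qed
    then have "(norm (\<psi> x - fourier_coeff (fourier \<psi>) x))\<^sup>2 \<le> 0" by (rule field_le_epsilon)
    then show "fourier_coeff (fourier \<psi>) x = \<psi> x" by simp
  qed
qed

section \<open>The uniform resolvent estimate\<close>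

abbreviation torus_pairing ::
  "(real ^ 'd::finite \<Rightarrow> complex) \<Rightarrow> (real ^ 'd \<Rightarrow> complex) \<Rightarrow> 'd lattice set \<Rightarrow> ('d lattice \<Rightarrow> complex) \<Rightarrow> complex"
  where "torus_pairing m u Y h \<equiv> \<integral>\<xi>. m \<xi> * u \<xi> * cnj (trig_poly Y h \<xi>) \<partial>torus"

text \<open>A bound that depends on h through its l^1 norm, used for integrability and for errors
  that tend to zero.\<close>

lemma norm_integral_mult_trig_poly_le:
  fixes m :: "real ^ 'd::finite \<Rightarrow> complex"
  assumes m: "m \<in> borel_measurable torus" and B: "\<And>\<xi>. norm (m \<xi>) \<le> B" and u: "square_integrable u"
  shows "integrable torus (\<lambda>\<xi>. m \<xi> * u \<xi> * cnj (trig_poly Y h \<xi>))"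
    and "norm (torus_pairing m u Y h)
      \<le> B * (\<Sum>y\<in>Y. norm (h y)) * (sqrt ((2 * pi) ^ CARD('d)) * sqrt (L2_sq u))"
proof -
  define H where "H = (\<Sum>y\<in>Y. norm (h y))"
  have B0: "0 \<le> B" using B[of 0] norm_ge_zero order_trans by blast
  have [measurable]: "m \<in> borel_measurable torus" "u \<in> borel_measurable torus"
    using m u by (auto simp: square_integrable_def)
  have iu: "integrable torus u" by (rule square_integrable_imp_integrable(1)[OF u])
  have le: "norm (m \<xi> * u \<xi> * cnj (trig_poly Y h \<xi>)) \<le> B * H * norm (u \<xi>)" for \<xi>
  proof -
    have "norm (m \<xi> * u \<xi> * cnj (trig_poly Y h \<xi>)) = (norm (m \<xi>) * norm (trig_poly Y h \<xi>)) * norm (u \<xi>)"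
      by (simp add: norm_mult mult_ac)
    also have "\<dots> \<le> (B * H) * norm (u \<xi>)"
      unfolding H_def using B0 by (intro mult_right_mono mult_mono B norm_trig_poly_le) auto
    finally show ?thesis .
  qed
  show int: "integrable torus (\<lambda>\<xi>. m \<xi> * u \<xi> * cnj (trig_poly Y h \<xi>))"
  proof (rule Bochner_Integration.integrable_bound)
    show "integrable torus (\<lambda>\<xi>. B * H * norm (u \<xi>))" using iu by simp
    show "AE \<xi> in torus. norm (m \<xi> * u \<xi> * cnj (trig_poly Y h \<xi>)) \<le> norm (B * H * norm (u \<xi>))"
      using order_trans[OF le abs_ge_self] by (intro AE_I2) (simp only: real_norm_def)
  qed measurable
  have "norm (torus_pairing m u Y h) \<le> (\<integral>\<xi>. norm (m \<xi> * u \<xi> * cnj (trig_poly Y h \<xi>)) \<partial>torus)"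
    by (rule integral_norm_bound)
  also have "\<dots> \<le> (\<integral>\<xi>. B * H * norm (u \<xi>) \<partial>torus)"
    using int iu by (intro integral_mono le integrable_norm integrable_mult_right)
  also have "\<dots> = B * H * (\<integral>\<xi>. norm (u \<xi>) \<partial>torus)" by simp
  also have "\<dots> \<le> B * H * (sqrt ((2 * pi) ^ CARD('d)) * sqrt (L2_sq u))"
    using B0 by (intro mult_left_mono square_integrable_imp_integrable(2)[OF u]) (auto simp: H_def sum_nonneg)
  finally show "norm (torus_pairing m u Y h)
      \<le> B * (\<Sum>y\<in>Y. norm (h y)) * (sqrt ((2 * pi) ^ CARD('d)) * sqrt (L2_sq u))"
    by (simp add: H_def)
qed

lemma trig_approximable_close:
  fixes m :: "real ^ 'd::finite \<Rightarrow> complex"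
  assumes G: "trig_approximable G" and \<epsilon>: "0 < \<epsilon>" and B: "0 \<le> B"
  obtains X where "finite X" "B * sqrt (L2_sq (\<lambda>\<xi>. G \<xi> - trig_poly X (fourier_coeff G) \<xi>)) \<le> \<epsilon>"
proof -
  have "0 < (\<epsilon> / (B + 1))\<^sup>2" using \<epsilon> B by simp
  from trig_approximable_fourier_series[OF G this] obtain X where X: "finite X"
    "L2_sq (\<lambda>\<xi>. G \<xi> - trig_poly X (fourier_coeff G) \<xi>) < (\<epsilon> / (B + 1))\<^sup>2" .
  have "sqrt (L2_sq (\<lambda>\<xi>. G \<xi> - trig_poly X (fourier_coeff G) \<xi>)) \<le> \<epsilon> / (B + 1)"
    using X(2) \<epsilon> B by (intro real_le_lsqrt) auto
  then have "B * sqrt (L2_sq (\<lambda>\<xi>. G \<xi> - trig_poly X (fourier_coeff G) \<xi>)) \<le> B * (\<epsilon> / (B + 1))"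
    using B by (intro mult_left_mono)
  also have "\<dots> \<le> \<epsilon>" using B \<epsilon> by (simp add: field_simps)
  finally show thesis using X(1) that by blast
qed

text \<open>The finite bound passes to G by replacing G with its partial Fourier sums. The bound B
  enters only the error, so that K alone survives as \<epsilon> tends to 0.\<close>

lemma norm_integral_form_le:
  fixes m :: "real ^ 'd::finite \<Rightarrow> complex"
  assumes m: "m \<in> borel_measurable torus" and B: "\<And>\<xi>. norm (m \<xi>) \<le> B"
    and R: "restricted_bound K (torus_form m)" and K: "0 \<le> K" and p: "0 < p" "p < 6 / 5"
    and G: "trig_approximable G" and s: "0 < s"
    and f: "\<And>X. finite X \<Longrightarrow> (\<Sum>x\<in>X. norm (fourier_coeff G x) powr p) \<le> s powr p"
    and Y: "finite Y" and h: "(\<Sum>y\<in>Y. norm (h y) powr p) \<le> 1"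
  shows "norm (torus_pairing m G Y h) \<le> K * (interpolation_const p)\<^sup>2 * s"
proof (rule field_le_epsilon)
  fix \<epsilon> :: real assume \<epsilon>: "0 < \<epsilon>"
  have sG: "square_integrable G" using G by (simp add: trig_approximable_def)
  have B0: "0 \<le> B" using B[of 0] norm_ge_zero order_trans by blast
  define c where "c = B * (\<Sum>y\<in>Y. norm (h y)) * sqrt ((2 * pi) ^ CARD('d))"
  have "0 \<le> c" using B0 by (simp add: c_def sum_nonneg)
  from trig_approximable_close[OF G \<epsilon> this] obtain X where X: "finite X"
    "c * sqrt (L2_sq (\<lambda>\<xi>. G \<xi> - trig_poly X (fourier_coeff G) \<xi>)) \<le> \<epsilon>" .
  define F where "F = trig_poly X (fourier_coeff G)"
  have sF: "square_integrable F" unfolding F_def by (rule square_integrable_trig_poly)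
  have sGF: "square_integrable (\<lambda>\<xi>. G \<xi> - F \<xi>)" by (rule square_integrable_diff[OF sG sF])
  have im: "integrable torus m" by (rule integrable_torus[OF m B])
  have "m \<xi> * G \<xi> * cnj (trig_poly Y h \<xi>) = m \<xi> * F \<xi> * cnj (trig_poly Y h \<xi>) + m \<xi> * (G \<xi> - F \<xi>) * cnj (trig_poly Y h \<xi>)" for \<xi>
    by (simp add: algebra_simps)
  then have "torus_pairing m G Y h =
      (torus_pairing m F Y h) + torus_pairing m (\<lambda>\<xi>. G \<xi> - F \<xi>) Y h"
    using norm_integral_mult_trig_poly_le(1)[OF m B sF, of Y h] norm_integral_mult_trig_poly_le(1)[OF m B sGF, of Y h]
    by simp
  also have "norm \<dots> \<le> K * (interpolation_const p)\<^sup>2 * s + \<epsilon>"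
  proof (rule norm_triangle_mono)
    have "torus_pairing m F Y h = (\<Sum>x\<in>X. \<Sum>y\<in>Y. fourier_coeff G x * cnj (h y) * torus_form m x y)"
      unfolding sum_torus_form[OF im] F_def by (simp add: mult.assoc)
    also have "norm \<dots> \<le> K * (interpolation_const p)\<^sup>2 * s"
      using h by (intro restricted_bound_imp_strong_bound[OF R p K X(1) Y s f[OF X(1)]]) simp
    finally show "norm (torus_pairing m F Y h) \<le> K * (interpolation_const p)\<^sup>2 * s" .
    have "norm (torus_pairing m (\<lambda>\<xi>. G \<xi> - F \<xi>) Y h)
      \<le> B * (\<Sum>y\<in>Y. norm (h y)) * (sqrt ((2 * pi) ^ CARD('d)) * sqrt (L2_sq (\<lambda>\<xi>. G \<xi> - F \<xi>)))"
      by (rule norm_integral_mult_trig_poly_le(2)[OF m B sGF])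
    also have "\<dots> \<le> \<epsilon>" using X(2) by (simp add: c_def F_def mult.assoc)
    finally show "norm (torus_pairing m (\<lambda>\<xi>. G \<xi> - F \<xi>) Y h) \<le> \<epsilon>" .
  qed
  finally show "norm (torus_pairing m G Y h) \<le> K * (interpolation_const p)\<^sup>2 * s + \<epsilon>" .
qed

lemma integral_mult_cnj_trig_poly:
  fixes G :: "real ^ 'd::finite \<Rightarrow> complex"
  assumes "square_integrable G"
  shows "(\<integral>\<xi>. G \<xi> * cnj (trig_poly Y h \<xi>) \<partial>torus) = of_real ((2 * pi) ^ CARD('d)) * (\<Sum>y\<in>Y. fourier_coeff G y * cnj (h y))"
proof -
  have i: "integrable torus (\<lambda>\<xi>. G \<xi> * plane_wave \<xi> x)" for x
    by (rule square_integrable_imp_integrable(1))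
       (use square_integrable_mult(1)[of "\<lambda>\<xi>. plane_wave \<xi> x" 1 G] assms in \<open>simp add: mult.commute\<close>)
  have "(\<integral>\<xi>. G \<xi> * cnj (trig_poly Y h \<xi>) \<partial>torus) = (\<integral>\<xi>. (\<Sum>y\<in>Y. cnj (h y) * (G \<xi> * plane_wave \<xi> y)) \<partial>torus)"
    by (simp add: trig_poly_def sum_distrib_left mult_ac)
  also have "\<dots> = (\<Sum>y\<in>Y. cnj (h y) * (\<integral>\<xi>. G \<xi> * plane_wave \<xi> y \<partial>torus))"
    using i by simp
  finally show ?thesis by (simp add: fourier_coeff_def sum_distrib_left mult_ac)
qed

text \<open>For fixed x, once t exceeds every |x_j|/2 by at least 1, the distance to each
  singularity is at least 1 and the kernel bound is of order t^(-3/4).\<close>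

lemma tendsto_integral_propagator:
  fixes x :: "'d::finite lattice"
  assumes d: "3 \<le> CARD('d)" and s: "s \<in> {1, -1}"
  shows "((\<lambda>t. \<integral>\<xi>. propagator (s * t) \<xi> * plane_wave \<xi> x \<partial>torus) \<longlongrightarrow> 0) at_top"
proof (rule Lim_null_comparison)
  define C where "C = (2 * pi) ^ (CARD('d) - 3) * (12 * pi\<^sup>2 + 6) ^ 3"
  define A where "A = (\<Sum>j\<in>UNIV. \<bar>real_of_int (x $ j)\<bar> / 2) + 1"
  have A: "\<bar>of_int (x $ j)\<bar> / 2 + 1 \<le> A" for j
    unfolding A_def by (intro add_right_mono member_le_sum) auto
  show "eventually (\<lambda>t. norm (propagator_kernel (s * t) x) \<le> C * (real CARD('d) * t powr (-3/4))) at_top"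
    using eventually_ge_at_top[of A]
  proof eventually_elim
    case (elim t)
    have tj: "\<bar>of_int (x $ j)\<bar> / 2 + 1 \<le> t" for j using A[of j] elim by simp
    \<comment> \<open>Any index serves here; the index type is nonempty.\<close>
    have t: "0 < t" using tj[of undefined] by linarith
    have "norm (propagator_kernel (s * t) x) \<le> C * (\<Sum>j\<in>UNIV. (t * \<bar>t - \<bar>of_int (x $ j)\<bar> / 2\<bar>) powr (-3/4))"
      unfolding C_def
    proof (rule norm_integral_propagator_le[OF d t])
      show "t \<noteq> \<bar>of_int (x $ j)\<bar> / 2" for j using tj[of j] by linarith
      show "\<bar>s * t\<bar> = t" using s t by auto
    qed
    also have "\<dots> \<le> C * (\<Sum>j\<in>(UNIV :: 'd set). t powr (-3/4))"
    proof (intro mult_left_mono sum_mono powr_mono2')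
      show "t \<le> t * \<bar>t - \<bar>of_int (x $ j)\<bar> / 2\<bar>" for j
        using tj[of j] t by (simp add: mult_le_cancel_left1)
    qed (use t in \<open>auto simp: C_def\<close>)
    finally show ?case by simp
  qed
  have "((\<lambda>t::real. t powr (-3/4)) \<longlongrightarrow> 0) at_top"
    by (intro tendsto_neg_powr filterlim_ident) auto
  then have "((\<lambda>t. C * (real CARD('d) * t powr (-3/4))) \<longlongrightarrow> C * (real CARD('d) * 0)) at_top"
    by (intro tendsto_intros)
  then show "((\<lambda>t. C * (real CARD('d) * t powr (-3/4))) \<longlongrightarrow> 0) at_top" by simp
qed

text \<open>Weak decay: the finite Fourier part of G vanishes by decay of its kernel entries, and
  the rest is small uniformly in time because the propagator is unimodular. This is what disposes of
  the boundary term at T.\<close>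

lemma propagator_form_vanishes:
  fixes G :: "real ^ 'd::finite \<Rightarrow> complex"
  assumes d: "3 \<le> CARD('d)" and s: "s \<in> {1, -1}" and G: "trig_approximable G" and \<epsilon>: "0 < \<epsilon>"
  obtains T where "0 \<le> T" "norm (torus_pairing (propagator (s * T)) G Y h) \<le> \<epsilon>"
proof -
  have sG: "square_integrable G" using G by (simp add: trig_approximable_def)
  define c where "c = 1 * (\<Sum>y\<in>Y. norm (h y)) * sqrt ((2 * pi) ^ CARD('d))"
  have c: "0 \<le> c" by (simp add: c_def sum_nonneg)
  have "0 < \<epsilon> / 2" using \<epsilon> by simp
  from trig_approximable_close[OF G this c] obtain X where X: "finite X"
    "c * sqrt (L2_sq (\<lambda>\<xi>. G \<xi> - trig_poly X (fourier_coeff G) \<xi>)) \<le> \<epsilon> / 2" .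
  define F where "F = trig_poly X (fourier_coeff G)"
  have sF: "square_integrable F" unfolding F_def by (rule square_integrable_trig_poly)
  have sGF: "square_integrable (\<lambda>\<xi>. G \<xi> - F \<xi>)" by (rule square_integrable_diff[OF sG sF])
  have m: "propagator \<tau> \<in> borel_measurable (torus :: (real ^ 'd) measure)" for \<tau>
    unfolding propagator_def[abs_def] by (rule borel_measurable_torus) measurable
  have B: "norm (propagator \<tau> \<xi>) \<le> 1" for \<tau> and \<xi> :: "real ^ 'd" by simp
  have form: "torus_pairing (propagator \<tau>) F Y h
     = (\<Sum>x\<in>X. \<Sum>y\<in>Y. fourier_coeff G x * cnj (h y) * propagator_kernel \<tau> (y - x))" for \<tau>
  proof -
    have "torus_form (propagator \<tau>) x y = propagator_kernel \<tau> (y - x)" for x y :: "'d lattice"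
      by (simp add: torus_form_def plane_wave_minus[symmetric] plane_wave_add[symmetric])
    then show ?thesis
      using sum_torus_form[OF integrable_torus[OF m B], of "fourier_coeff G" "\<lambda>y. cnj (h y)" \<tau> Y X]
      by (simp add: F_def mult.assoc)
  qed
  have "((\<lambda>t. \<Sum>x\<in>X. \<Sum>y\<in>Y. fourier_coeff G x * cnj (h y) * propagator_kernel (s * t) (y - x))
     \<longlongrightarrow> (\<Sum>x\<in>X. \<Sum>y\<in>Y. fourier_coeff G x * cnj (h y) * 0)) at_top"
    by (intro tendsto_sum tendsto_mult tendsto_const tendsto_integral_propagator d s)
  then have "((\<lambda>t. norm (torus_pairing (propagator (s * t)) F Y h)) \<longlongrightarrow> 0) at_top"
    unfolding form by (simp add: tendsto_norm_zero)
  then have "eventually (\<lambda>t. norm (torus_pairing (propagator (s * t)) F Y h) < \<epsilon> / 2) at_top"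
    using \<epsilon> by (intro order_tendstoD) auto
  then have "eventually (\<lambda>t. norm (torus_pairing (propagator (s * t)) F Y h) < \<epsilon> / 2 \<and> 0 \<le> t) at_top"
    using eventually_ge_at_top[of "0::real"] by (rule eventually_conj)
  then obtain T where T: "norm (torus_pairing (propagator (s * T)) F Y h) < \<epsilon> / 2" "0 \<le> T"
    using eventually_happens'[OF trivial_limit_at_top_linorder] by blast
  have "propagator (s * T) \<xi> * G \<xi> * cnj (trig_poly Y h \<xi>)
     = propagator (s * T) \<xi> * F \<xi> * cnj (trig_poly Y h \<xi>) + propagator (s * T) \<xi> * (G \<xi> - F \<xi>) * cnj (trig_poly Y h \<xi>)" for \<xi>
    by (simp add: algebra_simps)
  then have "torus_pairing (propagator (s * T)) G Y h =
      (torus_pairing (propagator (s * T)) F Y h)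
      + torus_pairing (propagator (s * T)) (\<lambda>\<xi>. G \<xi> - F \<xi>) Y h"
    using norm_integral_mult_trig_poly_le(1)[OF m B sF, of _ Y h] norm_integral_mult_trig_poly_le(1)[OF m B sGF, of _ Y h]
    by simp
  also have "norm \<dots> \<le> \<epsilon> / 2 + \<epsilon> / 2"
    using T(1) X(2) norm_integral_mult_trig_poly_le(2)[OF m B sGF, of "s * T" Y h]
    by (intro norm_triangle_mono) (auto simp: c_def F_def mult.assoc)
  finally show thesis using T(2) by (intro that) auto
qed

text \<open>As \<open>omega\<close> is at most 1 + 4d, such z keep distance at least 1 from its
  range, and the exact inverse symbol is bounded by 1.\<close>

lemma restricted_bound_inverse:
  fixes z :: complex
  assumes z: "2 + 4 * real CARD('d::finite) \<le> norm z"
  shows "restricted_bound ((2 * pi) ^ CARD('d)) (torus_form (\<lambda>\<xi> :: real ^ 'd. 1 / (of_real (omega \<xi>) - z)))"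
    and "norm (1 / (of_real (omega (\<xi> :: real ^ 'd)) - z)) \<le> 1"
    and "(\<lambda>\<xi> :: real ^ 'd. 1 / (of_real (omega \<xi>) - z)) \<in> borel_measurable torus"
proof -
  have ge: "1 \<le> norm (of_real (omega \<xi>) - z)" for \<xi> :: "real ^ 'd"
  proof -
    have "norm z - norm (complex_of_real (omega \<xi>)) \<le> norm (z - of_real (omega \<xi>))"
      by (rule norm_triangle_ineq2)
    then show ?thesis using z omega_le[of \<xi>] omega_ge_1[of \<xi>] by (simp add: norm_minus_commute)
  qed
  then show B: "norm (1 / (of_real (omega \<xi>) - z)) \<le> 1" for \<xi> :: "real ^ 'd"
    using ge[of \<xi>] by (simp add: norm_divide divide_le_eq)
  show m: "(\<lambda>\<xi> :: real ^ 'd. 1 / (of_real (omega \<xi>) - z)) \<in> borel_measurable torus"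
    by (rule borel_measurable_torus) measurable
  show "restricted_bound ((2 * pi) ^ CARD('d)) (torus_form (\<lambda>\<xi> :: real ^ 'd. 1 / (of_real (omega \<xi>) - z)))"
    unfolding restricted_bound_def
  proof (intro allI impI)
    fix X Y :: "'d lattice set" and f h :: "'d lattice \<Rightarrow> complex" and M N :: real
    assume fin: "finite X" "finite Y" and MN: "0 \<le> M" "0 \<le> N"
      and f: "\<forall>x\<in>X. norm (f x) \<le> M" and h: "\<forall>y\<in>Y. norm (h y) \<le> N"
    define n where "n = real (card X) * real (card Y)"
    \<comment> \<open>Being an integer, n is 0 or at least 1, so the exponent 1/2 may be raised to
      5/6.\<close>
    have n: "n = 0 \<or> 1 \<le> n" by (simp add: n_def flip: of_nat_mult) (cases "card X * card Y", auto)
    have "norm (\<Sum>x\<in>X. \<Sum>y\<in>Y. f x * h y * torus_form (\<lambda>\<xi>. 1 / (of_real (omega \<xi>) - z)) x y)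
        \<le> 1 * (2 * pi) ^ CARD('d) * M * N * n powr (1/2)"
      unfolding sum_torus_form[OF integrable_torus[OF m B]] n_def
      using f h fin MN by (intro norm_integral_trig_poly_le m B) auto
    also have "\<dots> \<le> 1 * (2 * pi) ^ CARD('d) * M * N * n powr (5/6)"
      using n MN by (intro mult_left_mono) (auto intro: powr_mono)
    finally show "norm (\<Sum>x\<in>X. \<Sum>y\<in>Y. f x * h y * torus_form (\<lambda>\<xi>. 1 / (of_real (omega \<xi>) - z)) x y)
      \<le> (2 * pi) ^ CARD('d) * M * N * (real (card X) * real (card Y)) powr (5/6)"
      by (simp add: n_def)
  qed
qed

text \<open>The constant of \<open>restricted_bound_resolvent_symbol\<close> at Z = 2 + 4d, the
  modulus where the argument for large z takes over.\<close>

definition uniform_const :: "'d::finite itself \<Rightarrow> real" where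
  "uniform_const _ = (1 + 4 * real CARD('d) + (2 + 4 * real CARD('d))) * (2 * pi) ^ CARD('d)
    + (resolvent_const TYPE('d) + (2 + 4 * real CARD('d)) * dispersive_const TYPE('d))"

lemma uniform_const_ge: "(2 * pi) ^ CARD('d::finite) \<le> uniform_const TYPE('d)"
proof -
  have dc: "0 \<le> dispersive_const TYPE('d)" by (simp add: dispersive_const_def)
  have rc: "0 \<le> resolvent_const TYPE('d)"
    unfolding resolvent_const_def using hopping_bound[where 'd = 'd]
    by (intro mult_nonneg_nonneg suminf_nonneg summable_sqrt_coeff dc) auto
  have "1 * (2 * pi) ^ CARD('d) \<le> (1 + 4 * real CARD('d) + (2 + 4 * real CARD('d))) * (2 * pi) ^ CARD('d)"
    by (intro mult_right_mono) auto
  moreover have "0 \<le> resolvent_const TYPE('d) + (2 + 4 * real CARD('d)) * dispersive_const TYPE('d)"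
    using dc rc by simp
  ultimately show ?thesis unfolding uniform_const_def by linarith
qed

text \<open>Links the operator, defined pointwise by an inverse Fourier integral, with its symbol:
  the right side of the theorem is the coefficient sequence of one approximable function.\<close>

lemma omega_minus_symbol:
  fixes \<psi> :: "'d::finite lattice \<Rightarrow> complex"
  assumes \<psi>: "in_ell 2 \<psi>"
  shows "trig_approximable (\<lambda>\<xi>. (of_real (omega \<xi>) - z) * fourier \<psi> \<xi>)"
    and "fourier_coeff (\<lambda>\<xi>. (of_real (omega \<xi>) - z) * fourier \<psi> \<xi>) = (\<lambda>x. sqrt_one_minus_laplacian \<psi> x - z * \<psi> x)"
proof -
  have ap: "trig_approximable (fourier \<psi>)" by (rule trig_approximable_fourier[OF \<psi>])
  then have sq: "square_integrable (fourier \<psi>)" by (simp add: trig_approximable_def)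
  have m: "(\<lambda>\<xi> :: real ^ 'd. of_real (omega \<xi>) - w) \<in> borel_measurable torus" for w :: complex
    by (rule borel_measurable_torus) measurable
  have B: "norm (of_real (omega \<xi>) - w) \<le> 1 + 4 * real CARD('d) + norm w" for w :: complex and \<xi> :: "real ^ 'd"
    using norm_omega_plus_le[of \<xi> "- w"] by simp
  show "trig_approximable (\<lambda>\<xi>. (of_real (omega \<xi>) - z) * fourier \<psi> \<xi>)"
    by (rule trig_approximable_mult[OF ap m B omega_minus_uniform_approx])
  have iw: "integrable torus (\<lambda>\<xi>. u \<xi> * plane_wave \<xi> x)" if "square_integrable u" for u :: "real ^ 'd \<Rightarrow> complex" and x
    by (rule square_integrable_imp_integrable(1))
       (use square_integrable_mult(1)[of "\<lambda>\<xi>. plane_wave \<xi> x" 1 u] that in \<open>simp add: mult.commute\<close>)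
  have i1: "integrable torus (\<lambda>\<xi>. of_real (omega \<xi>) * fourier \<psi> \<xi> * plane_wave \<xi> x)" for x
    by (rule iw) (use square_integrable_mult(1)[OF m B sq, of 0] in simp)
  have i2: "integrable torus (\<lambda>\<xi>. fourier \<psi> \<xi> * plane_wave \<xi> x)" for x
    by (rule iw[OF sq])
  show "fourier_coeff (\<lambda>\<xi>. (of_real (omega \<xi>) - z) * fourier \<psi> \<xi>) = (\<lambda>x. sqrt_one_minus_laplacian \<psi> x - z * \<psi> x)"
  proof
    fix x
    have "(of_real (omega \<xi>) - z) * fourier \<psi> \<xi> * plane_wave \<xi> x
       = of_real (omega \<xi>) * fourier \<psi> \<xi> * plane_wave \<xi> x - z * (fourier \<psi> \<xi> * plane_wave \<xi> x)" for \<xi>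
      by (simp add: algebra_simps)
    then have "(\<integral>\<xi>. (of_real (omega \<xi>) - z) * fourier \<psi> \<xi> * plane_wave \<xi> x \<partial>torus)
       = (\<integral>\<xi>. of_real (omega \<xi>) * fourier \<psi> \<xi> * plane_wave \<xi> x \<partial>torus) - z * (\<integral>\<xi>. fourier \<psi> \<xi> * plane_wave \<xi> x \<partial>torus)"
      using i1 i2 by simp
    then have "fourier_coeff (\<lambda>\<xi>. (of_real (omega \<xi>) - z) * fourier \<psi> \<xi>) x = sqrt_one_minus_laplacian \<psi> x - z * fourier_coeff (fourier \<psi>) x"
      by (simp add: fourier_coeff_def sqrt_one_minus_laplacian_def fourier_multiplier_def diff_divide_distrib)
    then show "fourier_coeff (\<lambda>\<xi>. (of_real (omega \<xi>) - z) * fourier \<psi> \<xi>) x = sqrt_one_minus_laplacian \<psi> x - z * \<psi> x"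
      by (simp add: fourier_coeff_fourier[OF \<psi>])
  qed
qed

text \<open>The estimate tested against finitely supported h; the power of 2 pi is the normalisation
  in \<open>integral_mult_cnj_trig_poly\<close>.\<close>

lemma uniform_resolvent_dual:
  fixes \<psi> :: "'d::finite lattice \<Rightarrow> complex"
  assumes d: "3 \<le> CARD('d)" and \<psi>: "in_ell 2 \<psi>" and p: "0 < p" "p < 6 / 5" and r: "0 < r"
    and f: "\<And>X. finite X \<Longrightarrow> (\<Sum>x\<in>X. norm (sqrt_one_minus_laplacian \<psi> x - z * \<psi> x) powr p) \<le> r powr p"
    and Y: "finite Y" and h: "(\<Sum>y\<in>Y. norm (h y) powr p) \<le> 1"
  shows "(2 * pi) ^ CARD('d) * norm (\<Sum>y\<in>Y. \<psi> y * cnj (h y)) \<le> uniform_const TYPE('d) * (interpolation_const p)\<^sup>2 * r"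
proof -
  define G where "G \<xi> = (of_real (omega \<xi>) - z) * fourier \<psi> \<xi>" for \<xi>
  have ap: "trig_approximable (fourier \<psi>)" by (rule trig_approximable_fourier[OF \<psi>])
  then have sq: "square_integrable (fourier \<psi>)" by (simp add: trig_approximable_def)
  have G: "trig_approximable G" and cG: "fourier_coeff G = (\<lambda>x. sqrt_one_minus_laplacian \<psi> x - z * \<psi> x)"
    unfolding G_def by (rule omega_minus_symbol[OF \<psi>])+
  have fG: "(\<Sum>x\<in>X. norm (fourier_coeff G x) powr p) \<le> r powr p" if "finite X" for X
    unfolding cG by (rule f[OF that])
  have U: "0 \<le> uniform_const TYPE('d)"
    by (rule order_trans[OF _ uniform_const_ge]) simp
  have pair: "(2 * pi) ^ CARD('d) * norm (\<Sum>y\<in>Y. \<psi> y * cnj (h y)) = norm (\<integral>\<xi>. fourier \<psi> \<xi> * cnj (trig_poly Y h \<xi>) \<partial>torus)"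
    unfolding integral_mult_cnj_trig_poly[OF sq] fourier_coeff_fourier[OF \<psi>] by (simp add: norm_mult norm_power)
  show ?thesis
  proof (cases "2 + 4 * real CARD('d) \<le> norm z")
    case True
    define m where "m \<xi> = 1 / (of_real (omega \<xi>) - z)" for \<xi> :: "real ^ 'd"
    have "of_real (omega \<xi>) \<noteq> z" for \<xi> :: "real ^ 'd"
      using True omega_le[of \<xi>] omega_ge_1[of \<xi>] by (auto simp flip: of_real_add)
    then have "m \<xi> * G \<xi> = fourier \<psi> \<xi>" for \<xi> by (simp add: m_def G_def)
    then have "(2 * pi) ^ CARD('d) * norm (\<Sum>y\<in>Y. \<psi> y * cnj (h y)) = norm (torus_pairing m G Y h)"
      unfolding pair by simp
    also have "\<dots> \<le> (2 * pi) ^ CARD('d) * (interpolation_const p)\<^sup>2 * r"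
      unfolding m_def using restricted_bound_inverse[OF True]
      by (intro norm_integral_form_le[OF _ _ _ _ p G r fG Y h]) auto
    also have "\<dots> \<le> uniform_const TYPE('d) * (interpolation_const p)\<^sup>2 * r"
      using r by (intro mult_right_mono uniform_const_ge) auto
    finally show ?thesis .
  next
    case False
    show ?thesis
    proof (rule field_le_epsilon)
      fix \<epsilon> :: real assume \<epsilon>: "0 < \<epsilon>"
      define s :: real where "s = (if 0 \<le> Im (z\<^sup>2) then 1 else -1)"
      have s: "s \<in> {1, -1}" "0 \<le> s * Im (z\<^sup>2)" by (auto simp: s_def)
      \<comment> \<open>T depends on Y, h and \<epsilon>, which is allowed because the restricted
        bound has the same constant for all T.\<close>
      obtain T where T: "0 \<le> T" "norm (torus_pairing (propagator (s * T)) (fourier \<psi>) Y h) \<le> \<epsilon>"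
        using propagator_form_vanishes[OF d s(1) ap \<epsilon>] .
      define m where "m = (resolvent_symbol s z T :: real ^ 'd \<Rightarrow> complex)"
      define e where "e = exp (\<i> * of_real s * of_real T * z\<^sup>2)"
      have e: "norm e \<le> 1" unfolding e_def by (rule norm_exp_time_le[OF T(1) s(2)])
      have pm: "propagator (s * T) \<in> borel_measurable (torus :: (real ^ 'd) measure)"
        unfolding propagator_def[abs_def] by (rule borel_measurable_torus) measurable
      have mm: "m \<in> borel_measurable torus" unfolding m_def by (rule resolvent_symbol_measurable)
      have mB: "norm (m \<xi>) \<le> T * (1 + 4 * real CARD('d) + norm z)" for \<xi>
        unfolding m_def by (rule resolvent_symbol_bounded[OF T(1) s(2)])
      have sG: "square_integrable G" using G by (simp add: trig_approximable_def)
      \<comment> \<open>Duhamel's formula in symbols: the first term contains (\<open>omega\<close>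
        - z) times the transform of \<psi>, the second is the remainder at time T.\<close>
      have "fourier \<psi> \<xi> * cnj (trig_poly Y h \<xi>) = \<i> * of_real s * (m \<xi> * G \<xi> * cnj (trig_poly Y h \<xi>))
         + e * (propagator (s * T) \<xi> * fourier \<psi> \<xi> * cnj (trig_poly Y h \<xi>))" for \<xi>
      proof -
        have "\<i> * of_real s * (m \<xi> * G \<xi> * cnj (trig_poly Y h \<xi>))
          = (\<i> * of_real s * (of_real (omega \<xi>) - z) * resolvent_symbol s z T \<xi>) * (fourier \<psi> \<xi> * cnj (trig_poly Y h \<xi>))"
          by (simp add: m_def G_def mult_ac)
        then show ?thesis
          unfolding resolvent_symbol_eq[OF T(1)] by (simp add: e_def algebra_simps)
      qed
      then have "(\<integral>\<xi>. fourier \<psi> \<xi> * cnj (trig_poly Y h \<xi>) \<partial>torus) = \<i> * of_real s * torus_pairing m G Y h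
         + e * torus_pairing (propagator (s * T)) (fourier \<psi>) Y h"
        using norm_integral_mult_trig_poly_le(1)[OF mm mB sG, of Y h] norm_integral_mult_trig_poly_le(1)[OF pm _ sq, of 1 Y h]
        by simp
      also have "norm \<dots> \<le> uniform_const TYPE('d) * (interpolation_const p)\<^sup>2 * r + \<epsilon>"
      proof (rule norm_triangle_mono)
        have "norm (torus_pairing m G Y h) \<le> uniform_const TYPE('d) * (interpolation_const p)\<^sup>2 * r"
        proof (rule norm_integral_form_le[OF mm mB _ U p G r fG Y h])
          show "restricted_bound (uniform_const TYPE('d)) (torus_form m)"
            unfolding m_def uniform_const_def using False by (intro restricted_bound_resolvent_symbol[OF d T(1) s]) auto
        qed
        then show "norm (\<i> * of_real s * torus_pairing m G Y h) \<le> uniform_const TYPE('d) * (interpolation_const p)\<^sup>2 * r"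
          using s(1) by (auto simp: norm_mult)
        have "norm (e * torus_pairing (propagator (s * T)) (fourier \<psi>) Y h) \<le> 1 * \<epsilon>"
          unfolding norm_mult using e T(2) by (intro mult_mono) auto
        then show "norm (e * torus_pairing (propagator (s * T)) (fourier \<psi>) Y h) \<le> \<epsilon>" by simp
      qed
      finally show "(2 * pi) ^ CARD('d) * norm (\<Sum>y\<in>Y. \<psi> y * cnj (h y)) \<le> uniform_const TYPE('d) * (interpolation_const p)\<^sup>2 * r + \<epsilon>"
        unfolding pair .
    qed
  qed
qed

text \<open>The extremal test function for Hoelder's inequality is inserted: it has l^p norm 1 on Y
  and its pairing with \<psi> equals the l^p' norm of \<psi> on Y.\<close>

lemma sum_powr_le_by_duality:
  fixes \<psi> :: "'a \<Rightarrow> complex"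
  assumes p: "1 < p" and p': "1 / p + 1 / p' = 1" and Y: "finite Y" and C: "0 \<le> C"
    and dual: "\<And>h. (\<Sum>y\<in>Y. norm (h y) powr p) \<le> 1 \<Longrightarrow> norm (\<Sum>y\<in>Y. \<psi> y * cnj (h y)) \<le> C"
  shows "(\<Sum>y\<in>Y. norm (\<psi> y) powr p') \<le> C powr p'"
proof -
  define W where "W = (\<Sum>y\<in>Y. norm (\<psi> y) powr p')"
  have W0: "0 \<le> W" by (simp add: W_def sum_nonneg)
  have "1 / p' = 1 - 1 / p" using p' by simp
  moreover have "1 - 1 / p > 0" using p by simp
  ultimately have p'0: "0 < p'" by (metis zero_less_divide_1_iff)
  have pp: "(p' - 1) * p = p'" using p' p p'0 by (simp add: field_simps)
  show ?thesis
  proof (cases "W = 0")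
    case True
    then show ?thesis by (simp add: W_def)
  next
    case False
    then have W: "0 < W" using W0 by simp
    define h where "h y = of_real (norm (\<psi> y) powr (p' - 1) / (W powr (1 / p))) * sgn (\<psi> y)" for y
    have nh: "norm (h y) powr p = norm (\<psi> y) powr p' / W" for y
    proof (cases "\<psi> y = 0")
      case True
      then show ?thesis by (simp add: h_def)
    next
      case False
      then have "norm (h y) = norm (\<psi> y) powr (p' - 1) / (W powr (1 / p))"
        by (simp add: h_def norm_mult norm_sgn norm_divide)
      then show ?thesis using p W by (simp add: powr_divide powr_powr pp)
    qed
    have "(\<Sum>y\<in>Y. norm (h y) powr p) \<le> 1"
      unfolding nh using W by (simp add: sum_divide_distrib[symmetric] W_def)
    then have "norm (\<Sum>y\<in>Y. \<psi> y * cnj (h y)) \<le> C" by (rule dual)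
    moreover have "\<psi> y * cnj (h y) = of_real (norm (\<psi> y) powr p' / W powr (1 / p))" for y
    proof (cases "\<psi> y = 0")
      case False
      have "\<psi> y * cnj (sgn (\<psi> y)) = of_real (norm (\<psi> y))"
        using False by (simp add: sgn_div_norm scaleR_conv_of_real complex_norm_square[symmetric] power2_eq_square field_simps)
      then have "\<psi> y * cnj (h y) = of_real (norm (\<psi> y) * (norm (\<psi> y) powr (p' - 1) / W powr (1 / p)))"
        by (simp add: h_def mult_ac)
      also have "norm (\<psi> y) * (norm (\<psi> y) powr (p' - 1) / W powr (1 / p)) = norm (\<psi> y) powr p' / W powr (1 / p)"
        using False by (simp add: powr_diff)
      finally show ?thesis .
    qed simp
    then have "(\<Sum>y\<in>Y. \<psi> y * cnj (h y)) = of_real (W / W powr (1 / p))"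
      by (simp add: W_def sum_divide_distrib)
    moreover have "W / W powr (1 / p) = W powr (1 / p')"
    proof -
      have "1 / p' = 1 - 1 / p" using p' by simp
      then show ?thesis using W by (simp add: powr_diff)
    qed
    ultimately have "W powr (1 / p') \<le> C" by simp
    then have "(W powr (1 / p')) powr p' \<le> C powr p'" using p'0 by (intro powr_mono2) auto
    then show ?thesis using p'0 W by (simp add: powr_powr W_def)
  qed
qed

theorem theorem5:
  fixes \<sigma> :: real
  assumes "(CARD('d::finite) = 3 \<and> \<sigma> = 7 / 6) \<or>
           (CARD('d) = 4 \<and> (\<exists>\<delta>. 0 < \<delta> \<and> \<delta> < 1 / 2 \<and> \<sigma> = 3 / 2 - \<delta>))"
  shows "\<exists>C::real. C > 0 \<and> (\<forall>(z::complex) (\<psi> :: 'd lattice \<Rightarrow> complex). in_ell 2 \<psi> \<longrightarrow>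
           ell_norm (2 * \<sigma> / (\<sigma> - 1)) \<psi>
             \<le> ennreal C * ell_norm (2 * \<sigma> / (\<sigma> + 1))
                  (\<lambda>x. sqrt_one_minus_laplacian \<psi> x - z * \<psi> x))"
proof -
  define p where "p = 2 * \<sigma> / (\<sigma> + 1)"
  define p' where "p' = 2 * \<sigma> / (\<sigma> - 1)"
  \<comment> \<open>All that is used of the two cases: at least three dimensions, and 1 < \<sigma> <
    3/2, which amounts to 1 < p < 6/5.\<close>
  have d: "3 \<le> CARD('d)" and \<sigma>: "1 < \<sigma>" "\<sigma> < 3 / 2" using assms by auto
  have p: "1 < p" "p < 6 / 5" using \<sigma> by (auto simp: p_def field_simps)
  have p'0: "0 < p'" using \<sigma> by (simp add: p'_def)
  have conj: "1 / p + 1 / p' = 1" using \<sigma> by (simp add: p_def p'_def field_simps)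
  define V where "V = (2 * pi) ^ CARD('d)"
  have V: "0 < V" by (simp add: V_def)
  \<comment> \<open>Division by V restores the normalisation omitted from the torus
    integrals.\<close>
  define C where "C = uniform_const TYPE('d) * (interpolation_const p)\<^sup>2 / V"
  have C: "0 < C"
    unfolding C_def using V interpolation_const_pos[OF p(2)] less_le_trans[OF V uniform_const_ge[where 'd = 'd, folded V_def]]
    by (intro divide_pos_pos mult_pos_pos) auto
  have "ell_norm p' \<psi> \<le> ennreal C * ell_norm p (\<lambda>x. sqrt_one_minus_laplacian \<psi> x - z * \<psi> x)"
    if \<psi>: "in_ell 2 \<psi>" for z and \<psi> :: "'d lattice \<Rightarrow> complex"
  proof -
    define f where "f x = sqrt_one_minus_laplacian \<psi> x - z * \<psi> x" for x
    show ?thesis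
    proof (cases "in_ell p f")
      case False
      then show ?thesis using C by (simp add: ell_norm_def f_def[abs_def] ennreal_mult_top)
    next
      case True
      define I where "I = (\<Sum>\<^sub>\<infinity>x. norm (f x) powr p)"
      define N where "N = I powr (1 / p)"
      have I0: "0 \<le> I" unfolding I_def by (intro infsum_nonneg) auto
      have N0: "0 \<le> N" by (simp add: N_def)
      have fin_le: "(\<Sum>x\<in>X. norm (f x) powr p) \<le> I" if "finite X" for X
        using True that unfolding I_def in_ell_def by (intro finite_sum_le_infsum) auto
      \<comment> \<open>A strictly positive r replaces N, since the bilinear estimate rescales by it
        and N may be 0.\<close>
      have key: "(\<Sum>y\<in>Y. norm (\<psi> y) powr p') \<le> (C * r) powr p'" if r: "0 < r" "N \<le> r" and Y: "finite Y" for r Y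
      proof (rule sum_powr_le_by_duality[OF p(1) conj Y])
        show "0 \<le> C * r" using C r by simp
        fix h :: "'d lattice \<Rightarrow> complex" assume h: "(\<Sum>y\<in>Y. norm (h y) powr p) \<le> 1"
        have "I = N powr p" using p I0 by (simp add: N_def powr_powr)
        also have "\<dots> \<le> r powr p" using r p N0 by (intro powr_mono2) auto
        finally have "I \<le> r powr p" .
        then have "(\<Sum>x\<in>X. norm (sqrt_one_minus_laplacian \<psi> x - z * \<psi> x) powr p) \<le> r powr p" if "finite X" for X
          using fin_le[OF that] by (simp add: f_def)
        then have "V * norm (\<Sum>y\<in>Y. \<psi> y * cnj (h y)) \<le> uniform_const TYPE('d) * (interpolation_const p)\<^sup>2 * r"
          unfolding V_def using p by (intro uniform_resolvent_dual[OF d \<psi> _ p(2) r(1) _ Y h]) auto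
        then show "norm (\<Sum>y\<in>Y. \<psi> y * cnj (h y)) \<le> C * r"
          using V by (simp add: C_def field_simps)
      qed
      \<comment> \<open>Membership of \<psi> in l^p' is part of the claim, as
        \<open>ell_norm\<close> would otherwise be infinite; bounded finite sums provide it.\<close>
      have sum': "(\<lambda>x. norm (\<psi> x) powr p') summable_on UNIV"
        using key[of "N + 1"] N0 by (intro nonneg_bdd_above_summable_on bdd_aboveI2) auto
      define L where "L = (\<Sum>\<^sub>\<infinity>x. norm (\<psi> x) powr p') powr (1 / p')"
      have "L \<le> C * N"
      proof (rule field_le_epsilon)
        fix \<epsilon> :: real assume \<epsilon>: "0 < \<epsilon>"
        \<comment> \<open>Chosen so that C r = C N + \<epsilon>.\<close>
        define r where "r = N + \<epsilon> / C"
        have r: "0 < r" "N \<le> r" using \<epsilon> C N0 by (auto simp: r_def add_nonneg_pos)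
        have "(\<Sum>\<^sub>\<infinity>x. norm (\<psi> x) powr p') \<le> (C * r) powr p'"
          using key[OF r] by (intro infsum_le_finite_sums sum') auto
        then have "L \<le> ((C * r) powr p') powr (1 / p')"
          unfolding L_def using p'0 by (intro powr_mono2 infsum_nonneg) auto
        also have "\<dots> = C * r" using p'0 C r by (simp add: powr_powr)
        also have "\<dots> = C * N + \<epsilon>" using C by (simp add: r_def field_simps)
        finally show "L \<le> C * N + \<epsilon>" .
      qed
      then have "ennreal L \<le> ennreal C * ennreal N"
        using C by (simp add: ennreal_mult'[symmetric] ennreal_leI)
      then show ?thesis
        using True sum' by (simp add: ell_norm_def in_ell_def L_def N_def I_def f_def[symmetric])
    qed
  qed
  then show ?thesis using C unfolding p_def p'_def by blast
qed

end
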